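(* Let $0<p,q<\infty$ and let $\{X_n\}_{n\ge 1}$ be a standard random sequence. Then $\mathcal{R}f\in\mathscr{H}^q$ almost surely for each $f\in\mathscr{H}^p$ if and only if $p\geq 2$.
   Context: A standard random sequence $\{X_n\}$ is a sequence of independent identically distributed random variables on a probability space, all of one of the following three types: Bernoulli ($\mathbb{P}(X_n=1)=\mathbb{P}(X_n=-1)=1/2$), Steinhaus (uniformly distributed on the unit circle), or Gaussian $N(0,1)$ (zero mean, unit variance). For $\theta\in\mathbb{R}$ let $\mathbb{C}_\theta=\{s\in\mathbb{C}:\Re s>\theta\}$. $\mathcal{D}$ is the space of Dirichlet series $\sum_{n\ge1}a_nn^{-s}$ ($a_n\in\mathbb{C}$) converging on some half plane $\mathbb{C}_\theta$, and $\mathcal{P}$ is the space of Dirichlet polynomials $\sum_{n=1}^Na_nn^{-s}$. For $f(s)=\sum_{n\ge1}a_nn^{-s}$ in $\mathcal{D}$, the randomization is $\mathcal{R}f(s)=\sum_{n\ge1}a_nX_nn^{-s}$. Let $p_j$ be the $j$th prime and write $n=\prod_j p_j^{\nu_j(n)}$. The Bohr lift of $P(s)=\sum_{n=1}^N a_nn^{-s}$ is $\mathscr{B}P(z)=\sum_{n=1}^N a_nz^{\nu(n)}$, where $z=(z_1,z_2,\dots)$ and $z^{\nu(n)}=\prod_jz_j^{\nu_j(n)}$. For $0<p<\infty$, $\mathscr{H}^p$ is the completion of $\mathcal{P}$ with respect to the (quasi-)norm $\|P\|_{\mathscr{H}^p}=\left(\int_{\mathbb{T}^\infty}|\mathscr{B}P(z)|^p\,dm_\infty(z)\right)^{1/p}$,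 where $m_\infty$ is the Haar probability measure on the infinite torus $\mathbb{T}^\infty$. Every element of $\mathscr{H}^p$ is identified with a Dirichlet series in $\mathcal{D}$ converging uniformly on $\mathbb{C}_{1/2+\epsilon}$ for every $\epsilon>0$. *)

theory Defs
  imports "HOL-Probability.Probability" "HOL-Computational_Algebra.Primes"
begin

text \<open>
  A Dirichlet series is represented by its coefficient sequence \<open>a :: nat \<Rightarrow> complex\<close>;
  the coefficients are \<open>a 1, a 2, \<dots>\<close>, and the value \<open>a 0\<close> is ignored by every definition.
\<close>

definition half_plane :: "real \<Rightarrow> complex set" where
  "half_plane \<theta> = {s. Re s > \<theta>}"

definition dirichlet_partial_sum :: "(nat \<Rightarrow> complex) \<Rightarrow> nat \<Rightarrow> complex \<Rightarrow> complex" where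
  "dirichlet_partial_sum a N s = (\<Sum>n=1..N. a n * of_nat n powr (- s))"

definition dirichlet_series :: "(nat \<Rightarrow> complex) \<Rightarrow> complex \<Rightarrow> complex" where
  "dirichlet_series a s = lim (\<lambda>N. dirichlet_partial_sum a N s)"

definition dirichlet_space :: "(nat \<Rightarrow> complex) set" where
  "dirichlet_space =
     {a. \<exists>\<theta>. \<forall>s\<in>half_plane \<theta>. convergent (\<lambda>N. dirichlet_partial_sum a N s)}"

definition dirichlet_polynomials :: "(nat \<Rightarrow> complex) set" where
  "dirichlet_polynomials = {a. finite {n. a n \<noteq> 0}}"

text \<open>Primes and the coordinates of the infinite torus are both indexed from \<open>0\<close>.\<close>

definition nth_prime :: "nat \<Rightarrow> nat" where
  "nth_prime j = enumerate {p. prime p} j"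

text \<open>
  The product \<open>z\<^sup>\<nu>\<^sup>(\<^sup>n\<^sup>)\<close> over all \<open>j\<close> is restricted to the finitely many \<open>j\<close> with nonzero exponent.
\<close>

definition bohr_monomial :: "nat \<Rightarrow> (nat \<Rightarrow> complex) \<Rightarrow> complex" where
  "bohr_monomial n z =
     (\<Prod>j | nth_prime j dvd n. z j ^ multiplicity (nth_prime j) n)"

definition bohr_lift :: "(nat \<Rightarrow> complex) \<Rightarrow> (nat \<Rightarrow> complex) \<Rightarrow> complex" where
  "bohr_lift a z = (\<Sum>n | n \<ge> 1 \<and> a n \<noteq> 0. a n * bohr_monomial n z)"

text \<open>
  Normalized arc length, as a Borel measure on the complex plane carried by the unit circle.
  The Haar probability measure of the infinite torus is the countable product of its copies.
\<close>

definition circle_measure :: "complex measure" where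
  "circle_measure = distr (uniform_measure lborel {0..2 * pi}) borel cis"

definition torus_measure :: "(nat \<Rightarrow> complex) measure" where
  "torus_measure = Pi\<^sub>M UNIV (\<lambda>_. circle_measure)"

definition Hp_norm :: "real \<Rightarrow> (nat \<Rightarrow> complex) \<Rightarrow> real" where
  "Hp_norm p a = (\<integral>z. norm (bohr_lift a z) powr p \<partial>torus_measure) powr (1 / p)"

definition Hp_Cauchy :: "real \<Rightarrow> (nat \<Rightarrow> nat \<Rightarrow> complex) \<Rightarrow> bool" where
  "Hp_Cauchy p P \<longleftrightarrow>
     (\<forall>\<epsilon>>0. \<exists>K. \<forall>k\<ge>K. \<forall>l\<ge>K. Hp_norm p (\<lambda>n. P k n - P l n) < \<epsilon>)"

text \<open>
  An element of the completion of the Dirichlet polynomials is represented by a sequence \<open>P\<close> of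
  Dirichlet polynomials that is Cauchy for the (quasi-)norm. It is identified with the Dirichlet
  series \<open>a\<close> which converges uniformly on each half plane to the right of \<open>1/2\<close> and is there
  the uniform limit of \<open>P\<close>. The space consists of the series arising in this way.
\<close>

definition Hp_space :: "real \<Rightarrow> (nat \<Rightarrow> complex) set" where
  "Hp_space p = {a \<in> dirichlet_space.
     (\<forall>\<epsilon>>0. uniform_limit (half_plane (1/2 + \<epsilon>))
        (dirichlet_partial_sum a) (dirichlet_series a) sequentially) \<and>
     (\<exists>P. (\<forall>k. P k \<in> dirichlet_polynomials) \<and> Hp_Cauchy p P \<and>
        (\<forall>\<epsilon>>0. uniform_limit (half_plane (1/2 + \<epsilon>))
           (\<lambda>k. dirichlet_series (P k)) (dirichlet_series a) sequentially))}"

definition bernoulli_variable :: "'w measure \<Rightarrow> ('w \<Rightarrow> complex) \<Rightarrow> bool" where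
  "bernoulli_variable M Y \<longleftrightarrow> Y \<in> borel_measurable M \<and>
     measure M {\<omega> \<in> space M. Y \<omega> = 1} = 1/2 \<and> measure M {\<omega> \<in> space M. Y \<omega> = -1} = 1/2"

definition steinhaus_variable :: "'w measure \<Rightarrow> ('w \<Rightarrow> complex) \<Rightarrow> bool" where
  "steinhaus_variable M Y \<longleftrightarrow> Y \<in> borel_measurable M \<and> distr M borel Y = circle_measure"

text \<open>The real standard normal law, transported to the complex plane.\<close>

definition gaussian_variable :: "'w measure \<Rightarrow> ('w \<Rightarrow> complex) \<Rightarrow> bool" where
  "gaussian_variable M Y \<longleftrightarrow> Y \<in> borel_measurable M \<and>
     distr M borel Y = distr (density lborel std_normal_density) borel complex_of_real"

definition standard_random_sequence :: "'w measure \<Rightarrow> (nat \<Rightarrow> 'w \<Rightarrow> complex) \<Rightarrow> bool" where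
  "standard_random_sequence M X \<longleftrightarrow>
     prob_space M \<and> prob_space.indep_vars M (\<lambda>_. borel) X {1..} \<and>
     ((\<forall>n\<ge>1. bernoulli_variable M (X n)) \<or>
      (\<forall>n\<ge>1. steinhaus_variable M (X n)) \<or>
      (\<forall>n\<ge>1. gaussian_variable M (X n)))"

definition randomization ::
  "(nat \<Rightarrow> 'w \<Rightarrow> complex) \<Rightarrow> (nat \<Rightarrow> complex) \<Rightarrow> 'w \<Rightarrow> nat \<Rightarrow> complex" where
  "randomization X a \<omega> n = a n * X n \<omega>"

end

(*
  For p >= 2 an element of H^p has square summable
  coefficients, because |x|^2 <= 1 + |x|^p. All three types of random variables are subgaussian,
  E exp(Re(c X)) <= exp(|c|^2 / 2), so a random sum of variance s^2 has q-th moments of order s^q.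
  Applied to blocks of the randomized series with rapidly decreasing variance, together with
  Fubini on the product of the probability space and the torus, this makes the partial sums Cauchy
  in H^q almost surely.

  For p < 2, sums of disjoint blocks of normalized Dirichlet kernels in one variable give an
  element of H^p whose coefficients are not square summable. If its randomization were in H^q
  almost surely, the polynomials approximating it would be bounded in H^q. Killing all variables
  but the first and dilating by r < 1 do not increase the norm: flipping the zeros of a polynomial
  Q out of the disc gives G with |Q| <= |G| in the disc and |Q| = |G| on the circle, and |G|^q is
  a uniform limit of squares |g|^2 of polynomials, for which Parseval applies. So almost surely the
  q-th means of the dilations of the random series over the circle stay bounded. By Fubini the q-th
  moments at a fixed point, on an event of probability close to 1, are bounded too; but the second
  and fourth moments force them to be comparable to a power of the variance, which is unbounded.
*)
theory Submission
  imports Defs "HOL-Computational_Algebra.Fundamental_Theorem_Algebra"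
begin

section \<open>The circle\<close>

text \<open>Both exponents may lie below 1, where the quasi-norm has no triangle inequality and a
  plain cut-off at a given degree is not under control. Three devices work for every exponent: sums
  of blocks are estimated with geometric weights \<open>2 ^ i\<close>;
  \<open>norm (poly G z) powr q\<close> is traded for the squared modulus of a polynomial, so that
  coefficient arguments apply; and a dilation makes high coefficients so small that a cut-off after
  it is harmless. The cut-off is needed because membership in \<open>Hp_space\<close> yields
  convergence of the approximating polynomials only one coefficient at a time, so that finite
  sections are what passes to the limit, and because the moment bounds concern finite random sums.
  Almost sure membership gives a bound that depends on the outcome, with no integrability. Hence the
  passage to an event of probability close to 1, on which the bound is uniform; the fourth moment
  shows that the discarded outcomes carry only a small part of the variance.\<close>

lemma sets_circle_measure [measurable_cong]: "sets circle_measure = sets borel"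
  by (simp add: circle_measure_def)

lemma space_circle_measure [simp]: "space circle_measure = UNIV"
  by (simp add: circle_measure_def)

lemma cis_measurable [measurable]: "cis \<in> borel_measurable borel"
  by (intro borel_measurable_continuous_onI continuous_intros)

lemma prob_space_circle_measure: "prob_space circle_measure"
  unfolding circle_measure_def
  by (intro prob_space.prob_space_distr prob_space_uniform_measure) auto

lemma integral_circle:
  fixes f :: "complex \<Rightarrow> complex"
  assumes [measurable]: "f \<in> borel_measurable borel"
  shows "integral\<^sup>L circle_measure f = (LBINT x:{0..2*pi}. f (cis x)) / (2 * pi)"
proof -
  have "integral\<^sup>L circle_measure f = (\<integral>x. f (cis x) \<partial>uniform_measure lborel {0..2*pi})"
    unfolding circle_measure_def by (rule integral_distr) auto
  also have "\<dots> = (\<integral>x. f (cis x) \<partial>density lborel (\<lambda>x. ennreal (indicator {0..2*pi} x / (2*pi))))"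
    unfolding uniform_measure_def
    by (rule arg_cong2[where f="integral\<^sup>L"], rule density_cong)
       (auto simp: divide_ennreal[symmetric] indicator_def)
  also have "\<dots> = (\<integral>x. (indicator {0..2*pi} x / (2*pi)) *\<^sub>R f (cis x) \<partial>lborel)"
    by (rule integral_density) (auto simp: indicator_def)
  also have "\<dots> = (\<integral>x. (indicator {0..2*pi} x *\<^sub>R f (cis x)) / (2*pi) \<partial>lborel)"
    by (intro Bochner_Integration.integral_cong) (auto simp: scaleR_conv_of_real)
  also have "\<dots> = (LBINT x:{0..2*pi}. f (cis x)) / (2 * pi)"
    unfolding set_lebesgue_integral_def by (rule integral_divide_zero)
  finally show ?thesis .
qed

lemma AE_circle_if_finite:
  assumes [measurable]: "Measurable.pred borel P" and "finite {x\<in>{0..2*pi}. \<not> P (cis x)}"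
  shows "AE z in circle_measure. P z"
proof -
  have "AE x in lborel. x \<in> {0..2*pi} \<longrightarrow> P (cis x)"
    using AE_lborel_singleton finite_imp_null_set_lborel[OF assms(2)]
    by (rule_tac AE_I'[of "{x\<in>{0..2*pi}. \<not> P (cis x)}"]) auto
  then show ?thesis
    unfolding circle_measure_def
    by (subst AE_distr_iff) (auto intro!: AE_uniform_measureI)
qed

lemma AE_circle_norm: "AE z in circle_measure. norm z = 1"
  by (rule AE_circle_if_finite) auto

text \<open>The point 1 is the only one on the circle at which the geometric sums of the Dirichlet
  kernel are unbounded.\<close>

lemma AE_circle_ne_1: "AE z in circle_measure. z \<noteq> 1"
proof (rule AE_circle_if_finite)
  have "x \<in> {0, 2*pi}" if x: "x \<in> {0..2*pi}" and "cis x = 1" for x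
  proof -
    have "cos x = 1" using that(2) by (metis cis.sel(1) one_complex.sel(1))
    then obtain n :: int where n: "x = real_of_int n * 2 * pi" using cos_one_2pi_int by blast
    then have "0 \<le> n" "n \<le> 1" using x pi_gt_zero
      by (auto simp: zero_le_mult_iff mult_le_cancel_right)
    then have "n = 0 \<or> n = 1" by linarith
    then show ?thesis using n by auto
  qed
  then have "{x\<in>{0..2*pi}. \<not> (cis x \<noteq> 1)} \<subseteq> {0, 2*pi}" by auto
  then show "finite {x\<in>{0..2*pi}. \<not> (cis x \<noteq> 1)}" by (rule finite_subset) auto
qed auto

lemma circle_integrable:
  fixes f :: "complex \<Rightarrow> 'b::{banach, second_countable_topology}"
  assumes "continuous_on UNIV f"
  shows "integrable circle_measure f"
proof -
  interpret prob_space circle_measure by (rule prob_space_circle_measure)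
  have "compact (f ` sphere 0 1)"
    using assms by (intro compact_continuous_image) (auto intro: continuous_on_subset)
  then obtain B where "\<And>z. z \<in> sphere 0 1 \<Longrightarrow> norm (f z) \<le> B"
    using compact_imp_bounded bounded_iff by (metis imageI)
  then show ?thesis
    using AE_circle_norm assms
    by (intro integrable_const_bound[of _ B]) 
       (auto intro: borel_measurable_continuous_onI simp: circle_measure_def)
qed

lemma circle_orthonormal:
  "(\<integral>z. z ^ j * cnj (z ^ k) \<partial>circle_measure) = (if j = k then 1 else 0)"
proof -
  interpret prob_space circle_measure by (rule prob_space_circle_measure)
  have "(\<integral>z. z ^ j * cnj (z ^ k) \<partial>circle_measure) =
     (LBINT x:{0..2*pi}. cis x ^ j * cnj (cis x ^ k)) / (2 * pi)"
    by (rule integral_circle) (intro borel_measurable_continuous_onI continuous_intros)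
  also have "(LBINT x:{0..2*pi}. cis x ^ j * cnj (cis x ^ k)) = (LBINT x:{0..2*pi}. cis ((real j - real k) * x))"
    by (intro set_lebesgue_integral_cong) (auto simp: cis_cnj Complex.DeMoivre cis_mult algebra_simps simp flip: complex_cnj_power)
  also have "\<dots> = (if j = k then 2 * pi else 0)"
  proof (cases "j = k")
    case True
    then show ?thesis by (simp add: set_lebesgue_integral_def scaleR_conv_of_real)
  next
    case False
    define d where "d = real j - real k"
    have d: "d \<noteq> 0" using False by (simp add: d_def)
    have "(LBINT x:{0..2*pi}. cis (d * x)) = cis (d * (2*pi)) / (\<i> * d) - cis (d * 0) / (\<i> * d)"
      unfolding set_lebesgue_integral_def
    proof (rule integral_FTC_Icc)
      show "((\<lambda>x. cis (d * x) / (\<i> * d)) has_vector_derivative cis (d * x)) (at x within {0..2*pi})" for x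
        unfolding cis_conv_exp
        by (auto intro!: derivative_eq_intros has_vector_derivative_real_field simp: d field_simps)
      show "continuous_on {0..2*pi} (\<lambda>x. cis (d * x))" by (intro continuous_intros)
    qed auto
    \<comment> \<open>\<open>d\<close> is a difference of naturals, so the primitive takes the same
      value at both ends of the period.\<close>
    also have "cis (d * (2*pi)) = cis (2*pi* (int j - int k))" by (simp add: d_def mult.commute)
    also have "\<dots> = 1" by (rule cis_multiple_2pi) auto
    finally show ?thesis using False by (simp add: d_def)
  qed
  finally show ?thesis by simp
qed

lemma circle_parseval:
  fixes c :: "nat \<Rightarrow> complex"
  assumes "finite A"
  shows "(\<integral>z. (norm (\<Sum>j\<in>A. c j * z ^ j))\<^sup>2 \<partial>circle_measure) = (\<Sum>j\<in>A. (norm (c j))\<^sup>2)"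
proof -
  have int: "integrable circle_measure (\<lambda>z. (norm (\<Sum>j\<in>A. c j * z ^ j))\<^sup>2)"
    by (intro circle_integrable continuous_intros)
  have "complex_of_real (\<integral>z. (norm (\<Sum>j\<in>A. c j * z ^ j))\<^sup>2 \<partial>circle_measure) =
    (\<integral>z. complex_of_real ((norm (\<Sum>j\<in>A. c j * z ^ j))\<^sup>2) \<partial>circle_measure)"
    by (rule integral_of_real[OF int, symmetric])
  also have "\<dots> = (\<integral>z. (\<Sum>j\<in>A. \<Sum>k\<in>A. (c j * cnj (c k)) * (z ^ j * cnj (z ^ k))) \<partial>circle_measure)"
    by (simp add: complex_norm_square sum_product algebra_simps del: of_real_power complex_cnj_power)
  also have "\<dots> = (\<Sum>j\<in>A. \<Sum>k\<in>A. (c j * cnj (c k)) * (\<integral>z. (z ^ j * cnj (z ^ k)) \<partial>circle_measure))"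
    by (simp add: circle_integrable continuous_intros)
  also have "\<dots> = (\<Sum>j\<in>A. c j * cnj (c j))"
    using assms by (simp only: circle_orthonormal) (simp add: if_distrib cong: if_cong)
  also have "\<dots> = complex_of_real (\<Sum>j\<in>A. (norm (c j))\<^sup>2)"
    by (simp add: complex_norm_square del: of_real_power)
  finally show ?thesis by (simp only: of_real_eq_iff)
qed

section \<open>Polynomials in the Hardy space of the disc\<close>

text \<open>A polynomial substitute for an analytic power of \<open>G\<close> with exponent
  \<open>q / 2\<close>: Parseval applies to \<open>g\<close>. Uniformity on the closed disc lets one
  \<open>g\<close> serve both on the circle and inside.\<close>

definition hardy_approx :: "real \<Rightarrow> complex poly \<Rightarrow> bool" where
  "hardy_approx q G \<longleftrightarrow>
     (\<forall>e>0. \<exists>g. \<forall>z. norm z \<le> 1 \<longrightarrow> \<bar>(norm (poly g z))\<^sup>2 - norm (poly G z) powr q\<bar> < e)"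

lemma continuous_on_norm_powr [continuous_intros]:
  fixes f :: "'a::topological_space \<Rightarrow> 'b::real_normed_vector"
  assumes "continuous_on A f" "0 < q"
  shows "continuous_on A (\<lambda>x. norm (f x) powr q)"
  using assms by (intro continuous_on_powr' continuous_intros) auto

lemma cball_bound:
  fixes f :: "complex \<Rightarrow> real"
  assumes "continuous_on UNIV f"
  obtains B where "B > 0" "\<And>z. norm z \<le> 1 \<Longrightarrow> f z \<le> B"
proof -
  have "compact (f ` cball 0 1)"
    using assms by (intro compact_continuous_image) (auto intro: continuous_on_subset)
  then obtain B where B: "\<And>z. z \<in> cball 0 1 \<Longrightarrow> norm (f z) \<le> B"
    using compact_imp_bounded bounded_iff by (metis imageI)
  show ?thesis
  proof (rule that[of "max 1 B"])
    show "f z \<le> max 1 B" if "norm z \<le> 1" for z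
      using B[of z] that by auto
  qed auto
qed

text \<open>Squared moduli and powers of moduli are both multiplicative, so the product of two
  approximants works; linear factors then suffice.\<close>

lemma hardy_approx_mult:
  assumes q: "0 < q" and "hardy_approx q G" "hardy_approx q H"
  shows "hardy_approx q (G * H)"
  unfolding hardy_approx_def
proof (intro allI impI)
  fix e :: real assume e: "0 < e"
  obtain B where B: "B > 0" "\<And>z. norm z \<le> 1 \<Longrightarrow> norm (poly G z) powr q \<le> B"
    by (rule cball_bound[of "\<lambda>z. norm (poly G z) powr q"]) (use q in \<open>auto intro!: continuous_intros\<close>)
  obtain C where C: "C > 0" "\<And>z. norm z \<le> 1 \<Longrightarrow> norm (poly H z) powr q \<le> C"
    by (rule cball_bound[of "\<lambda>z. norm (poly H z) powr q"]) (use q in \<open>auto intro!: continuous_intros\<close>)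
  \<comment> \<open>The bound by 1 keeps the squared modulus of \<open>h\<close> below
    \<open>C + 1\<close>; the total error is then at most \<open>d * (B + C + 1)\<close>.\<close>
  define d where "d = min 1 (e / (2 * (B + C + 1)))"
  have d: "d > 0" "d \<le> 1" "d * (B + C + 1) < e"
  proof -
    have "d * (B + C + 1) \<le> e / (2 * (B + C + 1)) * (B + C + 1)"
      using B C by (intro mult_right_mono) (auto simp: d_def)
    also have "\<dots> = e / 2" using B(1) C(1) by (simp add: field_simps)
    finally show "d * (B + C + 1) < e" using e by simp
  qed (use e B(1) C(1) in \<open>auto simp: d_def\<close>)
  obtain g where g: "\<And>z. norm z \<le> 1 \<Longrightarrow> \<bar>(norm (poly g z))\<^sup>2 - norm (poly G z) powr q\<bar> < d"
    using assms(2) d unfolding hardy_approx_def by metis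
  obtain h where h: "\<And>z. norm z \<le> 1 \<Longrightarrow> \<bar>(norm (poly h z))\<^sup>2 - norm (poly H z) powr q\<bar> < d"
    using assms(3) d unfolding hardy_approx_def by metis
  show "\<exists>f. \<forall>z. norm z \<le> 1 \<longrightarrow> \<bar>(norm (poly f z))\<^sup>2 - norm (poly (G * H) z) powr q\<bar> < e"
  proof (intro exI[of _ "g * h"] allI impI)
    fix z :: complex assume z: "norm z \<le> 1"
    define a where "a = (norm (poly g z))\<^sup>2"
    define b where "b = (norm (poly h z))\<^sup>2"
    define u where "u = norm (poly G z) powr q"
    define v where "v = norm (poly H z) powr q"
    have bd: "\<bar>a - u\<bar> < d" "\<bar>b - v\<bar> < d" "0 \<le> u" "u \<le> B" "0 \<le> b" "0 \<le> v" "v \<le> C"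
      using g[OF z] h[OF z] B(2)[OF z] C(2)[OF z] by (auto simp: a_def b_def u_def v_def)
    have "a * b - u * v = (a - u) * b + u * (b - v)" by (simp add: algebra_simps)
    then have "\<bar>a * b - u * v\<bar> \<le> \<bar>a - u\<bar> * b + u * \<bar>b - v\<bar>"
      using bd by (metis abs_triangle_ineq abs_mult abs_of_nonneg)
    also have "\<dots> \<le> d * (C + 1) + B * d"
      using bd d by (intro add_mono mult_mono) auto
    also have "\<dots> < e" using d by (simp add: algebra_simps)
    finally show "\<bar>(norm (poly (g * h) z))\<^sup>2 - norm (poly (G * H) z) powr q\<bar> < e"
      by (simp add: a_def b_def u_def v_def norm_mult power_mult_distrib powr_mult)
  qed
qed

lemma hardy_approx_const: "hardy_approx q [:c:]"
  unfolding hardy_approx_def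
  by (intro allI impI exI[of _ "[:complex_of_real (sqrt (norm c powr q)):]"]) simp

text \<open>The zero at 1 lies on the circle, so \<open>z\<close> is first shrunk to
  \<open>r * z\<close>. The binomial series of \<open>(1 - r * z) powr (q / 2)\<close> converges
  absolutely and uniformly on the closed disc, and its partial sums are the approximants. Uniform
  continuity pays for the shrinking.\<close>

lemma hardy_approx_one_minus_z:
  assumes q: "0 < q"
  shows "hardy_approx q [:1, -1:]"
  unfolding hardy_approx_def
proof (intro allI impI)
  fix e :: real assume e: "0 < e"
  have "uniformly_continuous_on (cball 0 1) (\<lambda>z::complex. norm (1 - z) powr q)"
    using q by (intro compact_uniformly_continuous continuous_intros) auto
  then obtain d where d: "d > 0" and unif:
    "\<And>z z'::complex. norm z \<le> 1 \<Longrightarrow> norm z' \<le> 1 \<Longrightarrow> dist z' z < d \<Longrightarrow>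
       \<bar>norm (1 - z') powr q - norm (1 - z) powr q\<bar> < e / 2"
  proof -
    from \<open>uniformly_continuous_on _ _\<close>[unfolded uniformly_continuous_on_def, rule_format, of "e / 2"] e
    show ?thesis using that by (auto simp: dist_real_def)
  qed
  \<comment> \<open>Within \<open>d\<close> of 1 but strictly below it; the maximum with 0 covers
    large \<open>d\<close>.\<close>
  define r where "r = max 0 (1 - d / 2)"
  have r: "0 \<le> r" "r < 1" "1 - r < d" using d by (auto simp: r_def)
  define a where "a = complex_of_real (q / 2)"
  define c where "c n = (a gchoose n) * of_real (- r) ^ n" for n
  have "ereal (norm (complex_of_real (- r))) < conv_radius (\<lambda>n. a gchoose n)"
    using r by (simp add: conv_radius_gchoose)
  then have sm: "summable (\<lambda>n. norm (c n))"
    unfolding c_def by (rule abs_summable_in_conv_radius)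
  define M where "M = (\<Sum>n. norm (c n))"
  have M: "M \<ge> 0" unfolding M_def using sm by (intro suminf_nonneg) auto
  define S where "S z = (\<Sum>n. c n * z ^ n)" for z
  have le: "norm (c n * z ^ n) \<le> norm (c n)" if "norm z \<le> 1" for n and z :: complex
    using that by (simp add: norm_mult norm_power mult_left_le power_le_one)
  have "uniform_limit (cball 0 1) (\<lambda>N z. \<Sum>n<N. c n * z ^ n) S sequentially"
    unfolding S_def using le by (intro Weierstrass_m_test[OF _ sm]) auto
  \<comment> \<open>A difference of squares is the difference of the moduli times a factor of at
    most \<open>2 * M\<close>; adding 1 keeps the denominator positive when \<open>M\<close> is
    0.\<close>
  then have "\<forall>\<^sub>F N in sequentially. \<forall>z\<in>cball 0 1. dist (\<Sum>n<N. c n * z ^ n) (S z) < e / (2 * (2 * M + 1))"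
    using e M by (intro uniform_limitD) auto
  then obtain N where "\<forall>z\<in>cball 0 1. dist (\<Sum>n<N. c n * z ^ n) (S z) < e / (2 * (2 * M + 1))"
    by (auto simp: eventually_sequentially)
  then have N: "\<And>z. norm z \<le> 1 \<Longrightarrow> dist (\<Sum>n<N. c n * z ^ n) (S z) < e / (2 * (2 * M + 1))"
    by auto
  define g where "g = (\<Sum>n<N. monom (c n) n)"
  have g: "poly g z = (\<Sum>n<N. c n * z ^ n)" for z
    by (simp add: g_def poly_sum poly_monom)
  show "\<exists>g. \<forall>z::complex. norm z \<le> 1 \<longrightarrow> \<bar>(norm (poly g z))\<^sup>2 - norm (poly [:1, -1:] z) powr q\<bar> < e"
  proof (intro exI[of _ g] allI impI)
    fix z :: complex assume z: "norm z \<le> 1"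
    have sz: "summable (\<lambda>n. norm (c n * z ^ n))"
      by (rule summable_comparison_test'[OF sm, of 0]) (use le z in auto)
    have rz: "norm (- of_real r * z) < 1"
    proof -
      have "r * norm z \<le> r" using r z by (simp add: mult_left_le)
      then show ?thesis using r by (simp add: norm_mult)
    qed
    have "S z = (\<Sum>n. (a gchoose n) * (- of_real r * z) ^ n)"
      unfolding S_def c_def power_mult_distrib by (simp add: mult_ac)
    also have "\<dots> = (1 - of_real r * z) powr a"
      using sums_unique[OF gen_binomial_complex[OF rz, of a]] by simp
    finally have "S z = (1 - of_real r * z) powr a" .
    then have "(norm (S z))\<^sup>2 = (norm (1 - of_real r * z) powr (q/2))\<^sup>2"
      by (simp add: a_def norm_powr_real_powr')
    also have "\<dots> = norm (1 - of_real r * z) powr q"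
      by (simp add: power2_eq_square flip: powr_add)
    finally have Sq: "(norm (S z))\<^sup>2 = norm (1 - of_real r * z) powr q" .
    have 1: "norm (poly g z) \<le> M"
    proof -
      have "norm (poly g z) \<le> (\<Sum>n<N. norm (c n * z ^ n))" unfolding g by (rule norm_sum)
      also have "\<dots> \<le> (\<Sum>n<N. norm (c n))" by (intro sum_mono le z)
      also have "\<dots> \<le> M" unfolding M_def by (rule sum_le_suminf[OF sm]) auto
      finally show ?thesis .
    qed
    have 2: "norm (S z) \<le> M"
    proof -
      have "norm (S z) \<le> (\<Sum>n. norm (c n * z ^ n))" unfolding S_def by (rule summable_norm[OF sz])
      also have "\<dots> \<le> M" unfolding M_def using le z by (intro suminf_le sz sm) auto
      finally show ?thesis .
    qed
    have 3: "\<bar>norm (poly g z) - norm (S z)\<bar> \<le> e / (2 * (2 * M + 1))"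
      using N[OF z] norm_triangle_ineq3[of "poly g z" "S z"] by (simp add: g dist_norm)
    have "(norm (poly g z))\<^sup>2 - (norm (S z))\<^sup>2 = (norm (poly g z) - norm (S z)) * (norm (poly g z) + norm (S z))"
      by (simp add: power2_eq_square algebra_simps)
    then have "\<bar>(norm (poly g z))\<^sup>2 - (norm (S z))\<^sup>2\<bar> = \<bar>norm (poly g z) - norm (S z)\<bar> * (norm (poly g z) + norm (S z))"
      by (simp add: abs_mult)
    also have "\<dots> \<le> e / (2 * (2 * M + 1)) * (M + M)"
      using 1 2 3 e M by (intro mult_mono) auto
    also have "\<dots> \<le> e / 2" using e M by (simp add: field_simps)
    finally have 4: "\<bar>(norm (poly g z))\<^sup>2 - (norm (S z))\<^sup>2\<bar> \<le> e / 2" .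
    have "dist (of_real r * z) z = norm (of_real (r - 1) * z)"
      by (simp add: dist_norm algebra_simps)
    also have "\<dots> = \<bar>r - 1\<bar> * norm z" by (simp only: norm_mult norm_of_real)
    also have "\<dots> \<le> 1 - r" using r z by (simp add: mult_left_le)
    finally have "dist (of_real r * z) z < d" using r by simp
    then have "\<bar>norm (1 - of_real r * z) powr q - norm (1 - z) powr q\<bar> < e / 2"
      using rz z by (intro unif) auto
    then have "\<bar>(norm (poly g z))\<^sup>2 - norm (1 - z) powr q\<bar> < e"
      using 4 by (simp add: Sq abs_if split: if_splits)
    then show "\<bar>(norm (poly g z))\<^sup>2 - norm (poly [:1, -1:] z) powr q\<bar> < e"
      by simp
  qed
qed

text \<open>The map from \<open>z\<close> to \<open>w * z\<close> sends the closed disc into itself,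
  so the approximant for \<open>w = 1\<close> can be composed with it.\<close>

lemma hardy_approx_linear:
  assumes q: "0 < q" and w: "norm w \<le> 1"
  shows "hardy_approx q [:1, -w:]"
  unfolding hardy_approx_def
proof (intro allI impI)
  fix e :: real assume "0 < e"
  then obtain g where g: "\<And>z::complex. norm z \<le> 1 \<Longrightarrow> \<bar>(norm (poly g z))\<^sup>2 - norm (poly [:1, -1:] z) powr q\<bar> < e"
    using hardy_approx_one_minus_z[OF q] unfolding hardy_approx_def by metis
  show "\<exists>g. \<forall>z. norm z \<le> 1 \<longrightarrow> \<bar>(norm (poly g z))\<^sup>2 - norm (poly [:1, -w:] z) powr q\<bar> < e"
  proof (intro exI[of _ "pcompose g [:0, w:]"] allI impI)
    fix z :: complex assume "norm z \<le> 1"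
    then have "norm (w * z) \<le> 1" using w by (simp add: norm_mult mult_le_one)
    from g[OF this] show "\<bar>(norm (poly (pcompose g [:0, w:]) z))\<^sup>2 - norm (poly [:1, -w:] z) powr q\<bar> < e"
      by (simp add: poly_pcompose mult_ac)
  qed
qed

text \<open>The difference of the two squared moduli factors as
  \<open>(1 - (norm z)^2) * (1 - (norm w)^2)\<close>. On the circle the first factor vanishes, which
  gives the equality in the next lemma.\<close>

lemma blaschke_factor_norm:
  assumes "norm w \<le> 1" "norm z \<le> 1"
  shows "norm (z - w) \<le> norm (1 - cnj w * z)"
proof -
  have "(norm (1 - cnj w * z))\<^sup>2 - (norm (z - w))\<^sup>2 = (1 - (norm z)\<^sup>2) * (1 - (norm w)\<^sup>2)"
    unfolding cmod_power2 by (simp add: power2_eq_square algebra_simps)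
  moreover have "\<dots> \<ge> 0" using assms by (simp add: power_le_one)
  ultimately have "(norm (z - w))\<^sup>2 \<le> (norm (1 - cnj w * z))\<^sup>2" by linarith
  then show ?thesis by (rule power2_le_imp_le) simp
qed

lemma blaschke_factor_norm_eq:
  assumes "norm z = 1"
  shows "norm (z - w) = norm (1 - cnj w * z)"
proof -
  have "(norm (1 - cnj w * z))\<^sup>2 - (norm (z - w))\<^sup>2 = (1 - (norm z)\<^sup>2) * (1 - (norm w)\<^sup>2)"
    unfolding cmod_power2 by (simp add: power2_eq_square algebra_simps)
  then have "(norm (z - w))\<^sup>2 = (norm (1 - cnj w * z))\<^sup>2" using assms by simp
  then show ?thesis by (simp add: power2_eq_iff_nonneg)
qed

text \<open>Zeros inside the disc obstruct an analytic power \<open>q / 2\<close>. Splitting off one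
  linear factor at a time, each zero of the closed disc is replaced by its reflection; this keeps
  the modulus on the circle and can only raise it inside.\<close>

lemma outer_majorant:
  fixes Q :: "complex poly"
  assumes q: "0 < q"
  shows "\<exists>G. hardy_approx q G \<and> (\<forall>z. norm z \<le> 1 \<longrightarrow> norm (poly Q z) \<le> norm (poly G z)) \<and>
     (\<forall>z. norm z = 1 \<longrightarrow> norm (poly Q z) = norm (poly G z))"
proof (induction "degree Q" arbitrary: Q)
  case 0
  then obtain c where "Q = [:c:]" by (metis degree_eq_zeroE)
  then show ?case using hardy_approx_const by (intro exI[of _ Q]) auto
next
  case (Suc n)
  then have "\<not> constant (poly Q)" by (simp add: constant_degree)
  then obtain w where "poly Q w = 0" using fundamental_theorem_of_algebra by blast
  then obtain R where R: "Q = [:-w, 1:] * R" unfolding poly_eq_0_iff_dvd by (rule dvdE)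
  have "R \<noteq> 0" using Suc R by auto
  then have "degree Q = Suc (degree R)" unfolding R by (subst degree_mult_eq) auto
  then have "n = degree R" using Suc by simp
  from Suc(1)[OF this] obtain H where H: "hardy_approx q H" "\<And>z. norm z \<le> 1 \<Longrightarrow> norm (poly R z) \<le> norm (poly H z)"
     "\<And>z. norm z = 1 \<Longrightarrow> norm (poly R z) = norm (poly H z)" by blast
  obtain L where L: "hardy_approx q L" "\<And>z. norm z \<le> 1 \<Longrightarrow> norm (z - w) \<le> norm (poly L z)"
     "\<And>z. norm z = 1 \<Longrightarrow> norm (z - w) = norm (poly L z)"
  proof (cases "norm w \<le> 1")
    case True
    show ?thesis
    proof (rule that[of "[:1, - cnj w:]"])
      show "hardy_approx q [:1, - cnj w:]" using hardy_approx_linear[OF q, of "cnj w"] True by simp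
      show "norm (z - w) \<le> norm (poly [:1, - cnj w:] z)" if "norm z \<le> 1" for z
        using blaschke_factor_norm[OF True that] by (simp add: mult.commute)
      show "norm (z - w) = norm (poly [:1, - cnj w:] z)" if "norm z = 1" for z
        using blaschke_factor_norm_eq[OF that] by (simp add: mult.commute)
    qed
  next
    case False
    then have w: "w \<noteq> 0" by auto
    \<comment> \<open>A zero outside the disc stays: its factor is a constant times
      \<open>1 - z / w\<close>, already of the admissible form.\<close>
    have eq: "poly ([:-w:] * [:1, - inverse w:]) z = z - w" for z
      using w by (simp add: field_simps)
    show ?thesis
    proof (rule that[of "[:-w:] * [:1, - inverse w:]"])
      show "hardy_approx q ([:-w:] * [:1, - inverse w:])"
        using False by (intro hardy_approx_mult[OF q] hardy_approx_const hardy_approx_linear q)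
           (auto simp: norm_inverse inverse_le_1_iff)
    qed (simp_all only: eq order_refl)
  qed
  have Q: "norm (poly Q z) = norm (z - w) * norm (poly R z)" for z
    unfolding R poly_mult norm_mult by simp
  show ?case
  proof (intro exI[of _ "L * H"] conjI allI impI)
    show "hardy_approx q (L * H)" by (intro hardy_approx_mult q L H)
  next
    fix z :: complex assume "norm z \<le> 1"
    then show "norm (poly Q z) \<le> norm (poly (L * H) z)"
      using L(2)[of z] H(2)[of z] by (simp add: Q norm_mult mult_mono)
  next
    fix z :: complex assume "norm z = 1"
    then show "norm (poly Q z) = norm (poly (L * H) z)"
      using L(3)[of z] H(3)[of z] by (simp add: Q norm_mult)
  qed
qed

section \<open>Dilation and point evaluation for polynomials at an arbitrary exponent\<close>

lemma integral_circle_mono: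
  fixes f g :: "complex \<Rightarrow> real"
  assumes "continuous_on UNIV f" "continuous_on UNIV g" "\<And>z. norm z = 1 \<Longrightarrow> f z \<le> g z"
  shows "integral\<^sup>L circle_measure f \<le> integral\<^sup>L circle_measure g"
  using assms AE_circle_norm
  by (intro integral_mono_AE circle_integrable) auto

lemma circle_integral_add_const:
  fixes f :: "complex \<Rightarrow> real"
  assumes "continuous_on UNIV f"
  shows "(\<integral>z. f z + e \<partial>circle_measure) = integral\<^sup>L circle_measure f + e"
proof -
  interpret prob_space circle_measure by (rule prob_space_circle_measure)
  show ?thesis using circle_integrable[OF assms] prob_space by simp
qed

lemma circle_parseval_poly:
  assumes "0 \<le> r"
  shows
  "(\<integral>z. (norm (poly g (of_real r * z)))\<^sup>2 \<partial>circle_measure) = (\<Sum>j\<le>degree g. (norm (coeff g j))\<^sup>2 * r ^ (2 * j))"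
proof -
  have "poly g (of_real r * z) = (\<Sum>j\<le>degree g. (coeff g j * of_real (r ^ j)) * z ^ j)" for z
    by (simp add: poly_altdef power_mult_distrib mult_ac)
  then show ?thesis
    by (simp only: circle_parseval[OF finite_atMost]) (simp add: norm_mult power_mult_distrib power_mult norm_power mult.commute[of 2] assms)
qed

lemma poly_L2_dilation:
  assumes r: "0 \<le> r" "r \<le> 1"
  shows "(\<integral>z. (norm (poly g (of_real r * z)))\<^sup>2 \<partial>circle_measure) \<le> (\<integral>z. (norm (poly g z))\<^sup>2 \<partial>circle_measure)"
  using circle_parseval_poly[of 1 g] circle_parseval_poly[of r g] r
  by (auto intro!: sum_mono mult_left_le power_le_one)

text \<open>Cauchy-Schwarz between the coefficients and the powers of \<open>norm z\<close>; the
  geometric series is the squared norm of the reproducing kernel.\<close>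

lemma poly_L2_point:
  assumes z: "norm z < 1"
  shows "(norm (poly g z))\<^sup>2 \<le> (\<integral>z. (norm (poly g z))\<^sup>2 \<partial>circle_measure) / (1 - (norm z)\<^sup>2)"
proof -
  have z2: "(norm z)\<^sup>2 < 1" using z by (simp add: power_less_one_iff abs_square_less_1)
  have "norm (poly g z) \<le> (\<Sum>j\<le>degree g. norm (coeff g j) * norm z ^ j)"
    unfolding poly_altdef by (rule order.trans[OF norm_sum]) (simp add: norm_mult norm_power)
  then have "(norm (poly g z))\<^sup>2 \<le> (\<Sum>j\<le>degree g. norm (coeff g j) * norm z ^ j)\<^sup>2"
    by (intro power_mono) auto
  also have "\<dots> \<le> (\<Sum>j\<le>degree g. (norm (coeff g j))\<^sup>2) * (\<Sum>j\<le>degree g. (norm z ^ j)\<^sup>2)"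
    by (rule Cauchy_Schwarz_ineq_sum)
  also have "(\<Sum>j\<le>degree g. (norm z ^ j)\<^sup>2) = (\<Sum>j\<le>degree g. ((norm z)\<^sup>2) ^ j)"
    by (simp add: power_mult[symmetric] mult.commute)
  also have "\<dots> \<le> (\<Sum>j. ((norm z)\<^sup>2) ^ j)"
    using z2 by (intro sum_le_suminf summable_geometric) auto
  also have "\<dots> = 1 / (1 - (norm z)\<^sup>2)"
    using z2 by (intro suminf_geometric) auto
  finally show ?thesis
    using circle_parseval_poly[of 1 g] by (simp add: mult_left_mono sum_nonneg)
qed

text \<open>At \<open>r * z\<close> only \<open>norm Q \<le> norm G\<close> is available, and it
  goes in the right direction; back on the circle the majorant is exact, so nothing is lost there.
  Parseval for \<open>g\<close> links the two, and each approximation costs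
  \<open>e / 2\<close>.\<close>

lemma hardy_dilation:
  fixes Q :: "complex poly"
  assumes q: "0 < q" and r: "0 \<le> r" "r \<le> 1"
  shows "(\<integral>z. norm (poly Q (of_real r * z)) powr q \<partial>circle_measure)
    \<le> (\<integral>z. norm (poly Q z) powr q \<partial>circle_measure)"
proof (rule field_le_epsilon)
  fix e :: real assume e: "0 < e"
  obtain G where G: "hardy_approx q G" "\<And>z. norm z \<le> 1 \<Longrightarrow> norm (poly Q z) \<le> norm (poly G z)"
     "\<And>z. norm z = 1 \<Longrightarrow> norm (poly Q z) = norm (poly G z)" using outer_majorant[OF q, of Q] by blast
  obtain g where g: "\<And>z. norm z \<le> 1 \<Longrightarrow> \<bar>(norm (poly g z))\<^sup>2 - norm (poly G z) powr q\<bar> < e / 2"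
    using G(1) e unfolding hardy_approx_def by (metis half_gt_zero)
  have "(\<integral>z. norm (poly Q (of_real r * z)) powr q \<partial>circle_measure)
    \<le> (\<integral>z. (norm (poly g (of_real r * z)))\<^sup>2 + e / 2 \<partial>circle_measure)"
  proof (rule integral_circle_mono)
    fix z :: complex assume "norm z = 1"
    then have rz: "norm (of_real r * z) \<le> 1" using r by (simp add: norm_mult)
    have "norm (poly Q (of_real r * z)) powr q \<le> norm (poly G (of_real r * z)) powr q"
      using G(2)[OF rz] q by (intro powr_mono2) auto
    then show "norm (poly Q (of_real r * z)) powr q \<le> (norm (poly g (of_real r * z)))\<^sup>2 + e / 2"
      using g[OF rz] by linarith
  qed (intro continuous_intros q)+
  also have "\<dots> = (\<integral>z. (norm (poly g (of_real r * z)))\<^sup>2 \<partial>circle_measure) + e / 2"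
    by (intro circle_integral_add_const continuous_intros q)
  also have "\<dots> \<le> (\<integral>z. (norm (poly g z))\<^sup>2 \<partial>circle_measure) + e / 2"
    using poly_L2_dilation[OF r] by simp
  also have "(\<integral>z. (norm (poly g z))\<^sup>2 \<partial>circle_measure) \<le> (\<integral>z. norm (poly Q z) powr q + e / 2 \<partial>circle_measure)"
  proof (rule integral_circle_mono)
    fix z :: complex assume z: "norm z = 1"
    then show "(norm (poly g z))\<^sup>2 \<le> norm (poly Q z) powr q + e / 2"
      using g[of z] unfolding G(3)[OF z] by linarith
  qed (intro continuous_intros q)+
  also have "\<dots> = (\<integral>z. norm (poly Q z) powr q \<partial>circle_measure) + e / 2"
    by (intro circle_integral_add_const continuous_intros q)
  finally show "(\<integral>z. norm (poly Q (of_real r * z)) powr q \<partial>circle_measure)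
    \<le> (\<integral>z. norm (poly Q z) powr q \<partial>circle_measure) + e" by simp
qed

text \<open>Same detour through the majorant, with the evaluation bound for \<open>g\<close> in
  place of its dilation. It turns a bound on the \<open>q\<close>-th mean into coefficient
  bounds.\<close>

lemma hardy_point_evaluation:
  fixes Q :: "complex poly"
  assumes q: "0 < q" and z: "norm z < 1"
  shows "norm (poly Q z) powr q \<le> (\<integral>z. norm (poly Q z) powr q \<partial>circle_measure) / (1 - (norm z)\<^sup>2)"
proof (rule field_le_epsilon)
  fix e' :: real assume e': "0 < e'"
  have z2: "(norm z)\<^sup>2 < 1" using z by (simp add: power_less_one_iff abs_square_less_1)
  \<comment> \<open>Scaled so that division by \<open>1 - (norm z)^2\<close> turns the error
    \<open>e / 2\<close> into \<open>e' / 2\<close>.\<close>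
  define e where "e = e' * (1 - (norm z)\<^sup>2)"
  have e: "0 < e" using e' z2 by (simp add: e_def)
  obtain G where G: "hardy_approx q G" "\<And>z. norm z \<le> 1 \<Longrightarrow> norm (poly Q z) \<le> norm (poly G z)"
     "\<And>z. norm z = 1 \<Longrightarrow> norm (poly Q z) = norm (poly G z)" using outer_majorant[OF q, of Q] by blast
  obtain g where g: "\<And>z. norm z \<le> 1 \<Longrightarrow> \<bar>(norm (poly g z))\<^sup>2 - norm (poly G z) powr q\<bar> < e / 2"
    using G(1) e unfolding hardy_approx_def by (metis half_gt_zero)
  have "(\<integral>z. (norm (poly g z))\<^sup>2 \<partial>circle_measure) \<le> (\<integral>z. norm (poly Q z) powr q + e / 2 \<partial>circle_measure)"
  proof (rule integral_circle_mono)
    fix z :: complex assume z: "norm z = 1"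
    then show "(norm (poly g z))\<^sup>2 \<le> norm (poly Q z) powr q + e / 2"
      using g[of z] unfolding G(3)[OF z] by linarith
  qed (intro continuous_intros q)+
  also have "\<dots> = (\<integral>z. norm (poly Q z) powr q \<partial>circle_measure) + e / 2"
    by (intro circle_integral_add_const continuous_intros q)
  finally have 1: "(\<integral>z. (norm (poly g z))\<^sup>2 \<partial>circle_measure) \<le> (\<integral>z. norm (poly Q z) powr q \<partial>circle_measure) + e / 2" .
  have "norm (poly Q z) powr q \<le> norm (poly G z) powr q"
    using G(2)[of z] z q by (intro powr_mono2) auto
  also have "\<dots> \<le> (norm (poly g z))\<^sup>2 + e / 2" using g[OF less_imp_le[OF z]] by linarith
  also have "(norm (poly g z))\<^sup>2 \<le> (\<integral>z. (norm (poly g z))\<^sup>2 \<partial>circle_measure) / (1 - (norm z)\<^sup>2)"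
    by (rule poly_L2_point[OF z])
  also have "\<dots> \<le> ((\<integral>z. norm (poly Q z) powr q \<partial>circle_measure) + e / 2) / (1 - (norm z)\<^sup>2)"
    using 1 z2 by (intro divide_right_mono) auto
  also have "\<dots> + e / 2 \<le> (\<integral>z. norm (poly Q z) powr q \<partial>circle_measure) / (1 - (norm z)\<^sup>2) + e'"
  proof -
    have "e / 2 \<le> e' / 2" using e' z2 by (simp add: e_def mult_left_le)
    moreover have "e / 2 / (1 - (norm z)\<^sup>2) = e' / 2"
    proof -
      define x where "x = 1 - (norm z)\<^sup>2"
      have "x \<noteq> 0" using z2 by (simp add: x_def)
      have "e = e' * x" by (simp add: e_def x_def)
      then show ?thesis using \<open>x \<noteq> 0\<close> by (simp flip: x_def)
    qed
    ultimately show ?thesis by (simp add: add_divide_distrib)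
  qed
  finally show "norm (poly Q z) powr q \<le> (\<integral>z. norm (poly Q z) powr q \<partial>circle_measure) / (1 - (norm z)\<^sup>2) + e'" 
    by simp
qed

section \<open>Cutting off a dilated polynomial\<close>

text \<open>A sum is at most twice the larger term; this stands in for the triangle inequality at
  every exponent.\<close>

lemma powr_norm_add_le:
  fixes x y :: "'a::real_normed_vector"
  assumes "0 < q"
  shows "norm (x + y) powr q \<le> 2 powr q * (norm x powr q + norm y powr q)"
proof -
  have "norm (x + y) \<le> 2 * max (norm x) (norm y)"
    using norm_triangle_ineq[of x y] by linarith
  then have "norm (x + y) powr q \<le> (2 * max (norm x) (norm y)) powr q"
    using assms by (intro powr_mono2) auto
  also have "\<dots> = 2 powr q * max (norm x) (norm y) powr q"
    by (simp add: powr_mult)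
  also have "max (norm x) (norm y) powr q \<le> norm x powr q + norm y powr q"
    by (simp add: max_def)
  finally show ?thesis by simp
qed

text \<open>Cauchy's estimate: integration against the conjugate monomial isolates one
  coefficient.\<close>

lemma coeff_bound_via_circle:
  fixes Q :: "complex poly"
  assumes \<rho>: "0 \<le> \<rho>" and B: "\<And>z. norm z = \<rho> \<Longrightarrow> norm (poly Q z) \<le> B"
  shows "norm (coeff Q j) * \<rho> ^ j \<le> B"
proof -
  interpret prob_space circle_measure by (rule prob_space_circle_measure)
  have B0: "B \<ge> 0" using B[of "of_real \<rho>"] \<rho> norm_ge_zero by (metis abs_of_nonneg norm_of_real order.trans)
  have "(\<integral>z. poly Q (of_real \<rho> * z) * cnj (z ^ j) \<partial>circle_measure) =
    (\<integral>z. (\<Sum>k\<le>degree Q. (coeff Q k * of_real \<rho> ^ k) * (z ^ k * cnj (z ^ j))) \<partial>circle_measure)"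
    by (simp add: poly_altdef sum_distrib_left sum_distrib_right power_mult_distrib mult_ac)
  also have "\<dots> = (\<Sum>k\<le>degree Q. (coeff Q k * of_real \<rho> ^ k) * (\<integral>z. (z ^ k * cnj (z ^ j)) \<partial>circle_measure))"
    by (simp add: circle_integrable continuous_intros)
  also have "\<dots> = coeff Q j * of_real \<rho> ^ j"
    by (simp only: circle_orthonormal) (auto simp: if_distrib coeff_eq_0 cong: if_cong)
  finally have "norm (coeff Q j) * \<rho> ^ j = norm (\<integral>z. poly Q (of_real \<rho> * z) * cnj (z ^ j) \<partial>circle_measure)"
    using \<rho> by (simp add: norm_mult norm_power)
  also have "\<dots> \<le> (\<integral>z. norm (poly Q (of_real \<rho> * z) * cnj (z ^ j)) \<partial>circle_measure)"
    by (rule integral_norm_bound)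
  also have "\<dots> \<le> (\<integral>z. B \<partial>circle_measure)"
    using \<rho> B by (intro integral_circle_mono continuous_intros) (auto simp: norm_mult norm_power)
  finally show ?thesis using prob_space by simp
qed

text \<open>The threshold \<open>J0\<close> serves all \<open>Q\<close> at once. Point evaluation
  and Cauchy's estimate on the circle of radius \<rho> bound the coefficients geometrically, so
  after dilation by \<open>r\<close> the tail has ratio \<open>r / \<rho>\<close> and, past
  \<open>J0\<close>, is at most the \<open>q\<close>-th root of the mean of \<open>Q\<close>. The
  dilated polynomial and the tail each contribute one copy of that mean.\<close>

lemma dilation_truncation:
  assumes q: "0 < q" and r: "0 \<le> r" "r < 1"
  shows "\<exists>J0. \<forall>J\<ge>J0. \<forall>Q::complex poly.
    (\<integral>z. norm (\<Sum>j\<le>J. coeff Q j * of_real (r ^ j) * z ^ j) powr q \<partial>circle_measure)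
      \<le> 2 powr q * 2 * (\<integral>z. norm (poly Q z) powr q \<partial>circle_measure)"
proof -
  \<comment> \<open>Below 1, so that points of modulus \<rho> can be evaluated; above
    \<open>r\<close>, so that the tail is geometric.\<close>
  define \<rho> where "\<rho> = (1 + r) / 2"
  have \<rho>: "0 < \<rho>" "\<rho> < 1" "r < \<rho>" using r by (auto simp: \<rho>_def)
  have \<rho>2: "\<rho>\<^sup>2 < 1" using \<rho> by (simp add: power_less_one_iff)
  define t where "t = r / \<rho>"
  have t: "0 \<le> t" "t < 1" using r \<rho> by (auto simp: t_def)
  \<comment> \<open>Chosen so that \<open>I powr (1/q) * (c * t ^ J)\<close> is the sum of the
    geometric tail from degree \<open>J\<close> on.\<close>
  define c where "c = (1 / (1 - \<rho>\<^sup>2)) powr (1/q) / (1 - t)"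
  have "(\<lambda>J. c * t ^ J) \<longlonglongrightarrow> c * 0" using t by (intro tendsto_intros LIMSEQ_power_zero) auto
  then have "\<forall>\<^sub>F J in sequentially. c * t ^ J < 1" by (intro order_tendstoD(2)) auto
  then obtain J0 where J0: "\<And>J. J \<ge> J0 \<Longrightarrow> c * t ^ J < 1" by (auto simp: eventually_sequentially)
  show ?thesis
  proof (intro exI[of _ J0] allI impI)
    fix J and Q :: "complex poly" assume J: "J0 \<le> J"
    define I where "I = (\<integral>z. norm (poly Q z) powr q \<partial>circle_measure)"
    have I: "0 \<le> I" by (simp add: I_def integral_nonneg_AE)
    define B where "B = (I / (1 - \<rho>\<^sup>2)) powr (1/q)"
    have coef: "norm (coeff Q j) * \<rho> ^ j \<le> B" for j
    proof (rule coeff_bound_via_circle)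
      fix z :: complex assume z: "norm z = \<rho>"
      have "norm (poly Q z) powr q \<le> I / (1 - \<rho>\<^sup>2)"
        using hardy_point_evaluation[OF q, of z Q] z \<rho> by (simp add: I_def)
      then have "(norm (poly Q z) powr q) powr (1/q) \<le> B"
        unfolding B_def using q by (intro powr_mono2) auto
      then show "norm (poly Q z) \<le> B" using q by (simp add: powr_powr)
    qed (use \<rho> in auto)
    have B0: "0 \<le> B" by (simp add: B_def)
    have le: "norm (coeff Q j * of_real (r ^ j) * z ^ j) \<le> B * t ^ j" if "norm z = 1" for j z
    proof -
      have "norm (coeff Q j * of_real (r ^ j) * z ^ j) = norm (coeff Q j) * \<rho> ^ j * t ^ j"
        using that r \<rho> by (simp add: t_def norm_mult norm_power power_divide)
      also have "\<dots> \<le> B * t ^ j" using coef t by (intro mult_right_mono) auto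
      finally show ?thesis .
    qed
    define T where "T z = (\<Sum>j\<le>J. coeff Q j * of_real (r ^ j) * z ^ j)" for z
    have diff: "norm (T z - poly Q (of_real r * z)) \<le> I powr (1/q)" if z: "norm z = 1" for z
    proof -
      define N where "N = max J (degree Q)"
      have "poly Q (of_real r * z) = (\<Sum>j\<le>N. coeff Q j * of_real (r ^ j) * z ^ j)"
        unfolding poly_altdef N_def
        by (rule sum.mono_neutral_cong_left) (auto simp: coeff_eq_0 power_mult_distrib)
      moreover have "(\<Sum>j\<le>N. coeff Q j * of_real (r ^ j) * z ^ j) = T z + (\<Sum>j\<in>{J<..N}. coeff Q j * of_real (r ^ j) * z ^ j)"
        unfolding T_def by (subst sum.union_disjoint[symmetric]) (auto simp: N_def intro!: sum.cong)
      ultimately have "norm (T z - poly Q (of_real r * z)) = norm (\<Sum>j\<in>{J<..N}. coeff Q j * of_real (r ^ j) * z ^ j)"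
        by (simp add: norm_minus_commute)
      also have "\<dots> \<le> (\<Sum>j\<in>{J<..N}. B * t ^ j)"
        by (rule sum_norm_le) (rule le[OF z])
      also have "\<dots> \<le> (\<Sum>j\<in>{J..<Suc N}. B * t ^ j)"
        using B0 t by (intro sum_mono2) auto
      also have "\<dots> = (\<Sum>j<Suc N - J. B * t ^ (J + j))"
        by (rule sum.reindex_bij_witness[of _ "\<lambda>j. J + j" "\<lambda>j. j - J"]) auto
      also have "\<dots> = B * t ^ J * (\<Sum>j<Suc N - J. t ^ j)"
        by (simp add: sum_distrib_left power_add mult.assoc)
      also have "\<dots> \<le> B * t ^ J * (\<Sum>j. t ^ j)"
        using B0 t by (intro mult_left_mono sum_le_suminf summable_geometric) auto
      also have "\<dots> = B * t ^ J / (1 - t)"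
        using t suminf_geometric[of t] by simp
      also have "\<dots> = I powr (1/q) * (c * t ^ J)"
        using I \<rho>2 by (simp add: B_def c_def powr_divide)
      also have "\<dots> \<le> I powr (1/q) * 1"
        using J0[OF J] by (intro mult_left_mono) auto
      finally show ?thesis by simp
    qed
    have "(\<integral>z. norm (T z) powr q \<partial>circle_measure)
      \<le> (\<integral>z. 2 powr q * (norm (poly Q (of_real r * z)) powr q + I) \<partial>circle_measure)"
    proof (rule integral_circle_mono)
      fix z :: complex assume z: "norm z = 1"
      have "norm (T z) powr q \<le> 2 powr q * (norm (poly Q (of_real r * z)) powr q + norm (T z - poly Q (of_real r * z)) powr q)"
        using powr_norm_add_le[OF q, of "poly Q (of_real r * z)" "T z - poly Q (of_real r * z)"] by simp
      also have "norm (T z - poly Q (of_real r * z)) powr q \<le> (I powr (1/q)) powr q"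
        using q diff[OF z] by (intro powr_mono2) auto
      also have "\<dots> = I" using q I by (simp add: powr_powr)
      finally show "norm (T z) powr q \<le> 2 powr q * (norm (poly Q (of_real r * z)) powr q + I)" by simp
    qed (unfold T_def, (intro continuous_intros q)+)
    also have "\<dots> = 2 powr q * ((\<integral>z. norm (poly Q (of_real r * z)) powr q \<partial>circle_measure) + I)"
      by (simp add: circle_integral_add_const continuous_intros q)
    also have "\<dots> \<le> 2 powr q * (I + I)"
      using hardy_dilation[OF q, of r Q] r by (intro mult_left_mono) (auto simp: I_def)
    finally show "(\<integral>z. norm (\<Sum>j\<le>J. coeff Q j * of_real (r ^ j) * z ^ j) powr q \<partial>circle_measure)
      \<le> 2 powr q * 2 * (\<integral>z. norm (poly Q z) powr q \<partial>circle_measure)"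
      by (simp add: T_def I_def)
  qed
qed

section \<open>The infinite torus\<close>

lemma sets_torus_measure [measurable_cong]: "sets torus_measure = sets (Pi\<^sub>M UNIV (\<lambda>_. borel))"
  unfolding torus_measure_def by (intro sets_PiM_cong sets_circle_measure) auto

lemma space_torus_measure [simp]: "space torus_measure = UNIV"
  by (simp add: torus_measure_def space_PiM)

lemma prob_space_torus_measure: "prob_space torus_measure"
  unfolding torus_measure_def by (intro prob_space_PiM prob_space_circle_measure)

lemma distr_torus_component: "distr torus_measure circle_measure (\<lambda>z. z j) = circle_measure"
  unfolding torus_measure_def by (intro distr_PiM_component prob_space_circle_measure) auto

lemma AE_torus_norm: "AE z in torus_measure. \<forall>j. norm (z j) = 1"
proof (subst AE_all_countable, intro allI)
  fix j
  show "AE z in torus_measure. norm (z j) = 1"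
    unfolding torus_measure_def
    by (rule AE_PiM_component[OF prob_space_circle_measure]) (auto intro: AE_circle_norm)
qed

text \<open>Inserting \<open>j\<close> into the index set \<open>UNIV\<close> changes nothing, so
  splitting off a coordinate becomes resampling it. One-variable facts can thus be applied in one
  coordinate with the others frozen.\<close>

lemma distr_torus_update:
  "distr (circle_measure \<Otimes>\<^sub>M torus_measure) torus_measure (\<lambda>(x, z). z(j := x)) = torus_measure"
  using distr_pair_PiM_eq_PiM[of UNIV "\<lambda>_. circle_measure" j]
  by (simp add: torus_measure_def prob_space_circle_measure)

lemma torus_update_measurable [measurable]:
  "(\<lambda>(x, z). z(j := x)) \<in> measurable (borel \<Otimes>\<^sub>M Pi\<^sub>M UNIV (\<lambda>_. borel)) (Pi\<^sub>M UNIV (\<lambda>_. borel :: complex measure))"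
proof (rule measurable_PiM_single')
  show "(\<lambda>\<omega>. (case \<omega> of (x, z) \<Rightarrow> z(j := x)) i) \<in> borel_measurable (borel \<Otimes>\<^sub>M Pi\<^sub>M UNIV (\<lambda>_. borel :: complex measure))" for i
    by (cases "i = j") (simp_all add: case_prod_unfold)
qed (auto simp: space_PiM)

lemma integral_torus_update:
  fixes f :: "(nat \<Rightarrow> complex) \<Rightarrow> 'b::{banach, second_countable_topology}"
  assumes int: "integrable torus_measure f"
  shows "(\<integral>z. (\<integral>x. f (z(j := x)) \<partial>circle_measure) \<partial>torus_measure) = integral\<^sup>L torus_measure f"
    and "integrable torus_measure (\<lambda>z. \<integral>x. f (z(j := x)) \<partial>circle_measure)"
proof -
  interpret C: prob_space circle_measure by (rule prob_space_circle_measure)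
  interpret T: prob_space torus_measure by (rule prob_space_torus_measure)
  interpret P: pair_prob_space circle_measure torus_measure ..
  have mf[measurable]: "f \<in> borel_measurable (Pi\<^sub>M UNIV (\<lambda>_. borel))"
    using borel_measurable_integrable[OF int] by (simp cong: measurable_cong_sets add: sets_torus_measure)
  have "integrable (distr (circle_measure \<Otimes>\<^sub>M torus_measure) torus_measure (\<lambda>(x, z). z(j := x))) f"
    using int by (simp only: distr_torus_update)
  then have int2: "integrable (circle_measure \<Otimes>\<^sub>M torus_measure) (\<lambda>(x, z). f (z(j := x)))"
    by (subst (asm) integrable_distr_eq) (simp_all add: case_prod_unfold)
  have "integral\<^sup>L torus_measure f = integral\<^sup>L (distr (circle_measure \<Otimes>\<^sub>M torus_measure) torus_measure (\<lambda>(x, z). z(j := x))) f"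
    by (simp only: distr_torus_update)
  also have "\<dots> = (\<integral>(x, z). f (z(j := x)) \<partial>(circle_measure \<Otimes>\<^sub>M torus_measure))"
    by (subst integral_distr) (simp_all add: case_prod_unfold)
  also have "\<dots> = (\<integral>z. (\<integral>x. f (z(j := x)) \<partial>circle_measure) \<partial>torus_measure)"
    using P.integral_snd[OF int2] by simp
  finally show "(\<integral>z. (\<integral>x. f (z(j := x)) \<partial>circle_measure) \<partial>torus_measure) = integral\<^sup>L torus_measure f" ..
  show "integrable torus_measure (\<lambda>z. \<integral>x. f (z(j := x)) \<partial>circle_measure)"
    using P.integrable_snd[OF int2] by simp
qed

section \<open>Primes, Bohr monomials and their orthogonality\<close>

lemma prime_nth_prime: "prime (nth_prime j)"
  using enumerate_in_set[OF primes_infinite, of j] by (simp add: nth_prime_def)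

lemma ex_nth_prime: "prime p \<Longrightarrow> \<exists>j. nth_prime j = p"
  using enumerate_Ex[OF primes_infinite, of p] by (auto simp: nth_prime_def)

lemma inj_nth_prime: "inj nth_prime"
  using inj_enumerate[OF primes_infinite] by (simp add: nth_prime_def[abs_def])

lemma finite_nth_prime_dvd: "n \<ge> 1 \<Longrightarrow> finite {j. nth_prime j dvd n}"
  using finite_vimageI[OF finite_divisors_nat[of n] inj_nth_prime] by (simp add: vimage_def)

definition nu :: "nat \<Rightarrow> nat \<Rightarrow> nat" where
  "nu j n = multiplicity (nth_prime j) n"

lemma nu_ext:
  assumes "n \<ge> 1" "m \<ge> 1" "\<And>j. nu j n = nu j m"
  shows "n = m"
proof (rule multiplicity_eq_nat)
  fix p :: nat assume "prime p"
  then show "multiplicity p n = multiplicity p m"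
    using assms(3) ex_nth_prime[of p] by (auto simp: nu_def)
qed (use assms in auto)

lemma bohr_monomial_eq_prod:
  assumes "n \<ge> 1" "finite A" "{j. nth_prime j dvd n} \<subseteq> A"
  shows "bohr_monomial n z = (\<Prod>j\<in>A. z j ^ nu j n)"
  unfolding bohr_monomial_def nu_def
  using assms by (intro prod.mono_neutral_left) (auto simp: not_dvd_imp_multiplicity_0)

text \<open>The value 1 at \<open>j\<close> stands for the absence of that variable; a lift thereby
  becomes a polynomial in \<open>x\<close> with the other coordinates as parameters.\<close>

lemma bohr_monomial_update:
  assumes "n \<ge> 1"
  shows "bohr_monomial n (z(j := x)) = x ^ nu j n * bohr_monomial n (z(j := 1))"
proof -
  define A where "A = insert j {j. nth_prime j dvd n}"
  have A: "finite A" "{j. nth_prime j dvd n} \<subseteq> A" "j \<in> A"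
    using finite_nth_prime_dvd[OF assms] by (auto simp: A_def)
  have *: "bohr_monomial n (z(j := y)) = y ^ nu j n * (\<Prod>i\<in>A - {j}. z i ^ nu i n)" for y
    using A by (subst bohr_monomial_eq_prod[OF assms A(1,2)], subst prod.remove[OF A(1,3)]) auto
  show ?thesis unfolding * by simp
qed

lemma bohr_monomial_measurable [measurable]: "bohr_monomial n \<in> borel_measurable (Pi\<^sub>M UNIV (\<lambda>_. borel))"
  unfolding bohr_monomial_def[abs_def] by measurable

lemma norm_bohr_monomial: "(\<And>j. norm (z j) = 1) \<Longrightarrow> norm (bohr_monomial n z) = 1"
  by (simp add: bohr_monomial_def prod_norm[symmetric] norm_power)

lemma integrable_torus_bounded:
  fixes f :: "(nat \<Rightarrow> complex) \<Rightarrow> 'b::{banach, second_countable_topology}"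
  assumes "f \<in> borel_measurable (Pi\<^sub>M UNIV (\<lambda>_. borel))" "\<And>z. (\<And>j. norm (z j) = 1) \<Longrightarrow> norm (f z) \<le> B"
  shows "integrable torus_measure f"
proof -
  interpret T: prob_space torus_measure by (rule prob_space_torus_measure)
  show ?thesis
    using assms AE_torus_norm
    by (intro T.integrable_const_bound[of _ B]) (auto simp: sets_torus_measure cong: measurable_cong_sets)
qed

lemma cnj_measurable [measurable]: "cnj \<in> borel_measurable borel"
  by (intro borel_measurable_continuous_onI continuous_intros)

lemma bohr_orthonormal:
  assumes n: "n \<ge> 1" and m: "m \<ge> 1"
  shows "(\<integral>z. bohr_monomial n z * cnj (bohr_monomial m z) \<partial>torus_measure) = (if n = m then 1 else 0)"
proof (cases "n = m")
  case True
  interpret T: prob_space torus_measure by (rule prob_space_torus_measure)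
  have "(\<integral>z. bohr_monomial n z * cnj (bohr_monomial m z) \<partial>torus_measure) = (\<integral>z. 1 \<partial>torus_measure)"
    using AE_torus_norm True
    by (intro integral_cong_AE) (auto simp: complex_norm_square[symmetric] norm_bohr_monomial)
  then show ?thesis using True T.prob_space by simp
next
  case False
  \<comment> \<open>By unique factorization some prime has different exponents in \<open>n\<close>
    and \<open>m\<close>; integrating over its coordinate alone already gives 0.\<close>
  then obtain j where j: "nu j n \<noteq> nu j m" using nu_ext[OF n m] by blast
  have int: "integrable torus_measure (\<lambda>z. bohr_monomial n z * cnj (bohr_monomial m z))"
    by (rule integrable_torus_bounded[of _ 1], measurable) (simp add: norm_mult norm_bohr_monomial)
  have "(\<integral>z. bohr_monomial n z * cnj (bohr_monomial m z) \<partial>torus_measure) =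
    (\<integral>z. (\<integral>x. bohr_monomial n (z(j := x)) * cnj (bohr_monomial m (z(j := x))) \<partial>circle_measure) \<partial>torus_measure)"
    by (rule integral_torus_update(1)[OF int, symmetric])
  also have "\<dots> = (\<integral>z. (\<integral>x. (bohr_monomial n (z(j := 1)) * cnj (bohr_monomial m (z(j := 1)))) * (x ^ nu j n * cnj (x ^ nu j m)) \<partial>circle_measure) \<partial>torus_measure)"
    by (subst bohr_monomial_update[OF n], subst bohr_monomial_update[OF m]) (simp add: mult_ac)
  also have "\<dots> = 0"
    by (simp only: integral_mult_right_zero circle_orthonormal) (simp add: j)
  finally show ?thesis using False by simp
qed

lemma torus_parseval:
  fixes c :: "nat \<Rightarrow> complex"
  assumes "finite A" "0 \<notin> A"
  shows "(\<integral>z. (norm (\<Sum>n\<in>A. c n * bohr_monomial n z))\<^sup>2 \<partial>torus_measure) = (\<Sum>n\<in>A. (norm (c n))\<^sup>2)"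
proof -
  have int': "integrable torus_measure (\<lambda>z. (c j * cnj (c k)) * (bohr_monomial j z * cnj (bohr_monomial k z)))" for j k
    by (rule integrable_torus_bounded[of _ "norm (c j) * norm (c k)"], measurable) (simp add: norm_mult norm_bohr_monomial)
  have int: "integrable torus_measure (\<lambda>z. (norm (\<Sum>n\<in>A. c n * bohr_monomial n z))\<^sup>2)"
  proof (rule integrable_torus_bounded[of _ "(\<Sum>n\<in>A. norm (c n))\<^sup>2"])
    fix z :: "nat \<Rightarrow> complex" assume z: "\<And>j. norm (z j) = 1"
    have "norm (\<Sum>n\<in>A. c n * bohr_monomial n z) \<le> (\<Sum>n\<in>A. norm (c n))"
      by (rule sum_norm_le) (simp add: norm_mult norm_bohr_monomial z)
    then show "norm ((norm (\<Sum>n\<in>A. c n * bohr_monomial n z))\<^sup>2) \<le> (\<Sum>n\<in>A. norm (c n))\<^sup>2"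
      by (simp add: power_mono)
  qed measurable
  have "complex_of_real (\<integral>z. (norm (\<Sum>n\<in>A. c n * bohr_monomial n z))\<^sup>2 \<partial>torus_measure) =
    (\<integral>z. complex_of_real ((norm (\<Sum>n\<in>A. c n * bohr_monomial n z))\<^sup>2) \<partial>torus_measure)"
    by (rule integral_of_real[OF int, symmetric])
  also have "\<dots> = (\<integral>z. (\<Sum>j\<in>A. \<Sum>k\<in>A. (c j * cnj (c k)) * (bohr_monomial j z * cnj (bohr_monomial k z))) \<partial>torus_measure)"
    by (simp add: complex_norm_square sum_product mult_ac del: of_real_power)
  also have "\<dots> = (\<Sum>j\<in>A. \<Sum>k\<in>A. (c j * cnj (c k)) * (\<integral>z. (bohr_monomial j z * cnj (bohr_monomial k z)) \<partial>torus_measure))"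
    using int' by (simp add: Bochner_Integration.integral_sum)
  also have "\<dots> = (\<Sum>j\<in>A. \<Sum>k\<in>A. (c j * cnj (c k)) * (if j = k then 1 else 0))"
    using assms(2) by (intro sum.cong refl arg_cong2[where f="(*)"] bohr_orthonormal) (auto intro: Suc_leI gr0I)
  also have "\<dots> = (\<Sum>j\<in>A. c j * cnj (c j))"
    using assms by (simp add: if_distrib cong: if_cong)
  also have "\<dots> = complex_of_real (\<Sum>j\<in>A. (norm (c j))\<^sup>2)"
    by (simp add: complex_norm_square del: of_real_power)
  finally show ?thesis by (simp only: of_real_eq_iff)
qed

lemma bohr_lift_eq_sum:
  assumes "finite A" "{n. n \<ge> 1 \<and> a n \<noteq> 0} \<subseteq> A" "0 \<notin> A"
  shows "bohr_lift a z = (\<Sum>n\<in>A. a n * bohr_monomial n z)"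
  unfolding bohr_lift_def using assms
  by (intro sum.mono_neutral_left) (auto simp: Suc_le_eq intro: gr0I)

lemma bohr_lift_finite:
  assumes "finite A" "0 \<notin> A"
  shows "bohr_lift (\<lambda>n. if n \<in> A then a n else 0) z = (\<Sum>n\<in>A. a n * bohr_monomial n z)"
  by (subst bohr_lift_eq_sum[OF assms(1) _ assms(2)]) (auto intro!: sum.cong)

lemma bohr_lift_measurable [measurable]: "bohr_lift a \<in> borel_measurable (Pi\<^sub>M UNIV (\<lambda>_. borel))"
  unfolding bohr_lift_def[abs_def] by measurable

section \<open>Means of the Bohr lift and reduction to one variable\<close>

text \<open>The \<open>p\<close>-th power of \<open>Hp_norm\<close>: without the root, the quantity
  is a plain integral, to which monotonicity and Fubini apply directly.\<close>

definition lift_int :: "real \<Rightarrow> (nat \<Rightarrow> complex) \<Rightarrow> real" where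
  "lift_int p a = (\<integral>z. norm (bohr_lift a z) powr p \<partial>torus_measure)"

lemma Hp_norm_eq: "Hp_norm p a = lift_int p a powr (1 / p)"
  by (simp add: Hp_norm_def lift_int_def)

lemma lift_int_nonneg: "0 \<le> lift_int p a"
  by (simp add: lift_int_def integral_nonneg_AE)

lemma Hp_norm_less_iff:
  assumes "0 < p" "0 < e"
  shows "Hp_norm p a < e \<longleftrightarrow> lift_int p a < e powr p"
proof -
  have "lift_int p a < e powr p \<longleftrightarrow> lift_int p a powr (1/p) < (e powr p) powr (1/p)"
    using assms lift_int_nonneg by (smt (verit) powr_less_mono2 powr_ge_zero zero_less_divide_1_iff)
  then show ?thesis using assms by (simp add: Hp_norm_eq powr_powr)
qed

lemma dirichlet_polynomials_finite: "a \<in> dirichlet_polynomials \<Longrightarrow> finite {n. n \<ge> 1 \<and> a n \<noteq> 0}"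
  by (auto simp: dirichlet_polynomials_def intro: finite_subset[of _ "{n. a n \<noteq> 0}"])

text \<open>On unimodular points the lift is bounded by the sum of the moduli of the coefficients.
  For infinite support both sums default to 0, so the bound persists.\<close>

lemma integrable_lift_powr:
  assumes "0 \<le> p"
  shows "integrable torus_measure (\<lambda>z. norm (bohr_lift a z) powr p)"
proof (rule integrable_torus_bounded[of _ "(\<Sum>n | n \<ge> 1 \<and> a n \<noteq> 0. norm (a n)) powr p"])
  fix z :: "nat \<Rightarrow> complex" assume z: "\<And>j. norm (z j) = 1"
  have "norm (bohr_lift a z) \<le> (\<Sum>n | n \<ge> 1 \<and> a n \<noteq> 0. norm (a n))"
    unfolding bohr_lift_def by (rule sum_norm_le) (simp add: norm_mult norm_bohr_monomial z)
  then show "norm (norm (bohr_lift a z) powr p) \<le> (\<Sum>n | n \<ge> 1 \<and> a n \<noteq> 0. norm (a n)) powr p"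
    using assms by (simp add: powr_mono2)
qed measurable

lemma integral_torus_component:
  fixes f :: "complex \<Rightarrow> real"
  assumes [measurable]: "f \<in> borel_measurable borel"
  shows "(\<integral>z. f (z j) \<partial>torus_measure) = integral\<^sup>L circle_measure f"
proof -
  have "integral\<^sup>L circle_measure f = integral\<^sup>L (distr torus_measure circle_measure (\<lambda>z. z j)) f"
    by (simp only: distr_torus_component)
  also have "\<dots> = (\<integral>z. f (z j) \<partial>torus_measure)"
    by (rule integral_distr) measurable
  finally show ?thesis ..
qed

lemma nu_power: "nu j (nth_prime i ^ k) = (if j = i then k else 0)"
  using prime_nth_prime[of i] prime_nth_prime[of j] inj_nth_prime
  by (auto simp: nu_def inj_eq multiplicity_distinct_prime_power)

lemma nth_prime_gt_1: "nth_prime j > 1"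
  using prime_gt_1_nat[OF prime_nth_prime] .

lemma inj_nth_prime_power: "inj (\<lambda>k. nth_prime j ^ k)"
  using nth_prime_gt_1[of j] by (auto intro!: injI)

lemma bohr_monomial_power: "bohr_monomial (nth_prime i ^ k) z = z i ^ k"
proof -
  have "nth_prime j dvd nth_prime i ^ k \<Longrightarrow> j = i" for j
    using prime_nth_prime[of i] prime_nth_prime[of j] inj_nth_prime
    by (metis prime_dvd_power primes_dvd_imp_eq injD)
  then have "{j. nth_prime j dvd nth_prime i ^ k} \<subseteq> {i}" by blast
  moreover have "nth_prime i ^ k \<ge> 1" using nth_prime_gt_1[of i] by simp
  ultimately show ?thesis
    using bohr_monomial_eq_prod[of "nth_prime i ^ k" "{i}" z] by (simp add: nu_power)
qed

text \<open>On powers of one prime the lift depends on a single coordinate, whose law is that of the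
  circle.\<close>

lemma lift_int_powers:
  assumes "finite K"
  shows "lift_int p (\<lambda>n. if n \<in> (\<lambda>k. nth_prime j ^ k) ` K then a n else 0) =
    (\<integral>x. norm (\<Sum>k\<in>K. a (nth_prime j ^ k) * x ^ k) powr p \<partial>circle_measure)"
proof -
  have 0: "0 \<notin> (\<lambda>k. nth_prime j ^ k) ` K" using nth_prime_gt_1[of j] by auto
  have "bohr_lift (\<lambda>n. if n \<in> (\<lambda>k. nth_prime j ^ k) ` K then a n else 0) z = (\<Sum>k\<in>K. a (nth_prime j ^ k) * z j ^ k)" for z
    using assms 0 by (subst bohr_lift_finite)
      (auto simp: sum.reindex inj_on_subset[OF inj_nth_prime_power] bohr_monomial_power)
  then show ?thesis
    unfolding lift_int_def
    by (simp add: integral_torus_component[of "\<lambda>x. norm (\<Sum>k\<in>K. a (nth_prime j ^ k) * x ^ k) powr p"])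
qed

lemma lift_int_dilation:
  assumes fin: "finite {n. n \<ge> 1 \<and> a n \<noteq> 0}" and q: "0 < q" and r: "0 \<le> r" "r \<le> 1"
  shows "lift_int q (\<lambda>n. a n * of_real (r ^ nu j n)) \<le> lift_int q a"
proof -
  define A where "A = {n. n \<ge> 1 \<and> a n \<noteq> 0}"
  have A: "finite A" "0 \<notin> A" using fin by (auto simp: A_def)
  \<comment> \<open>With all coordinates but \<open>j\<close> frozen the lift is the polynomial
    \<open>Q z\<close> in coordinate \<open>j\<close>; \<open>hardy_dilation\<close> is applied to
    it fibre by fibre.\<close>
  define Q where "Q z = (\<Sum>n\<in>A. monom (a n * bohr_monomial n (z(j := 1))) (nu j n))" for z
  define b where "b = (\<lambda>n. a n * of_real (r ^ nu j n))"
  have Q: "poly (Q z) x = (\<Sum>n\<in>A. a n * bohr_monomial n (z(j := 1)) * x ^ nu j n)" for z x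
    by (simp add: Q_def poly_sum poly_monom)
  have la: "bohr_lift a (z(j := x)) = poly (Q z) x" for z x
    unfolding Q by (subst bohr_lift_eq_sum[of A])
      (use A in \<open>auto simp: A_def intro!: sum.cong bohr_monomial_update[THEN trans]\<close>)
  have lb: "bohr_lift b (z(j := x)) = poly (Q z) (of_real r * x)" for z x
    unfolding Q b_def by (subst bohr_lift_eq_sum[of A])
      (use A in \<open>auto simp: A_def power_mult_distrib intro!: sum.cong bohr_monomial_update[THEN trans]
        bohr_monomial_update[THEN arg_cong2[where f="(*)", OF refl], THEN trans]\<close>)
  have ia: "integrable torus_measure (\<lambda>z. norm (bohr_lift a z) powr q)"
    and ib: "integrable torus_measure (\<lambda>z. norm (bohr_lift b z) powr q)"
    using q by (auto intro!: integrable_lift_powr)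
  have "lift_int q b = (\<integral>z. \<integral>x. norm (bohr_lift b (z(j := x))) powr q \<partial>circle_measure \<partial>torus_measure)"
    unfolding lift_int_def by (rule integral_torus_update(1)[OF ib, symmetric])
  also have "\<dots> \<le> (\<integral>z. \<integral>x. norm (bohr_lift a (z(j := x))) powr q \<partial>circle_measure \<partial>torus_measure)"
  proof (rule integral_mono)
    show "(\<integral>x. norm (bohr_lift b (z(j := x))) powr q \<partial>circle_measure) \<le> (\<integral>x. norm (bohr_lift a (z(j := x))) powr q \<partial>circle_measure)" for z
      unfolding la lb by (rule hardy_dilation[OF q r])
  qed (intro integral_torus_update(2)[OF ia] integral_torus_update(2)[OF ib])+
  also have "\<dots> = lift_int q a"
    unfolding lift_int_def by (rule integral_torus_update(1)[OF ia])
  finally show ?thesis by (simp add: b_def)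
qed

lemma lift_int_kill_variables:
  assumes fin: "finite {n. n \<ge> 1 \<and> a n \<noteq> 0}" and q: "0 < q"
  shows "lift_int q (\<lambda>n. if \<forall>j\<in>{1..J}. nu j n = 0 then a n else 0) \<le> lift_int q a"
proof (induction J)
  case (Suc J)
  define b where "b = (\<lambda>n. if \<forall>j\<in>{1..J}. nu j n = 0 then a n else 0)"
  have fb: "finite {n. n \<ge> 1 \<and> b n \<noteq> 0}"
    by (rule finite_subset[OF _ fin]) (auto simp: b_def)
  \<comment> \<open>Dilation by \<open>r = 0\<close>: since \<open>0 ^ 0 = 1\<close>, exactly the
    monomials containing the variable are removed.\<close>
  have "(\<lambda>n. if \<forall>j\<in>{1..Suc J}. nu j n = 0 then a n else 0) = (\<lambda>n. b n * of_real (0 ^ nu (Suc J) n))"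
    by (auto simp: fun_eq_iff b_def atLeastAtMostSuc_conv power_0_left)
  then have "lift_int q (\<lambda>n. if \<forall>j\<in>{1..Suc J}. nu j n = 0 then a n else 0) \<le> lift_int q b"
    using lift_int_dilation[OF fb q, of 0 "Suc J"] by simp
  also have "\<dots> \<le> lift_int q a" using Suc by (simp add: b_def)
  finally show ?case .
qed simp

text \<open>A finite support involves finitely many primes, so removing finitely many variables
  leaves only powers of the first prime.\<close>

lemma lift_int_restrict_powers:
  assumes fin: "finite {n. n \<ge> 1 \<and> a n \<noteq> 0}" and q: "0 < q"
  shows "\<exists>P::complex poly. (\<forall>k. coeff P k = a (nth_prime 0 ^ k)) \<and>
    (\<integral>x. norm (poly P x) powr q \<partial>circle_measure) \<le> lift_int q a"
proof -
  define A where "A = {n. n \<ge> 1 \<and> a n \<noteq> 0}"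
  have A: "finite A" "\<And>n. n \<in> A \<Longrightarrow> n \<ge> 1" using fin by (auto simp: A_def)
  define K where "K = {k. nth_prime 0 ^ k \<in> A}"
  have K: "finite K"
    using finite_vimageI[OF A(1) inj_nth_prime_power[of 0]] by (simp add: K_def vimage_def)
  have "finite (\<Union>n\<in>A. {j. nth_prime j dvd n})"
    using A by (intro finite_UN_I finite_nth_prime_dvd) auto
  \<comment> \<open>\<open>J\<close> bounds the index of every prime dividing a number of the
    support.\<close>
  then obtain J where J: "\<And>n j. n \<in> A \<Longrightarrow> nth_prime j dvd n \<Longrightarrow> j \<le> J"
    unfolding finite_nat_set_iff_bounded_le by blast
  \<comment> \<open>The equality is one of lifts: the coefficient sequences may differ at index 0,
    where all exponents are 0 by convention.\<close>
  have eq: "bohr_lift (\<lambda>n. if \<forall>j\<in>{1..J}. nu j n = 0 then a n else 0) =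
    bohr_lift (\<lambda>n. if n \<in> (\<lambda>k. nth_prime 0 ^ k) ` K then a n else 0)"
  proof -
    define b where "b = (\<lambda>n. if \<forall>j\<in>{1..J}. nu j n = 0 then a n else 0)"
    define c where "c = (\<lambda>n. if n \<in> (\<lambda>k. nth_prime 0 ^ k) ` K then a n else 0)"
    have "b n = c n" if n: "n \<ge> 1" for n
    proof (cases "n \<in> A")
      case False
      then have "a n = 0" using n by (simp add: A_def)
      then show ?thesis by (simp add: b_def c_def)
    next
      case nA: True
      show ?thesis
      proof (cases "\<forall>j\<in>{1..J}. nu j n = 0")
        case L: True
        have nu_eq: "nu j n = nu j (nth_prime 0 ^ nu 0 n)" for j
        proof (cases "j = 0")
          case False
          have "nu j n = 0"
          proof (cases "nth_prime j dvd n")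
            case True
            then have "j \<in> {1..J}" using J[OF nA True] \<open>j \<noteq> 0\<close> by simp
            then show ?thesis using L by blast
          qed (simp add: nu_def not_dvd_imp_multiplicity_0)
          then show ?thesis using False by (simp add: nu_power)
        qed (simp add: nu_power)
        have pn: "n = nth_prime 0 ^ nu 0 n"
        proof (rule nu_ext[OF n _ nu_eq])
          show "1 \<le> nth_prime 0 ^ nu 0 n" using nth_prime_gt_1[of 0] by (intro one_le_power) simp
        qed
        have "nu 0 n \<in> K" unfolding K_def mem_Collect_eq pn[symmetric] by (rule nA)
        then have "n \<in> (\<lambda>k. nth_prime 0 ^ k) ` K" by (rule rev_image_eqI) (rule pn)
        then show ?thesis unfolding b_def c_def using L by presburger
      next
        case False
        then have "n \<notin> (\<lambda>k. nth_prime 0 ^ k) ` K" by (auto simp: nu_power)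
        then show ?thesis unfolding b_def c_def using False by (simp only: if_False)
      qed
    qed
    then have "{n. n \<ge> 1 \<and> b n \<noteq> 0} = {n. n \<ge> 1 \<and> c n \<noteq> 0}" by auto
    then have "bohr_lift b = bohr_lift c"
      unfolding bohr_lift_def using \<open>\<And>n. n \<ge> 1 \<Longrightarrow> b n = c n\<close> by (intro ext sum.cong) auto
    then show ?thesis unfolding b_def c_def .
  qed
  define P where "P = (\<Sum>k\<in>K. monom (a (nth_prime 0 ^ k)) k)"
  have "coeff P k = a (nth_prime 0 ^ k)" for k
  proof -
    have "coeff P k = (if k \<in> K then a (nth_prime 0 ^ k) else 0)"
      unfolding P_def coeff_sum coeff_monom using K by simp
    moreover have "a (nth_prime 0 ^ k) = 0" if "k \<notin> K"
      using that one_le_power[OF less_imp_le[OF nth_prime_gt_1[of 0]], of k] unfolding K_def A_def by blast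
    ultimately show ?thesis by simp
  qed
  moreover have "(\<integral>x. norm (poly P x) powr q \<partial>circle_measure) \<le> lift_int q a"
  proof -
    have "(\<integral>x. norm (poly P x) powr q \<partial>circle_measure) = lift_int q (\<lambda>n. if n \<in> (\<lambda>k. nth_prime 0 ^ k) ` K then a n else 0)"
      by (simp add: lift_int_powers[OF K] P_def poly_sum poly_monom)
    also have "\<dots> = lift_int q (\<lambda>n. if \<forall>j\<in>{1..J}. nu j n = 0 then a n else 0)"
      by (simp only: lift_int_def eq)
    also have "\<dots> \<le> lift_int q a" by (rule lift_int_kill_variables[OF fin q])
    finally show ?thesis .
  qed
  ultimately show ?thesis by blast
qed

section \<open>Dirichlet series\<close>

lemma dirichlet_series_finite:
  assumes "finite A" "0 \<notin> A" "\<And>n. n \<ge> 1 \<Longrightarrow> n \<notin> A \<Longrightarrow> a n = 0"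
  shows "dirichlet_series a s = (\<Sum>n\<in>A. a n * of_nat n powr (- s))"
proof -
  obtain M where M: "\<And>n. n \<in> A \<Longrightarrow> n \<le> M" using assms(1) unfolding finite_nat_set_iff_bounded_le by blast
  have "dirichlet_partial_sum a N s = (\<Sum>n\<in>A. a n * of_nat n powr (- s))" if "N \<ge> M" for N
    unfolding dirichlet_partial_sum_def
  proof (rule sum.mono_neutral_right)
    show "A \<subseteq> {1..N}"
    proof
      fix n assume n: "n \<in> A"
      then have "n \<noteq> 0" using assms(2) by metis
      then show "n \<in> {1..N}" using M[OF n] that by simp
    qed
  qed (use assms(3) in auto)
  then have "(\<lambda>N. dirichlet_partial_sum a N s) \<longlonglongrightarrow> (\<Sum>n\<in>A. a n * of_nat n powr (- s))"
    by (intro tendsto_eventually eventually_sequentiallyI[of M]) auto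
  then show ?thesis unfolding dirichlet_series_def by (rule limI)
qed

section \<open>Recovering coefficients from values on a vertical line\<close>

lemma geometric_average_tendsto_0:
  fixes w :: complex
  assumes "norm w = 1" "w \<noteq> 1"
  shows "(\<lambda>L. (\<Sum>l<L. w ^ l) / of_nat L) \<longlonglongrightarrow> 0"
proof (rule Lim_null_comparison)
  show "\<forall>\<^sub>F L in sequentially. norm ((\<Sum>l<L. w ^ l) / of_nat L) \<le> (2 / norm (1 - w)) * inverse (real L)"
  proof (intro always_eventually allI)
    fix L
    have "norm (\<Sum>l<L. w ^ l) = norm (1 - w ^ L) / norm (1 - w)"
      using assms(2) by (simp only: sum_gp_strict if_False norm_divide)
    also have "\<dots> \<le> 2 / norm (1 - w)"
    proof (rule divide_right_mono)
      have "norm (w ^ L) = 1" using assms(1) by (simp add: norm_power)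
      then show "norm (1 - w ^ L) \<le> 2" using norm_triangle_ineq4[of 1 "w ^ L"] by simp
    qed simp
    finally show "norm ((\<Sum>l<L. w ^ l) / of_nat L) \<le> (2 / norm (1 - w)) * inverse (real L)"
      unfolding norm_divide norm_of_nat divide_inverse[of _ "real L"] by (rule mult_right_mono) simp
  qed
  show "(\<lambda>L. (2 / norm (1 - w)) * inverse (real L)) \<longlonglongrightarrow> 0"
    by (rule tendsto_mult_right_zero[OF lim_inverse_n])
qed

text \<open>Dividing by \<open>w m ^ l\<close> and averaging over \<open>l < L\<close> leaves
  \<open>c m\<close> in the limit, because the other ratios are unimodular and different from 1. The
  averages never exceed \<open>B\<close>.\<close>

lemma exponential_sum_coeff_bound:
  fixes c w :: "nat \<Rightarrow> complex"
  assumes A: "finite A" "m \<in> A" and w: "\<And>n. n \<in> A \<Longrightarrow> norm (w n) = 1" "inj_on w A"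
    and B: "\<And>l::nat. norm (\<Sum>n\<in>A. c n * w n ^ l) \<le> B"
  shows "norm (c m) \<le> B"
proof -
  define v where "v n = w n / w m" for n
  have wm: "w m \<noteq> 0" using w(1)[OF A(2)] by auto
  have "(\<lambda>L. \<Sum>n\<in>A. c n * ((\<Sum>l<L. v n ^ l) / of_nat L)) \<longlonglongrightarrow> (\<Sum>n\<in>A. c n * (if n = m then 1 else 0))"
  proof (intro tendsto_sum tendsto_mult tendsto_const)
    fix n assume n: "n \<in> A"
    show "(\<lambda>L. (\<Sum>l<L. v n ^ l) / of_nat L) \<longlonglongrightarrow> (if n = m then 1 else 0)"
    proof (cases "n = m")
      case True
      have "(\<lambda>L. (\<Sum>l<L. v n ^ l) / of_nat L) \<longlonglongrightarrow> 1"
        by (rule tendsto_eventually, rule eventually_sequentiallyI[of 1]) (use True wm in \<open>simp add: v_def\<close>)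
      then show ?thesis using True by simp
    next
      case False
      have "norm (v n) = 1" using w(1)[OF n] w(1)[OF A(2)] by (simp add: v_def norm_divide)
      moreover have "w n \<noteq> w m" using inj_onD[OF w(2) _ n A(2)] False by blast
      then have "v n \<noteq> 1" using wm by (simp add: v_def)
      ultimately show ?thesis using geometric_average_tendsto_0 False by simp
    qed
  qed
  also have "(\<Sum>n\<in>A. c n * (if n = m then 1 else 0)) = c m" using A by (simp add: if_distrib cong: if_cong)
  finally have "(\<lambda>L. norm (\<Sum>n\<in>A. c n * ((\<Sum>l<L. v n ^ l) / of_nat L))) \<longlonglongrightarrow> norm (c m)"
    by (rule tendsto_norm)
  moreover have "norm (\<Sum>n\<in>A. c n * ((\<Sum>l<L. v n ^ l) / of_nat L)) \<le> B" if L: "L \<ge> 1" for L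
  proof -
    have "(\<Sum>n\<in>A. c n * ((\<Sum>l<L. v n ^ l) / of_nat L)) = (\<Sum>l<L. (\<Sum>n\<in>A. c n * w n ^ l) / w m ^ l) / of_nat L"
      by (simp add: v_def sum_distrib_left sum_divide_distrib power_divide, subst sum.swap) simp
    also have "norm \<dots> \<le> (\<Sum>l<L. B) / real L"
      unfolding norm_divide norm_of_nat
      by (intro divide_right_mono sum_norm_le) (use B w(1)[OF A(2)] in \<open>auto simp: norm_divide norm_power\<close>)
    also have "\<dots> = B" using L by simp
    finally show ?thesis .
  qed
  ultimately show ?thesis
    by (intro tendsto_upperbound[where F=sequentially]) (auto intro: eventually_sequentiallyI[of 1])
qed

lemma nat_powr_imaginary_step:
  assumes "n \<ge> 1"
  shows "(of_nat n :: complex) powr (- (of_real \<sigma> + \<i> * of_real (real l * h))) = of_real (real n powr (- \<sigma>)) * cis (- h * ln n) ^ l"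
proof -
  have "(of_nat n :: complex) powr (- (of_real \<sigma> + \<i> * of_real (real l * h))) =
     exp (- (of_real \<sigma> + \<i> * of_real (real l * h)) * of_real (ln n))"
    using assms Ln_of_nat[of n] by (simp add: powr_def Ln_of_real)
  also have "\<dots> = exp (of_real (- \<sigma> * ln n) + \<i> * of_real (real l * (- h * ln n)))"
    by (simp add: algebra_simps)
  also have "\<dots> = exp (of_real (- \<sigma> * ln n)) * cis (- h * ln n) ^ l"
    unfolding exp_add cis_conv_exp[symmetric] Complex.DeMoivre ..
  also have "exp (of_real (- \<sigma> * ln n)) = complex_of_real (real n powr (- \<sigma>))"
    using assms by (simp add: powr_def flip: exp_of_real)
  finally show ?thesis .
qed

text \<open>Provides a sampling step at which different \<open>n\<close> of a finite set have
  different frequencies modulo a full turn.\<close>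

lemma inj_on_cis_ln:
  assumes "finite A" "0 \<notin> A"
  shows "\<exists>h>0. inj_on (\<lambda>n::nat. cis (- h * ln n)) A"
proof -
  obtain M where M: "\<And>n. n \<in> A \<Longrightarrow> n \<le> M" using assms(1) unfolding finite_nat_set_iff_bounded_le by blast
  \<comment> \<open>Small enough that \<open>h * ln n\<close> lies in \<open>{0..<1}\<close> for all
    \<open>n\<close> up to \<open>M\<close>; two such angles differ by less than a full
    turn.\<close>
  define h where "h = 1 / (1 + ln (real M + 1))"
  have h: "h > 0" by (simp add: h_def add_pos_nonneg)
  have bd: "h * ln n \<in> {0..<1}" if "n \<in> A" for n
  proof -
    have n: "n \<ge> 1" using that assms(2) by (metis less_one not_le)
    have "h * ln n \<le> h * ln (real M + 1)"
      using n M[OF that] h by (intro mult_left_mono) auto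
    also have "\<dots> < 1" by (simp add: h_def add_pos_nonneg)
    finally show ?thesis using n h by simp
  qed
  have "inj_on (\<lambda>n::nat. cis (- h * ln n)) A"
  proof (rule inj_onI)
    fix n m assume nm: "n \<in> A" "m \<in> A" and eq: "cis (- h * ln n) = cis (- h * ln m)"
    have "cis (h * ln m - h * ln n) = cis (h * ln m) * cis (- h * ln n)" by (simp add: cis_mult)
    also have "\<dots> = cis (h * ln m) * cis (- h * ln m)" by (simp only: eq)
    also have "\<dots> = 1" by (simp add: cis_mult)
    finally have "cis (h * ln m - h * ln n) = 1" .
    then have "cos (h * ln m - h * ln n) = 1" by (metis cis.sel(1) one_complex.sel(1))
    then obtain k :: int where k: "h * ln m - h * ln n = real_of_int k * 2 * pi" using cos_one_2pi_int by blast
    have "\<bar>real_of_int k * 2 * pi\<bar> < 1" unfolding k[symmetric] using bd[OF nm(1)] bd[OF nm(2)] by auto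
    moreover have "\<bar>real_of_int k * 2 * pi\<bar> \<ge> \<bar>real_of_int k\<bar> * 1"
      using pi_gt3 mult_left_mono[of 1 "2 * pi" "\<bar>real_of_int k\<bar>"] by (simp add: abs_mult mult.assoc)
    ultimately have "k = 0" by linarith
    then have "ln (real m) = ln (real n)" using k h by simp
    moreover have "real n > 0" "real m > 0" using nm assms(2) by (auto intro: gr0I)
    ultimately show "n = m" by simp
  qed
  then show ?thesis using h by blast
qed

text \<open>Sampled at imaginary parts \<open>l * h\<close>, a Dirichlet polynomial is an
  exponential sum in \<open>l\<close> with coefficients
  \<open>c n * n powr (- \<sigma>)\<close>.\<close>

lemma dirichlet_coeff_bound:
  fixes c :: "nat \<Rightarrow> complex"
  assumes A: "finite A" "0 \<notin> A" "m \<in> A"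
    and B: "\<And>s. Re s = \<sigma> \<Longrightarrow> norm (\<Sum>n\<in>A. c n * of_nat n powr (- s)) \<le> B"
  shows "norm (c m) \<le> B * real m powr \<sigma>"
proof -
  obtain h where h: "inj_on (\<lambda>n::nat. cis (- h * ln n)) A" using inj_on_cis_ln[OF A(1,2)] by blast
  have "norm (c m * of_real (real m powr (- \<sigma>))) \<le> B"
  proof (rule exponential_sum_coeff_bound[OF A(1,3) _ h])
    fix l :: nat
    have "(\<Sum>n\<in>A. c n * of_real (real n powr (- \<sigma>)) * cis (- h * ln n) ^ l) =
      (\<Sum>n\<in>A. c n * of_nat n powr (- (of_real \<sigma> + \<i> * of_real (real l * h))))"
      using A(2) by (intro sum.cong refl, subst nat_powr_imaginary_step) (auto simp: mult.assoc Suc_le_eq intro: gr0I)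
    also have "norm \<dots> \<le> B" by (rule B) simp
    finally show "norm (\<Sum>n\<in>A. c n * of_real (real n powr (- \<sigma>)) * cis (- h * ln n) ^ l) \<le> B" .
  qed simp
  then have "norm (c m) * real m powr (- \<sigma>) \<le> B" by (simp add: norm_mult)
  then have "norm (c m) * real m powr (- \<sigma>) * real m powr \<sigma> \<le> B * real m powr \<sigma>"
    by (intro mult_right_mono) auto
  moreover have "real m powr (- \<sigma>) * real m powr \<sigma> = 1"
    using A by (subst powr_add[symmetric]) (auto intro: gr0I)
  ultimately show ?thesis by (simp add: mult.assoc)
qed

text \<open>The difference of \<open>P k\<close> and a long partial sum of \<open>a\<close> is again
  a Dirichlet polynomial, small on a vertical line since both are close to \<open>f\<close>; the
  coefficient bound then applies to it.\<close>

lemma dirichlet_coeff_tendsto: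
  assumes P: "\<And>k. P k \<in> dirichlet_polynomials"
    and u1: "uniform_limit (half_plane \<theta>) (dirichlet_partial_sum a) f sequentially"
    and u2: "uniform_limit (half_plane \<theta>) (\<lambda>k. dirichlet_series (P k)) f sequentially"
    and m: "m \<ge> 1"
  shows "(\<lambda>k. P k m) \<longlonglongrightarrow> a m"
proof (rule LIMSEQ_I)
  fix e :: real assume e: "0 < e"
  \<comment> \<open>The half plane is open, so the line is taken strictly inside it.\<close>
  define \<sigma> where "\<sigma> = \<theta> + 1"
  define d where "d = e / (4 * real m powr \<sigma>)"
  have d: "d > 0" using e m by (simp add: d_def)
  have "\<forall>\<^sub>F N in sequentially. \<forall>s\<in>half_plane \<theta>. dist (dirichlet_partial_sum a N s) (f s) < d"
    using u1 d by (rule uniform_limitD)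
  then obtain N0 where N0: "\<And>N s. N \<ge> N0 \<Longrightarrow> s \<in> half_plane \<theta> \<Longrightarrow> dist (dirichlet_partial_sum a N s) (f s) < d"
    by (auto simp: eventually_sequentially)
  \<comment> \<open>The partial sum must be long enough to contain index \<open>m\<close>.\<close>
  define N where "N = max N0 m"
  have N: "N \<ge> N0" "N \<ge> m" by (auto simp: N_def)
  have "\<forall>\<^sub>F k in sequentially. \<forall>s\<in>half_plane \<theta>. dist (dirichlet_series (P k) s) (f s) < d"
    using u2 d by (rule uniform_limitD)
  then obtain K where K: "\<And>k s. k \<ge> K \<Longrightarrow> s \<in> half_plane \<theta> \<Longrightarrow> dist (dirichlet_series (P k) s) (f s) < d"
    by (auto simp: eventually_sequentially)
  have "norm (P k m - a m) < e" if k: "k \<ge> K" for k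
  proof -
    define A where "A = {n. n \<ge> 1 \<and> P k n \<noteq> 0} \<union> {1..N}"
    have A: "finite A" "0 \<notin> A" "m \<in> A" using dirichlet_polynomials_finite[OF P[of k]] m N by (auto simp: A_def)
    define c where "c n = P k n - (if n \<le> N then a n else 0)" for n
    have "norm (c m) \<le> (d + d) * real m powr \<sigma>"
    proof (rule dirichlet_coeff_bound[OF A])
      fix s :: complex assume "Re s = \<sigma>"
      then have s: "s \<in> half_plane \<theta>" by (simp add: half_plane_def \<sigma>_def)
      have 1: "dirichlet_series (P k) s = (\<Sum>n\<in>A. P k n * of_nat n powr (- s))"
        by (rule dirichlet_series_finite) (use A in \<open>auto simp: A_def\<close>)
      have 2: "dirichlet_partial_sum a N s = (\<Sum>n\<in>A. (if n \<le> N then a n else 0) * of_nat n powr (- s))"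
        unfolding dirichlet_partial_sum_def using A(1)
        by (intro sum.mono_neutral_cong_left) (auto simp: A_def)
      have "(\<Sum>n\<in>A. c n * of_nat n powr (- s)) = dirichlet_series (P k) s - dirichlet_partial_sum a N s"
        unfolding 1 2 c_def by (simp add: left_diff_distrib sum_subtractf)
      also have "norm \<dots> \<le> d + d"
        using K[OF k s] N0[OF N(1) s] dist_triangle2[of "dirichlet_series (P k) s" "dirichlet_partial_sum a N s" "f s"]
        by (simp add: dist_norm)
      finally show "norm (\<Sum>n\<in>A. c n * of_nat n powr (- s)) \<le> d + d" .
    qed
    also have "\<dots> = e / 2" using m by (simp add: d_def)
    finally show ?thesis using N e by (simp add: c_def)
  qed
  then show "\<exists>K. \<forall>k\<ge>K. norm (P k m - a m) < e" by blast
qed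

section \<open>Consequences of, and a criterion for, membership in \<open>Hp_space\<close>\<close>

text \<open>Trades uniform convergence for convergence of each coefficient, the form in which both
  directions of the equivalence use membership.\<close>

lemma Hp_spaceE:
  assumes "a \<in> Hp_space p"
  obtains P where "\<And>k. P k \<in> dirichlet_polynomials" "Hp_Cauchy p P" "\<And>m. m \<ge> 1 \<Longrightarrow> (\<lambda>k. P k m) \<longlonglongrightarrow> a m"
proof -
  obtain P where P: "\<forall>k. P k \<in> dirichlet_polynomials" "Hp_Cauchy p P"
    "\<forall>\<epsilon>>0. uniform_limit (half_plane (1/2 + \<epsilon>)) (\<lambda>k. dirichlet_series (P k)) (dirichlet_series a) sequentially"
    and a: "\<forall>\<epsilon>>0. uniform_limit (half_plane (1/2 + \<epsilon>)) (dirichlet_partial_sum a) (dirichlet_series a) sequentially"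
    using assms unfolding Hp_space_def by auto
  show ?thesis
  proof (rule that[of P])
    show "(\<lambda>k. P k m) \<longlonglongrightarrow> a m" if "m \<ge> 1" for m
    proof (rule dirichlet_coeff_tendsto[OF _ _ _ that])
      show "uniform_limit (half_plane (1/2 + 1)) (dirichlet_partial_sum a) (dirichlet_series a) sequentially"
        using a zero_less_one by blast
      show "uniform_limit (half_plane (1/2 + 1)) (\<lambda>k. dirichlet_series (P k)) (dirichlet_series a) sequentially"
        using P(3) zero_less_one by blast
    qed (use P(1) in blast)
  qed (use P in blast)+
qed


lemma lift_int_triangle:
  assumes p: "0 < p" and a: "finite {n. n \<ge> 1 \<and> a n \<noteq> 0}" and b: "finite {n. n \<ge> 1 \<and> b n \<noteq> 0}"
  shows "lift_int p (\<lambda>n. a n + b n) \<le> 2 powr p * (lift_int p a + lift_int p b)"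
proof -
  define A where "A = {n. n \<ge> 1 \<and> a n \<noteq> 0} \<union> {n. n \<ge> 1 \<and> b n \<noteq> 0}"
  have A: "finite A" "0 \<notin> A" using a b by (auto simp: A_def)
  have lift: "bohr_lift (\<lambda>n. a n + b n) z = bohr_lift a z + bohr_lift b z" for z
    using A by (subst (1 2 3) bohr_lift_eq_sum[of A]) (auto simp: A_def sum.distrib distrib_right)
  have "lift_int p (\<lambda>n. a n + b n) \<le> (\<integral>z. 2 powr p * (norm (bohr_lift a z) powr p + norm (bohr_lift b z) powr p) \<partial>torus_measure)"
    unfolding lift_int_def using p
    by (intro integral_mono integrable_lift_powr integrable_mult_right Bochner_Integration.integrable_add) (auto simp: lift powr_norm_add_le)
  also have "\<dots> = 2 powr p * (lift_int p a + lift_int p b)"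
    using p by (simp add: lift_int_def integrable_lift_powr)
  finally show ?thesis .
qed

lemma lift_int_Cauchy_bounded:
  assumes p: "0 < p" and P: "\<And>k. P k \<in> dirichlet_polynomials" and C: "Hp_Cauchy p P"
  obtains K B where "\<And>k. k \<ge> K \<Longrightarrow> lift_int p (P k) \<le> B"
proof -
  obtain K where K: "\<And>k l. k \<ge> K \<Longrightarrow> l \<ge> K \<Longrightarrow> Hp_norm p (\<lambda>n. P k n - P l n) < 1"
    using C unfolding Hp_Cauchy_def by (metis zero_less_one)
  show ?thesis
  proof (rule that)
    fix k assume k: "k \<ge> K"
    have fin: "finite {n. n \<ge> 1 \<and> P k n \<noteq> 0}" for k by (rule dirichlet_polynomials_finite[OF P])
    have "lift_int p (\<lambda>n. P k n - P K n) < 1"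
      using K[OF k order_refl] p by (simp add: Hp_norm_less_iff)
    moreover have "lift_int p (\<lambda>n. (P k n - P K n) + P K n) \<le> 2 powr p * (lift_int p (\<lambda>n. P k n - P K n) + lift_int p (P K))"
      by (rule lift_int_triangle[OF p _ fin], rule finite_subset[of _ "{n. n \<ge> 1 \<and> P k n \<noteq> 0} \<union> {n. n \<ge> 1 \<and> P K n \<noteq> 0}"])
         (use fin in auto)
    ultimately show "lift_int p (P k) \<le> 2 powr p * (1 + lift_int p (P K))"
      by (simp, elim order.trans) simp
  qed
qed

lemma Hp_space_square_summable:
  assumes p: "2 \<le> p" and a: "a \<in> Hp_space p"
  shows "summable (\<lambda>n. (norm (a n))\<^sup>2)"
proof -
  obtain P where P: "\<And>k. P k \<in> dirichlet_polynomials" "Hp_Cauchy p P" and lim: "\<And>m. m \<ge> 1 \<Longrightarrow> (\<lambda>k. P k m) \<longlonglongrightarrow> a m"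
    using Hp_spaceE[OF a] by blast
  obtain K B where B: "\<And>k. k \<ge> K \<Longrightarrow> lift_int p (P k) \<le> B"
    by (rule lift_int_Cauchy_bounded[OF _ P]) (use p in auto)
  interpret T: prob_space torus_measure by (rule prob_space_torus_measure)
  have bd: "(\<Sum>n\<in>{1..N}. (norm (P k n))\<^sup>2) \<le> 1 + B" if k: "k \<ge> K" for k N
  proof -
    define A where "A = {n. n \<ge> 1 \<and> P k n \<noteq> 0} \<union> {1..N}"
    have A: "finite A" "0 \<notin> A" using dirichlet_polynomials_finite[OF P(1)[of k]] by (auto simp: A_def)
    have eq: "bohr_lift (P k) z = (\<Sum>n\<in>A. P k n * bohr_monomial n z)" for z
      by (rule bohr_lift_eq_sum) (use A in \<open>auto simp: A_def\<close>)
    have "(\<Sum>n\<in>{1..N}. (norm (P k n))\<^sup>2) \<le> (\<Sum>n\<in>A. (norm (P k n))\<^sup>2)"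
      using A by (intro sum_mono2) (auto simp: A_def)
    also have "\<dots> = (\<integral>z. (norm (bohr_lift (P k) z))\<^sup>2 \<partial>torus_measure)"
      unfolding eq by (rule torus_parseval[OF A, symmetric])
    also have "\<dots> = (\<integral>z. norm (bohr_lift (P k) z) powr 2 \<partial>torus_measure)"
      by simp
    also have "\<dots> \<le> (\<integral>z. 1 + norm (bohr_lift (P k) z) powr p \<partial>torus_measure)"
    proof (intro integral_mono integrable_lift_powr Bochner_Integration.integrable_add)
      fix z
      show "norm (bohr_lift (P k) z) powr 2 \<le> 1 + norm (bohr_lift (P k) z) powr p"
      proof (cases "norm (bohr_lift (P k) z) \<le> 1")
        case True
        then have "norm (bohr_lift (P k) z) powr 2 \<le> 1 powr 2" by (intro powr_mono2) auto
        then show ?thesis using powr_ge_zero[of "norm (bohr_lift (P k) z)" p] unfolding powr_one_eq_one by linarith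
      next
        case False
        then have "norm (bohr_lift (P k) z) powr 2 \<le> norm (bohr_lift (P k) z) powr p"
          using p by (intro powr_mono) auto
        then show ?thesis by simp
      qed
    qed (use p in auto)
    also have "\<dots> = 1 + lift_int p (P k)"
      using p T.prob_space by (simp add: lift_int_def integrable_lift_powr)
    finally show ?thesis using B[OF k] by simp
  qed
  \<comment> \<open>The bound \<open>1 + B\<close> involves neither \<open>k\<close> nor
    \<open>N\<close>: first \<open>k\<close> tends to infinity in a fixed section, then the sections
    grow.\<close>
  have "(\<Sum>n\<in>{1..N}. (norm (a n))\<^sup>2) \<le> 1 + B" for N
  proof (rule tendsto_upperbound)
    show "(\<lambda>k. \<Sum>n\<in>{1..N}. (norm (P k n))\<^sup>2) \<longlonglongrightarrow> (\<Sum>n\<in>{1..N}. (norm (a n))\<^sup>2)"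
      by (intro tendsto_intros lim) auto
    show "\<forall>\<^sub>F k in sequentially. (\<Sum>n\<in>{1..N}. (norm (P k n))\<^sup>2) \<le> 1 + B"
      using bd by (intro eventually_sequentiallyI[of K]) auto
  qed auto
  then have "summable (\<lambda>n. (norm (a (Suc n)))\<^sup>2)"
    by (intro summableI_nonneg_bounded[of _ "1 + B"])
       (auto simp: sum.shift_bounds_Suc_ivl lessThan_Suc_atMost[symmetric] sum.atLeast1_atMost_eq)
  then show ?thesis by (subst (asm) summable_Suc_iff)
qed

lemma lift_int_uminus: "lift_int q (\<lambda>n. - a n) = lift_int q a"
proof -
  have "bohr_lift (\<lambda>n. - a n) z = - bohr_lift a z" for z
    by (simp add: bohr_lift_def sum_negf)
  then show ?thesis by (simp add: lift_int_def)
qed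

text \<open>The weights \<open>(1/2) ^ i\<close> sum to at most 2, so some term must satisfy
  \<open>2 ^ i * norm (D i) \<ge> x / 2\<close>, where \<open>x\<close> is the norm of the sum. The
  constant does not grow with the number of terms, unlike that of an iterated
  \<open>powr_norm_add_le\<close>.\<close>

lemma norm_sum_powr_le:
  fixes D :: "nat \<Rightarrow> 'a::real_normed_vector"
  assumes q: "0 < q" and A: "finite A"
  shows "norm (\<Sum>i\<in>A. D i) powr q \<le> 2 powr q * (\<Sum>i\<in>A. (2 ^ i) powr q * norm (D i) powr q)"
proof (cases "norm (\<Sum>i\<in>A. D i) = 0")
  case True
  then show ?thesis using q by (simp add: sum_nonneg)
next
  case False
  define x where "x = norm (\<Sum>i\<in>A. D i)"
  have x: "x > 0" using False by (simp add: x_def)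
  have "\<exists>i\<in>A. x / 2 \<le> 2 ^ i * norm (D i)"
  proof (rule ccontr)
    assume "\<not> ?thesis"
    then have lt: "norm (D i) < (1/2) ^ i * (x / 2)" if "i \<in> A" for i
      using that by (auto simp: not_le field_simps)
    have "A \<noteq> {}" using x by (auto simp: x_def)
    have "x \<le> (\<Sum>i\<in>A. norm (D i))" unfolding x_def by (rule norm_sum)
    also have "\<dots> < (\<Sum>i\<in>A. (1/2) ^ i * (x / 2))"
      using lt \<open>A \<noteq> {}\<close> A by (intro sum_strict_mono) auto
    also have "\<dots> = (\<Sum>i\<in>A. (1/2) ^ i) * (x / 2)" by (simp add: sum_distrib_right)
    also have "(\<Sum>i\<in>A. (1/2::real) ^ i) \<le> (\<Sum>i. (1/2) ^ i)"
      by (rule sum_le_suminf[OF summable_geometric A]) auto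
    also have "(\<Sum>i. (1/2::real) ^ i) = 2" by (subst suminf_geometric) auto
    finally show False using x by simp
  qed
  then obtain i where i: "i \<in> A" "x \<le> 2 * (2 ^ i * norm (D i))" by auto
  have "x powr q \<le> (2 * (2 ^ i * norm (D i))) powr q"
    using i x q by (intro powr_mono2) auto
  also have "\<dots> = 2 powr q * ((2 ^ i) powr q * norm (D i) powr q)"
    by (simp add: powr_mult)
  also have "\<dots> \<le> 2 powr q * (\<Sum>i\<in>A. (2 ^ i) powr q * norm (D i) powr q)"
    using i(1) A by (intro mult_left_mono member_le_sum) auto
  finally show ?thesis by (simp add: x_def)
qed

definition block :: "(nat \<Rightarrow> nat) \<Rightarrow> (nat \<Rightarrow> complex) \<Rightarrow> nat \<Rightarrow> nat \<Rightarrow> complex" where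
  "block N a k n = (if n \<in> {N k..<N (Suc k)} then a n else 0)"

lemma lift_int_block_sum:
  assumes q: "0 < q" and N: "strict_mono N" "N 0 \<ge> 1" and kl: "k \<le> l"
  shows "lift_int q (\<lambda>n. if n \<in> {N k..<N l} then a n else 0)
    \<le> 2 powr q * (\<Sum>i\<in>{k..<l}. (2 ^ i) powr q * lift_int q (block N a i))"
proof -
  have N0: "N i \<ge> 1" for i using N strict_mono_less_eq[OF N(1), of 0 i] by linarith
  have un: "{N k..<N l} = (\<Union>i\<in>{k..<l}. {N i..<N (Suc i)})"
    using kl
  proof (induction rule: dec_induct)
    case (step m)
    have "N k \<le> N m" "N m \<le> N (Suc m)" using step strict_mono_less_eq[OF N(1)] by auto
    then have "{N k..<N (Suc m)} = {N k..<N m} \<union> {N m..<N (Suc m)}" by auto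
    then show ?case using step by (simp add: atLeastLessThanSuc Un_commute)
  qed simp
  have b: "bohr_lift (block N a i) z = (\<Sum>n\<in>{N i..<N (Suc i)}. a n * bohr_monomial n z)" for i z
    unfolding block_def[abs_def] using N0[of i] by (intro bohr_lift_finite) auto
  have "bohr_lift (\<lambda>n. if n \<in> {N k..<N l} then a n else 0) z = (\<Sum>i\<in>{k..<l}. bohr_lift (block N a i) z)" for z
  proof -
    have "bohr_lift (\<lambda>n. if n \<in> {N k..<N l} then a n else 0) z = (\<Sum>n\<in>{N k..<N l}. a n * bohr_monomial n z)"
      using N0[of k] by (intro bohr_lift_finite) auto
    also have "\<dots> = (\<Sum>i\<in>{k..<l}. \<Sum>n\<in>{N i..<N (Suc i)}. a n * bohr_monomial n z)"
      unfolding un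
    proof (rule sum.UNION_disjoint)
      show "\<forall>i\<in>{k..<l}. \<forall>j\<in>{k..<l}. i \<noteq> j \<longrightarrow> {N i..<N (Suc i)} \<inter> {N j..<N (Suc j)} = {}"
      proof (intro ballI impI)
        fix i j :: nat assume "i \<noteq> j"
        then have "Suc i \<le> j \<or> Suc j \<le> i" by linarith
        then have "N (Suc i) \<le> N j \<or> N (Suc j) \<le> N i" using strict_mono_less_eq[OF N(1)] by blast
        then show "{N i..<N (Suc i)} \<inter> {N j..<N (Suc j)} = {}" by auto
      qed
    qed auto
    finally show ?thesis by (simp only: b)
  qed
  then have "lift_int q (\<lambda>n. if n \<in> {N k..<N l} then a n else 0) = (\<integral>z. norm (\<Sum>i\<in>{k..<l}. bohr_lift (block N a i) z) powr q \<partial>torus_measure)"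
    by (simp only: lift_int_def)
  also have "\<dots> \<le> (\<integral>z. 2 powr q * (\<Sum>i\<in>{k..<l}. (2 ^ i) powr q * norm (bohr_lift (block N a i) z) powr q) \<partial>torus_measure)"
  proof (rule integral_mono)
    have "integrable torus_measure (\<lambda>z. norm (bohr_lift (\<lambda>n. if n \<in> {N k..<N l} then a n else 0) z) powr q)"
      using q by (intro integrable_lift_powr) auto
    then show "integrable torus_measure (\<lambda>z. norm (\<Sum>i\<in>{k..<l}. bohr_lift (block N a i) z) powr q)"
      by (simp only: \<open>\<And>z. bohr_lift (\<lambda>n. if n \<in> {N k..<N l} then a n else 0) z = _\<close>)
    show "integrable torus_measure (\<lambda>z. 2 powr q * (\<Sum>i\<in>{k..<l}. (2 ^ i) powr q * norm (bohr_lift (block N a i) z) powr q))"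
      using q by (intro integrable_mult_right Bochner_Integration.integrable_sum integrable_lift_powr) auto
  qed (rule norm_sum_powr_le[OF q], simp)
  also have "\<dots> = 2 powr q * (\<Sum>i\<in>{k..<l}. (2 ^ i) powr q * lift_int q (block N a i))"
    using q by (simp add: lift_int_def Bochner_Integration.integral_sum integrable_lift_powr)
  finally show ?thesis .
qed

text \<open>The approximants are the partial sums ending at the block boundaries \<open>N k\<close>,
  so their differences are sums of blocks and \<open>sm\<close> makes them Cauchy. Absolute
  convergence to the right of \<open>1/2\<close> supplies both uniform limits by the Weierstrass
  test.\<close>

lemma Hp_spaceI:
  assumes q: "0 < q" and N: "strict_mono N" "N 0 \<ge> 1"
    and abs: "\<And>\<sigma>. \<sigma> > 1/2 \<Longrightarrow> summable (\<lambda>n. norm (a n) * real n powr (- \<sigma>))"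
    and sm: "summable (\<lambda>k. (2 ^ k) powr q * lift_int q (block N a k))"
  shows "a \<in> Hp_space q"
proof -
  define S where "S M s = (\<Sum>n<M. a n * of_nat n powr (- s))" for M and s :: complex
  define f where "f s = (\<Sum>n. a n * of_nat n powr (- s))" for s :: complex
  define P where "P k n = (if n < N k then a n else 0)" for k n
  have N0: "N i \<ge> 1" for i using N strict_mono_less_eq[OF N(1), of 0 i] by linarith
  have u: "uniform_limit (half_plane \<sigma>) S f sequentially" if \<sigma>: "\<sigma> > 1/2" for \<sigma>
    unfolding S_def f_def
  proof (rule Weierstrass_m_test)
    fix n and s assume "s \<in> half_plane \<sigma>"
    then have s: "Re s > \<sigma>" by (simp add: half_plane_def)
    show "norm (a n * of_nat n powr (- s)) \<le> norm (a n) * real n powr (- \<sigma>)"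
    proof (cases "n = 0")
      case False
      then have "norm ((of_nat n :: complex) powr (- s)) = real n powr (- Re s)"
        using norm_powr_real_powr[of "of_nat n" "- s"] by simp
      also have "\<dots> \<le> real n powr (- \<sigma>)" using False s by (intro powr_mono) auto
      finally show ?thesis by (simp add: norm_mult mult_left_mono)
    qed simp
  qed (rule abs[OF \<sigma>])
  \<comment> \<open>Index shift between \<open>{1..M}\<close> and \<open>{..<Suc M}\<close>: the
    extra term at 0 vanishes because \<open>0 powr (- s) = 0\<close>.\<close>
  have ps: "dirichlet_partial_sum a = (\<lambda>M. S (Suc M))"
  proof (intro ext)
    fix M s
    have "S (Suc M) s = (\<Sum>n\<in>{1..M}. a n * of_nat n powr (- s))"
      unfolding S_def by (rule sum.mono_neutral_right) (auto simp: not_le)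
    then show "dirichlet_partial_sum a M s = S (Suc M) s" by (simp add: dirichlet_partial_sum_def)
  qed
  have u1: "uniform_limit (half_plane \<sigma>) (dirichlet_partial_sum a) f sequentially" if "\<sigma> > 1/2" for \<sigma>
    unfolding ps using filterlim_compose[OF u[OF that] filterlim_Suc] .
  have conv: "(\<lambda>M. dirichlet_partial_sum a M s) \<longlonglongrightarrow> f s" if "s \<in> half_plane \<sigma>" "\<sigma> > 1/2" for s \<sigma>
    by (rule tendsto_uniform_limitI[OF u1[OF that(2)] that(1)])
  have ds: "dirichlet_series a s = f s" if "s \<in> half_plane \<sigma>" "\<sigma> > 1/2" for s \<sigma>
    unfolding dirichlet_series_def using conv[OF that] by (rule limI)
  have dP: "dirichlet_series (P k) = S (N k)" for k
  proof
    fix s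
    have "dirichlet_series (P k) s = (\<Sum>n\<in>{1..<N k}. P k n * of_nat n powr (- s))"
      by (rule dirichlet_series_finite) (auto simp: P_def)
    also have "\<dots> = S (N k) s"
      unfolding S_def by (rule sum.mono_neutral_cong_left) (auto simp: P_def not_le)
    finally show "dirichlet_series (P k) s = S (N k) s" .
  qed
  have u2: "uniform_limit (half_plane \<sigma>) (\<lambda>k. dirichlet_series (P k)) f sequentially" if "\<sigma> > 1/2" for \<sigma>
    unfolding dP using filterlim_compose[OF u[OF that] filterlim_subseq[OF N(1)]] .
  have cong: "uniform_limit (half_plane \<sigma>) g f sequentially \<Longrightarrow> uniform_limit (half_plane \<sigma>) g (dirichlet_series a) sequentially"
    if "\<sigma> > 1/2" for \<sigma> and g :: "nat \<Rightarrow> complex \<Rightarrow> complex"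
    using ds[OF _ that] by (subst uniform_limit_cong'[of "half_plane \<sigma>" g g "dirichlet_series a" f]) auto
  have 1: "a \<in> dirichlet_space"
    unfolding dirichlet_space_def mem_Collect_eq convergent_def
    by (intro exI[of _ 1] ballI exI, rule conv[of _ 1]) auto
  have 2: "uniform_limit (half_plane (1/2 + e)) (dirichlet_partial_sum a) (dirichlet_series a) sequentially" if "e > 0" for e
    using that by (intro cong u1) auto
  have 3: "uniform_limit (half_plane (1/2 + e)) (\<lambda>k. dirichlet_series (P k)) (dirichlet_series a) sequentially" if "e > 0" for e
    using that by (intro cong u2) auto
  have 4: "P k \<in> dirichlet_polynomials" for k
    unfolding dirichlet_polynomials_def P_def by (auto intro: finite_subset[of _ "{..<N k}"])
  define J where "J k = (2 ^ k) powr q * lift_int q (block N a k)" for k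
  have J0: "J k \<ge> 0" for k by (simp add: J_def lift_int_nonneg)
  have "Hp_Cauchy q P"
    unfolding Hp_Cauchy_def
  proof (intro allI impI)
    fix e :: real assume e: "0 < e"
    define d where "d = e powr q / (2 * 2 powr q)"
    have d: "d > 0" using e by (simp add: d_def)
    have "(\<lambda>K. \<Sum>i. J (i + K)) \<longlonglongrightarrow> 0"
      using sm unfolding J_def[symmetric] by (rule suminf_exist_split2)
    then have "\<forall>\<^sub>F K in sequentially. (\<Sum>i. J (i + K)) < d" using d by (rule order_tendstoD(2))
    then obtain K where K: "(\<Sum>i. J (i + K)) < d" by (auto simp: eventually_sequentially)
    have main: "lift_int q (\<lambda>n. P l n - P k n) < e powr q" if "K \<le> k" "k \<le> l" for k l
    proof -
      have "N k \<le> N l" using that strict_mono_less_eq[OF N(1)] by blast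
      then have "(\<lambda>n. P l n - P k n) = (\<lambda>n. if n \<in> {N k..<N l} then a n else 0)"
        by (auto simp: P_def fun_eq_iff)
      then have "lift_int q (\<lambda>n. P l n - P k n) \<le> 2 powr q * (\<Sum>i\<in>{k..<l}. J i)"
        using lift_int_block_sum[OF q N that(2), of a] by (simp add: J_def)
      also have "(\<Sum>i\<in>{k..<l}. J i) \<le> (\<Sum>i. J (i + K))"
      proof -
        have "(\<Sum>i\<in>{k..<l}. J i) \<le> (\<Sum>i\<in>{K..<l}. J i)"
          using that J0 by (intro sum_mono2) auto
        also have "\<dots> = (\<Sum>i<l - K. J (i + K))"
          by (rule sum.reindex_bij_witness[of _ "\<lambda>i. i + K" "\<lambda>i. i - K"]) auto
        also have "\<dots> \<le> (\<Sum>i. J (i + K))"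
          using sm J0 by (intro sum_le_suminf) (auto simp: J_def[symmetric] summable_iff_shift)
        finally show ?thesis .
      qed
      also have "2 powr q * \<dots> \<le> 2 powr q * d" using K by (intro mult_left_mono) auto
      also have "\<dots> < e powr q" using e by (simp add: d_def)
      finally show ?thesis by simp
    qed
    show "\<exists>K. \<forall>k\<ge>K. \<forall>l\<ge>K. Hp_norm q (\<lambda>n. P k n - P l n) < e"
    proof (intro exI[of _ K] allI impI)
      fix k l assume kl: "K \<le> k" "K \<le> l"
      have "lift_int q (\<lambda>n. P k n - P l n) < e powr q"
      proof (cases "k \<le> l")
        case True
        then show ?thesis using main[OF kl(1) True] lift_int_uminus[of q "\<lambda>n. P l n - P k n"] by simp
      next
        case False
        then show ?thesis using main[OF kl(2), of k] by simp
      qed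
      then show "Hp_norm q (\<lambda>n. P k n - P l n) < e" using Hp_norm_less_iff[OF q e] by blast
    qed
  qed
  then show ?thesis
    unfolding Hp_space_def using 1 2 3 4 by blast
qed

section \<open>Random sums\<close>

text \<open>Completing the square turns the tilted density into that of the normal law with mean
  \<open>t\<close>.\<close>

lemma std_normal_exp_moment:
  "(\<integral>\<^sup>+x. ennreal (exp (t * x)) \<partial>density lborel std_normal_density) = ennreal (exp (t\<^sup>2 / 2))"
proof -
  have "(\<integral>\<^sup>+x. ennreal (exp (t * x)) \<partial>density lborel std_normal_density) = (\<integral>\<^sup>+x. ennreal (std_normal_density x) * ennreal (exp (t * x)) \<partial>lborel)"
    by (rule nn_integral_density) auto
  also have "\<dots> = (\<integral>\<^sup>+x. ennreal (exp (t\<^sup>2 / 2)) * ennreal (normal_density t 1 x) \<partial>lborel)"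
  proof (rule nn_integral_cong)
    fix x :: real
    have "std_normal_density x * exp (t * x) = exp (t\<^sup>2 / 2) * normal_density t 1 x"
      unfolding normal_density_def by (simp add: mult_exp_exp power2_eq_square field_simps)
    then show "ennreal (std_normal_density x) * ennreal (exp (t * x)) = ennreal (exp (t\<^sup>2 / 2)) * ennreal (normal_density t 1 x)"
      by (simp add: ennreal_mult[symmetric])
  qed
  also have "\<dots> = ennreal (exp (t\<^sup>2 / 2)) * (\<integral>\<^sup>+x. ennreal (normal_density t 1 x) \<partial>lborel)"
    by (rule nn_integral_cmult) auto
  also have "(\<integral>\<^sup>+x. ennreal (normal_density t 1 x) \<partial>lborel) = 1"
    using prob_space.emeasure_space_1[OF prob_space_normal_density[of 1 t]] by (simp add: emeasure_density)
  finally show ?thesis by simp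
qed

text \<open>Bound for the \<open>q\<close>-th moment at variance at most 1: \<open>2 powr q\<close>
  from splitting into real and imaginary part, \<open>q powr q\<close> from comparing a power with
  the exponential, and \<open>exp (1/2)\<close> from each of the four directions 1, -1,
  \<open>\<i>\<close>, \<open>-\<i>\<close>.\<close>

definition moment_const :: "real \<Rightarrow> real" where
  "moment_const q = 2 powr q * q powr q * (4 * exp (1/2))"

text \<open>The inequality \<open>y \<le> exp y\<close> at \<open>y = \<bar>x\<bar> / q\<close>,
  raised to the power \<open>q\<close>.\<close>

lemma abs_powr_le_exp:
  assumes "0 < q"
  shows "\<bar>x::real\<bar> powr q \<le> q powr q * (exp x + exp (- x))"
proof -
  have "\<bar>x\<bar> / q \<le> exp (\<bar>x\<bar> / q)" using exp_ge_add_one_self[of "\<bar>x\<bar> / q"] by linarith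
  then have "\<bar>x\<bar> \<le> q * exp (\<bar>x\<bar> / q)" using assms by (simp add: field_simps)
  then have "\<bar>x\<bar> powr q \<le> (q * exp (\<bar>x\<bar> / q)) powr q" using assms by (intro powr_mono2) auto
  also have "\<dots> = q powr q * exp \<bar>x\<bar>" using assms by (simp add: powr_mult exp_powr_real)
  also have "exp \<bar>x\<bar> \<le> exp x + exp (- x)" by (simp add: abs_if)
  finally show ?thesis using assms by simp
qed

lemma cmod_powr_le_exp:
  assumes q: "0 < q"
  shows "norm (z::complex) powr q \<le> 2 powr q * q powr q * (exp (Re z) + exp (Re (- z)) + exp (Re (\<i> * z)) + exp (Re (- (\<i> * z))))"
proof -
  have "norm z powr q = norm (of_real (Re z) + \<i> * of_real (Im z)) powr q"
    by (subst complex_eq[symmetric]) simp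
  also have "\<dots> \<le> 2 powr q * (norm (complex_of_real (Re z)) powr q + norm (\<i> * complex_of_real (Im z)) powr q)"
    by (rule powr_norm_add_le[OF q])
  also have "\<dots> = 2 powr q * (\<bar>Re z\<bar> powr q + \<bar>Im z\<bar> powr q)" by (simp add: norm_mult)
  also have "\<dots> \<le> 2 powr q * (q powr q * (exp (Re z) + exp (- Re z)) + q powr q * (exp (Im z) + exp (- Im z)))"
    using q by (intro mult_left_mono add_mono abs_powr_le_exp) auto
  finally show ?thesis by (simp add: algebra_simps)
qed

text \<open>What the three types share: exponential moments in all complex directions give upper
  bounds for every moment of a sum, and mean 0 with variance 1 gives its exact second
  moment.\<close>

locale subgaussian_sequence = prob_space M for M :: "'w measure" +
  fixes X :: "nat \<Rightarrow> 'w \<Rightarrow> complex"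
  assumes indep: "indep_vars (\<lambda>_. borel) X {1..}"
    and exp_moment: "\<And>n c. n \<ge> 1 \<Longrightarrow> (\<integral>\<^sup>+\<omega>. ennreal (exp (Re (c * X n \<omega>))) \<partial>M) \<le> ennreal (exp ((norm c)\<^sup>2 / 2))"
    and integrable_X: "\<And>n. n \<ge> 1 \<Longrightarrow> integrable M (X n)"
    and mean: "\<And>n. n \<ge> 1 \<Longrightarrow> expectation (X n) = 0"
    and integrable_square: "\<And>n. n \<ge> 1 \<Longrightarrow> integrable M (\<lambda>\<omega>. (norm (X n \<omega>))\<^sup>2)"
    and variance: "\<And>n. n \<ge> 1 \<Longrightarrow> expectation (\<lambda>\<omega>. (norm (X n \<omega>))\<^sup>2) = 1"

text \<open>Hoeffding's lemma on the interval from \<open>- norm c\<close> to \<open>norm c\<close>: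
  a squared length of \<open>4 * (norm c)^2\<close>, divided by 8, is the exponent.\<close>

lemma (in prob_space) exp_moment_of_unimodular:
  assumes [measurable]: "Y \<in> borel_measurable M" and Y: "AE \<omega> in M. norm (Y \<omega>) = 1" and mean: "expectation Y = (0::complex)"
  shows "(\<integral>\<^sup>+\<omega>. ennreal (exp (Re (c * Y \<omega>))) \<partial>M) \<le> ennreal (exp ((norm c)\<^sup>2 / 2))"
proof -
  have int: "integrable M Y" using Y by (intro integrable_const_bound[of _ 1]) auto
  interpret interval_bounded_random_variable M "\<lambda>\<omega>. Re (c * Y \<omega>)" "- norm c" "norm c"
  proof
    show "AE \<omega> in M. Re (c * Y \<omega>) \<in> {- norm c..norm c}"
      using Y
    proof eventually_elim
      case (elim \<omega>)
      then show ?case using abs_Re_le_cmod[of "c * Y \<omega>"] by (auto simp: norm_mult)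
    qed
  qed measurable
  have "expectation (\<lambda>\<omega>. Re (c * Y \<omega>)) = Re (expectation (\<lambda>\<omega>. c * Y \<omega>))"
    using int by (intro integral_Re) auto
  also have "\<dots> = 0" using mean by simp
  finally have "(\<integral>\<^sup>+\<omega>. ennreal (exp (1 * Re (c * Y \<omega>))) \<partial>M) \<le> ennreal (exp (1\<^sup>2 * (norm c - - norm c)\<^sup>2 / 8))"
    by (intro Hoeffdings_lemma_nn_integral_0) auto
  then show ?thesis by (simp add: power2_eq_square)
qed

lemma (in prob_space) subgaussian_sequenceI_unimodular:
  assumes "indep_vars (\<lambda>_. borel) X {1..}" "\<And>n. n \<ge> 1 \<Longrightarrow> AE \<omega> in M. norm (X n \<omega>) = 1"
    "\<And>n. n \<ge> 1 \<Longrightarrow> expectation (X n) = 0"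
  shows "subgaussian_sequence M X"
proof -
  have m[measurable]: "X n \<in> borel_measurable M" if "n \<ge> 1" for n
    using assms(1) that by (auto simp: indep_vars_def)
  have AE2: "AE \<omega> in M. (norm (X n \<omega>))\<^sup>2 = 1" if "n \<ge> 1" for n using assms(2)[OF that] by auto
  show ?thesis
  proof (unfold_locales, goal_cases)
    case (2 n c)
    then show ?case using assms m by (intro exp_moment_of_unimodular) auto
  next
    case (3 n)
    then show ?case using assms(2)[of n] m by (intro integrable_const_bound[of _ 1]) auto
  next
    case (5 n)
    then show ?case using AE2[of n] m by (intro integrable_const_bound[of _ 1]) auto
  next
    case (6 n)
    have "expectation (\<lambda>\<omega>. (norm (X n \<omega>))\<^sup>2) = expectation (\<lambda>\<omega>. 1)"
      using AE2[of n] m[of n] 6 by (intro integral_cong_AE) auto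
    then show ?case using prob_space by simp
  qed (use assms in auto)
qed

lemma (in prob_space) bernoulli_variable_props:
  assumes "bernoulli_variable M Y"
  shows "AE \<omega> in M. norm (Y \<omega>) = 1" "expectation Y = 0"
proof -
  have [measurable]: "Y \<in> borel_measurable M" and p: "prob {\<omega> \<in> space M. Y \<omega> = 1} = 1/2" "prob {\<omega> \<in> space M. Y \<omega> = -1} = 1/2"
    using assms by (auto simp: bernoulli_variable_def)
  have "prob ({\<omega> \<in> space M. Y \<omega> = 1} \<union> {\<omega> \<in> space M. Y \<omega> = -1}) = 1"
    by (subst finite_measure_Union) (auto simp: p)
  then have "AE \<omega> in M. \<omega> \<in> {\<omega> \<in> space M. Y \<omega> = 1} \<union> {\<omega> \<in> space M. Y \<omega> = -1}"
    by (subst (asm) prob_eq_1) auto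
  then have AE: "AE \<omega> in M. Y \<omega> = 1 \<or> Y \<omega> = -1" by auto
  then show "AE \<omega> in M. norm (Y \<omega>) = 1" by auto
  have int: "integrable M (indicat_real {\<omega> \<in> space M. Y \<omega> = y})" for y
    by (intro integrable_const_bound[of _ 1]) (auto simp: indicator_def)
  have "expectation Y = expectation (\<lambda>\<omega>. complex_of_real (indicator {\<omega> \<in> space M. Y \<omega> = 1} \<omega> - indicator {\<omega> \<in> space M. Y \<omega> = -1} \<omega>))"
    using AE AE_space by (intro integral_cong_AE) (auto simp: indicator_def)
  also have "\<dots> = complex_of_real (expectation (\<lambda>\<omega>. indicator {\<omega> \<in> space M. Y \<omega> = 1} \<omega> - indicator {\<omega> \<in> space M. Y \<omega> = -1} \<omega>))"
    by (intro integral_of_real Bochner_Integration.integrable_diff int)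
  also have "\<dots> = 0" by (subst Bochner_Integration.integral_diff) (auto simp: p int)
  finally show "expectation Y = 0" .
qed

lemma (in prob_space) steinhaus_variable_props:
  assumes "steinhaus_variable M Y"
  shows "AE \<omega> in M. norm (Y \<omega>) = 1" "expectation Y = 0"
proof -
  have [measurable]: "Y \<in> borel_measurable M" and d: "distr M borel Y = circle_measure"
    using assms by (auto simp: steinhaus_variable_def)
  have "AE z in distr M borel Y. norm z = 1" unfolding d by (rule AE_circle_norm)
  then show "AE \<omega> in M. norm (Y \<omega>) = 1" by (subst (asm) AE_distr_iff) auto
  have "expectation Y = (\<integral>z. z \<partial>distr M borel Y)" by (rule integral_distr[symmetric]) auto
  also have "\<dots> = 0" unfolding d using circle_orthonormal[of 1 0] by simp
  finally show "expectation Y = 0" .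
qed

lemma (in prob_space) gaussian_variable_props:
  assumes "gaussian_variable M Y"
  shows "integrable M Y" "expectation Y = 0" "integrable M (\<lambda>\<omega>. (norm (Y \<omega>))\<^sup>2)" "expectation (\<lambda>\<omega>. (norm (Y \<omega>))\<^sup>2) = 1"
    "(\<integral>\<^sup>+\<omega>. ennreal (exp (Re (c * Y \<omega>))) \<partial>M) \<le> ennreal (exp ((norm c)\<^sup>2 / 2))"
proof -
  define G where "G = density lborel (\<lambda>x. ennreal (std_normal_density x))"
  have [measurable]: "Y \<in> borel_measurable M" and d: "distr M borel Y = distr G borel complex_of_real"
    using assms by (auto simp: gaussian_variable_def G_def)
  have [measurable_cong]: "sets G = sets borel" by (simp add: G_def)
  have int: "integrable M (\<lambda>\<omega>. f (Y \<omega>)) \<longleftrightarrow> integrable G (\<lambda>x. f (complex_of_real x))"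
    if [measurable]: "f \<in> borel_measurable borel" for f :: "complex \<Rightarrow> 'b::{banach, second_countable_topology}"
    by (subst (1 2) integrable_distr_eq[symmetric, where N=borel]) (auto simp: d)
  have ex: "expectation (\<lambda>\<omega>. f (Y \<omega>)) = (\<integral>x. f (complex_of_real x) \<partial>G)"
    if [measurable]: "f \<in> borel_measurable borel" for f :: "complex \<Rightarrow> 'b::{banach, second_countable_topology}"
    by (subst (1 2) integral_distr[symmetric, where N=borel]) (auto simp: d)
  have ig: "integrable G (\<lambda>x. x ^ k)" for k
    unfolding G_def using integrable_std_normal_moment[of k] by (subst integrable_density) auto
  have eg: "(\<integral>x. x ^ k \<partial>G) = (\<integral>x. std_normal_density x * x ^ k \<partial>lborel)" for k
    unfolding G_def by (subst integral_density) auto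
  show "integrable M Y" using int[of "\<lambda>z. z"] ig[of 1] by simp
  have "expectation Y = complex_of_real (\<integral>x. x \<partial>G)"
    using ex[of "\<lambda>z. z"] ig[of 1] by simp
  also have "(\<integral>x. x \<partial>G) = 0" using eg[of 1] integral_std_normal_moment_odd[of 0] by simp
  finally show "expectation Y = 0" by simp
  show "integrable M (\<lambda>\<omega>. (norm (Y \<omega>))\<^sup>2)" using int[of "\<lambda>z. (norm z)\<^sup>2"] ig[of 2] by simp
  show "expectation (\<lambda>\<omega>. (norm (Y \<omega>))\<^sup>2) = 1"
    using ex[of "\<lambda>z. (norm z)\<^sup>2"] eg[of 2] integral_std_normal_moment_even[of 1] by simp
  have "(\<integral>\<^sup>+\<omega>. ennreal (exp (Re (c * Y \<omega>))) \<partial>M) = (\<integral>\<^sup>+z. ennreal (exp (Re (c * z))) \<partial>distr M borel Y)"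
    by (rule nn_integral_distr[symmetric]) auto
  also have "\<dots> = (\<integral>\<^sup>+x. ennreal (exp (Re c * x)) \<partial>G)"
    unfolding d by (subst nn_integral_distr) auto
  also have "\<dots> = ennreal (exp ((Re c)\<^sup>2 / 2))" unfolding G_def by (rule std_normal_exp_moment)
  \<comment> \<open>The Gaussian variable has a real law, so only \<open>Re c\<close> entered so
    far; it is at most \<open>norm c\<close> in modulus.\<close>
  also have "\<dots> \<le> ennreal (exp ((norm c)\<^sup>2 / 2))"
    by (intro ennreal_leI) (simp add: cmod_power2)
  finally show "(\<integral>\<^sup>+\<omega>. ennreal (exp (Re (c * Y \<omega>))) \<partial>M) \<le> ennreal (exp ((norm c)\<^sup>2 / 2))" .
qed

lemma subgaussian_sequence_if_standard:
  assumes "standard_random_sequence M X"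
  shows "subgaussian_sequence M X"
proof -
  interpret prob_space M using assms by (simp add: standard_random_sequence_def)
  have ind: "indep_vars (\<lambda>_. borel) X {1..}" using assms by (simp add: standard_random_sequence_def)
  consider "\<forall>n\<ge>1. bernoulli_variable M (X n)" | "\<forall>n\<ge>1. steinhaus_variable M (X n)" | "\<forall>n\<ge>1. gaussian_variable M (X n)"
    using assms by (auto simp: standard_random_sequence_def)
  then show ?thesis
  proof cases
    case 1
    then show ?thesis using bernoulli_variable_props by (intro subgaussian_sequenceI_unimodular ind) auto
  next
    case 2
    then show ?thesis using steinhaus_variable_props by (intro subgaussian_sequenceI_unimodular ind) auto
  next
    case 3
    then show ?thesis using gaussian_variable_props by unfold_locales (use ind in auto)
  qed
qed

section \<open>Upper moment bounds and second moments of random sums\<close>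

context subgaussian_sequence
begin

lemma X_measurable [measurable]: "n \<ge> 1 \<Longrightarrow> X n \<in> borel_measurable M"
  using integrable_X by auto

lemma exp_moment_sum:
  assumes A: "finite A" "0 \<notin> A"
  shows "(\<integral>\<^sup>+\<omega>. ennreal (exp (Re (\<Sum>n\<in>A. c n * X n \<omega>))) \<partial>M) \<le> ennreal (exp ((\<Sum>n\<in>A. (norm (c n))\<^sup>2) / 2))"
proof -
  have A1: "\<And>n. n \<in> A \<Longrightarrow> n \<ge> 1" using A(2) by (metis less_one not_le)
  have "(\<integral>\<^sup>+\<omega>. ennreal (exp (Re (\<Sum>n\<in>A. c n * X n \<omega>))) \<partial>M) = (\<integral>\<^sup>+\<omega>. (\<Prod>n\<in>A. ennreal (exp (Re (c n * X n \<omega>)))) \<partial>M)"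
    using A by (simp add: prod_ennreal exp_sum)
  also have "\<dots> = (\<Prod>n\<in>A. (\<integral>\<^sup>+\<omega>. ennreal (exp (Re (c n * X n \<omega>))) \<partial>M))"
  proof (rule indep_vars_nn_integral[OF A(1)])
    have "indep_vars (\<lambda>_. borel) (\<lambda>n \<omega>. (\<lambda>x. ennreal (exp (Re (c n * x)))) (X n \<omega>)) {1..}"
      by (rule indep_vars_compose2[OF indep]) auto
    then show "indep_vars (\<lambda>_. borel) (\<lambda>n \<omega>. ennreal (exp (Re (c n * X n \<omega>)))) A"
      by (rule indep_vars_subset) (use A1 in auto)
  qed auto
  also have "\<dots> \<le> (\<Prod>n\<in>A. ennreal (exp ((norm (c n))\<^sup>2 / 2)))"
    by (intro prod_mono_ennreal exp_moment A1)
  also have "\<dots> = ennreal (exp ((\<Sum>n\<in>A. (norm (c n))\<^sup>2) / 2))"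
    using A by (simp add: prod_ennreal exp_sum sum_divide_distrib)
  finally show ?thesis .
qed

lemma moment_bound_normalized:
  assumes q: "0 < q" and A: "finite A" "0 \<notin> A" and c: "(\<Sum>n\<in>A. (norm (c n))\<^sup>2) \<le> 1"
  shows "(\<integral>\<^sup>+\<omega>. ennreal (norm (\<Sum>n\<in>A. c n * X n \<omega>) powr q) \<partial>M) \<le> ennreal (moment_const q)"
proof -
  define S where "S \<omega> = (\<Sum>n\<in>A. c n * X n \<omega>)" for \<omega>
  have A1: "\<And>n. n \<in> A \<Longrightarrow> n \<ge> 1" using A(2) by (metis less_one not_le)
  have [measurable]: "S \<in> borel_measurable M"
    unfolding S_def[abs_def] using A1 by (intro borel_measurable_sum borel_measurable_times X_measurable) auto
  \<comment> \<open>A unimodular factor leaves the sum of squares unchanged, so the same bound holds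
    in each of the four directions.\<close>
  have E: "(\<integral>\<^sup>+\<omega>. ennreal (exp (Re (d * S \<omega>))) \<partial>M) \<le> ennreal (exp (1/2))" if "norm d = 1" for d
  proof -
    have "(\<integral>\<^sup>+\<omega>. ennreal (exp (Re (d * S \<omega>))) \<partial>M) = (\<integral>\<^sup>+\<omega>. ennreal (exp (Re (\<Sum>n\<in>A. (d * c n) * X n \<omega>))) \<partial>M)"
      by (simp add: S_def sum_distrib_left mult.assoc)
    also have "\<dots> \<le> ennreal (exp ((\<Sum>n\<in>A. (norm (d * c n))\<^sup>2) / 2))" by (rule exp_moment_sum[OF A])
    also have "\<dots> \<le> ennreal (exp (1/2))" using c that by (simp add: norm_mult)
    finally show ?thesis .
  qed
  define K where "K = 2 powr q * q powr q"
  have sum4: "ennreal (K * (a + b + c + d)) = ennreal K * (ennreal a + ennreal b + ennreal c + ennreal d)"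
    if "0 \<le> a" "0 \<le> b" "0 \<le> c" "0 \<le> d" for a b c d
    using that by (simp add: K_def ennreal_mult ennreal_plus)
  have "(\<integral>\<^sup>+\<omega>. ennreal (norm (S \<omega>) powr q) \<partial>M) \<le>
    (\<integral>\<^sup>+\<omega>. ennreal K * (ennreal (exp (Re (1 * S \<omega>))) + ennreal (exp (Re ((-1) * S \<omega>))) + ennreal (exp (Re (\<i> * S \<omega>))) + ennreal (exp (Re ((-\<i>) * S \<omega>)))) \<partial>M)"
  proof (rule nn_integral_mono)
    fix \<omega>
    have "ennreal (norm (S \<omega>) powr q) \<le> ennreal (K * (exp (Re (S \<omega>)) + exp (Re (- S \<omega>)) + exp (Re (\<i> * S \<omega>)) + exp (Re (- (\<i> * S \<omega>)))))"
      unfolding K_def by (intro ennreal_leI cmod_powr_le_exp q)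
    then show "ennreal (norm (S \<omega>) powr q) \<le> ennreal K * (ennreal (exp (Re (1 * S \<omega>))) + ennreal (exp (Re ((-1) * S \<omega>))) + ennreal (exp (Re (\<i> * S \<omega>))) + ennreal (exp (Re ((-\<i>) * S \<omega>))))"
      using sum4[of "exp (Re (S \<omega>))" "exp (Re (- S \<omega>))" "exp (Re (\<i> * S \<omega>))" "exp (Re (- (\<i> * S \<omega>)))"]
      by (simp only: exp_ge_zero mult_1_left mult_minus_left)
  qed
  also have "\<dots> = ennreal K * ((\<integral>\<^sup>+\<omega>. ennreal (exp (Re (1 * S \<omega>))) \<partial>M) + (\<integral>\<^sup>+\<omega>. ennreal (exp (Re ((-1) * S \<omega>))) \<partial>M)
      + (\<integral>\<^sup>+\<omega>. ennreal (exp (Re (\<i> * S \<omega>))) \<partial>M) + (\<integral>\<^sup>+\<omega>. ennreal (exp (Re ((-\<i>) * S \<omega>))) \<partial>M))"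
    by (subst nn_integral_cmult, measurable, subst nn_integral_add, measurable, subst nn_integral_add, measurable, subst nn_integral_add, measurable) 
  also have "\<dots> \<le> ennreal K * (ennreal (exp (1/2)) + ennreal (exp (1/2)) + ennreal (exp (1/2)) + ennreal (exp (1/2)))"
    by (intro mult_left_mono add_mono E) auto
  also have "\<dots> = ennreal (moment_const q)"
    by (simp add: moment_const_def K_def ennreal_mult[symmetric] flip: ennreal_plus)
  finally show ?thesis by (simp add: S_def)
qed

text \<open>Homogeneity: dividing by the standard deviation \<open>s\<close> reduces to the
  normalized case, and \<open>s powr q\<close> is the variance to the power
  \<open>q / 2\<close>.\<close>

lemma moment_bound:
  assumes q: "0 < q" and A: "finite A" "0 \<notin> A"
  shows "(\<integral>\<^sup>+\<omega>. ennreal (norm (\<Sum>n\<in>A. c n * X n \<omega>) powr q) \<partial>M)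
    \<le> ennreal (moment_const q * (\<Sum>n\<in>A. (norm (c n))\<^sup>2) powr (q / 2))"
proof (cases "(\<Sum>n\<in>A. (norm (c n))\<^sup>2) = 0")
  case True
  then have "\<And>n. n \<in> A \<Longrightarrow> c n = 0" using A by (simp add: sum_nonneg_eq_0_iff)
  then have "(\<Sum>n\<in>A. c n * X n \<omega>) = 0" for \<omega> by simp
  then show ?thesis by simp
next
  case False
  define v where "v = (\<Sum>n\<in>A. (norm (c n))\<^sup>2)"
  define s where "s = sqrt v"
  have v: "v > 0" using False by (simp add: v_def sum_nonneg less_le)
  then have s: "s > 0" "s\<^sup>2 = v" by (auto simp: s_def)
  have A1: "\<And>n. n \<in> A \<Longrightarrow> n \<ge> 1" using A(2) by (metis less_one not_le)
  have "(\<integral>\<^sup>+\<omega>. ennreal (norm (\<Sum>n\<in>A. c n * X n \<omega>) powr q) \<partial>M)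
     = (\<integral>\<^sup>+\<omega>. ennreal (s powr q) * ennreal (norm (\<Sum>n\<in>A. (c n / of_real s) * X n \<omega>) powr q) \<partial>M)"
  proof (rule nn_integral_cong)
    fix \<omega>
    have "(\<Sum>n\<in>A. c n * X n \<omega>) = of_real s * (\<Sum>n\<in>A. (c n / of_real s) * X n \<omega>)"
      using s by (simp add: sum_distrib_left)
    then have "norm (\<Sum>n\<in>A. c n * X n \<omega>) = s * norm (\<Sum>n\<in>A. (c n / of_real s) * X n \<omega>)"
      using s(1) by (simp only: norm_mult norm_of_real abs_of_pos)
    then show "ennreal (norm (\<Sum>n\<in>A. c n * X n \<omega>) powr q) = ennreal (s powr q) * ennreal (norm (\<Sum>n\<in>A. (c n / of_real s) * X n \<omega>) powr q)"
      by (simp only: powr_mult ennreal_mult[symmetric] powr_ge_zero)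
  qed
  also have "\<dots> = ennreal (s powr q) * (\<integral>\<^sup>+\<omega>. ennreal (norm (\<Sum>n\<in>A. (c n / of_real s) * X n \<omega>) powr q) \<partial>M)"
  proof (rule nn_integral_cmult)
    have "(\<lambda>\<omega>. \<Sum>n\<in>A. (c n / of_real s) * X n \<omega>) \<in> borel_measurable M"
      using A1 by (intro borel_measurable_sum borel_measurable_times X_measurable) auto
    then show "(\<lambda>\<omega>. ennreal (norm (\<Sum>n\<in>A. (c n / of_real s) * X n \<omega>) powr q)) \<in> borel_measurable M" by simp
  qed
  also have "\<dots> \<le> ennreal (s powr q) * ennreal (moment_const q)"
  proof (intro mult_left_mono moment_bound_normalized q A)
    have "(\<Sum>n\<in>A. (norm (c n / of_real s))\<^sup>2) = v / s\<^sup>2"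
      by (simp add: norm_divide power_divide v_def sum_divide_distrib)
    then show "(\<Sum>n\<in>A. (norm (c n / of_real s))\<^sup>2) \<le> 1" using s v by simp
  qed simp
  also have "\<dots> = ennreal (moment_const q * v powr (q / 2))"
  proof -
    have "s powr q = v powr (q / 2)" using v by (simp add: s_def powr_half_sqrt[symmetric] powr_powr)
    then show ?thesis by (simp add: ennreal_mult[symmetric] moment_const_def mult.commute)
  qed
  finally show ?thesis by (simp add: v_def)
qed

lemma expectation_mult_cnj:
  assumes n: "n \<ge> 1" and m: "m \<ge> 1"
  shows "integrable M (\<lambda>\<omega>. X n \<omega> * cnj (X m \<omega>))"
    "expectation (\<lambda>\<omega>. X n \<omega> * cnj (X m \<omega>)) = (if n = m then 1 else 0)"
proof -
  have "integrable M (\<lambda>\<omega>. X n \<omega> * cnj (X m \<omega>)) \<and> expectation (\<lambda>\<omega>. X n \<omega> * cnj (X m \<omega>)) = (if n = m then 1 else 0)"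
  proof (cases "n = m")
    case True
    then have "(\<lambda>\<omega>. X n \<omega> * cnj (X m \<omega>)) = (\<lambda>\<omega>. complex_of_real ((norm (X n \<omega>))\<^sup>2))"
      by (simp add: complex_norm_square del: of_real_power)
    then show ?thesis using integrable_square[OF n] variance[OF n] True
      by (simp only: integral_of_real) (simp del: of_real_power)
  next
    case False
    define Y where "Y i \<omega> = (if i = n then X n \<omega> else cnj (X m \<omega>))" for i \<omega>
    have "indep_vars (\<lambda>_. borel) (\<lambda>i \<omega>. (if i = n then (\<lambda>x. x) else cnj) (X i \<omega>)) {1..}"
      by (rule indep_vars_compose2[OF indep]) auto
    then have "indep_vars (\<lambda>_. borel) (\<lambda>i \<omega>. (if i = n then (\<lambda>x. x) else cnj) (X i \<omega>)) {n, m}"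
      by (rule indep_vars_subset) (use n m in auto)
    then have ind: "indep_vars (\<lambda>_. borel) Y {n, m}"
      by (subst (asm) indep_vars_cong[of _ "{n, m}" _ Y]) (auto simp: Y_def fun_eq_iff)
    have int: "integrable M (Y i)" if "i \<in> {n, m}" for i
      using that integrable_X[OF n] integrable_X[OF m] False by (auto simp: Y_def[abs_def])
    have "integrable M (\<lambda>\<omega>. \<Prod>i\<in>{n, m}. Y i \<omega>)" "expectation (\<lambda>\<omega>. \<Prod>i\<in>{n, m}. Y i \<omega>) = (\<Prod>i\<in>{n, m}. expectation (Y i))"
      using indep_vars_integrable[OF _ ind int] indep_vars_lebesgue_integral[OF _ ind int] by auto
    then show ?thesis using False mean[OF n] by (simp add: Y_def[abs_def])
  qed
  then show "integrable M (\<lambda>\<omega>. X n \<omega> * cnj (X m \<omega>))"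
    "expectation (\<lambda>\<omega>. X n \<omega> * cnj (X m \<omega>)) = (if n = m then 1 else 0)" by auto
qed

lemma second_moment:
  assumes A: "finite A" "0 \<notin> A"
  shows "integrable M (\<lambda>\<omega>. (norm (\<Sum>n\<in>A. c n * X n \<omega>))\<^sup>2)"
    "expectation (\<lambda>\<omega>. (norm (\<Sum>n\<in>A. c n * X n \<omega>))\<^sup>2) = (\<Sum>n\<in>A. (norm (c n))\<^sup>2)"
proof -
  have A1: "\<And>n. n \<in> A \<Longrightarrow> n \<ge> 1" using A(2) by (metis less_one not_le)
  have eq: "complex_of_real ((norm (\<Sum>n\<in>A. c n * X n \<omega>))\<^sup>2) = (\<Sum>j\<in>A. \<Sum>k\<in>A. (c j * cnj (c k)) * (X j \<omega> * cnj (X k \<omega>)))" for \<omega>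
    by (simp add: complex_norm_square sum_product mult_ac del: of_real_power)
  have "integrable M (\<lambda>\<omega>. complex_of_real ((norm (\<Sum>n\<in>A. c n * X n \<omega>))\<^sup>2))"
    unfolding eq by (intro Bochner_Integration.integrable_sum integrable_mult_right expectation_mult_cnj A1)
  then show int: "integrable M (\<lambda>\<omega>. (norm (\<Sum>n\<in>A. c n * X n \<omega>))\<^sup>2)"
    by (simp only: integrable_of_real complex_of_real_integrable_eq)
  have "complex_of_real (expectation (\<lambda>\<omega>. (norm (\<Sum>n\<in>A. c n * X n \<omega>))\<^sup>2)) = expectation (\<lambda>\<omega>. complex_of_real ((norm (\<Sum>n\<in>A. c n * X n \<omega>))\<^sup>2))"
    by (rule integral_of_real[OF int, symmetric])
  also have "\<dots> = (\<Sum>j\<in>A. \<Sum>k\<in>A. (c j * cnj (c k)) * expectation (\<lambda>\<omega>. X j \<omega> * cnj (X k \<omega>)))"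
    unfolding eq using A1 by (simp add: Bochner_Integration.integral_sum expectation_mult_cnj(1))
  also have "\<dots> = (\<Sum>j\<in>A. \<Sum>k\<in>A. (c j * cnj (c k)) * (if j = k then 1 else 0))"
    using A1 by (intro sum.cong refl arg_cong2[where f="(*)"] expectation_mult_cnj(2)) auto
  also have "\<dots> = (\<Sum>j\<in>A. c j * cnj (c j))"
    using A by (simp add: if_distrib cong: if_cong)
  also have "\<dots> = complex_of_real (\<Sum>n\<in>A. (norm (c n))\<^sup>2)"
    by (simp add: complex_norm_square del: of_real_power)
  finally show "expectation (\<lambda>\<omega>. (norm (\<Sum>n\<in>A. c n * X n \<omega>))\<^sup>2) = (\<Sum>n\<in>A. (norm (c n))\<^sup>2)"
    by (simp only: of_real_eq_iff)
qed

end

section \<open>Square summable coefficients: membership of the randomization\<close>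

lemma ex_block_sequence:
  fixes f :: "nat \<Rightarrow> real"
  assumes f: "summable f" and e: "\<And>k. e k > 0"
  obtains N :: "nat \<Rightarrow> nat" where "strict_mono N" "N 0 \<ge> 1" "\<And>k. sum f {N k..<N (Suc k)} \<le> e k"
proof -
  have "\<exists>M. \<forall>m\<ge>M. \<forall>n. norm (sum f {m..<n}) < e k" for k
    using f e[of k] unfolding summable_Cauchy by blast
  then obtain M where M: "\<And>k m n. m \<ge> M k \<Longrightarrow> norm (sum f {m..<n}) < e k" by metis
  \<comment> \<open>The sum of all thresholds so far is at least \<open>M k\<close>; the summand
    \<open>k\<close> makes \<open>N\<close> strictly increasing and \<open>Suc\<close> makes it
    start at 1 or later.\<close>
  define N where "N k = Suc (k + (\<Sum>i\<le>k. M i))" for k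
  have "strict_mono N" by (rule strict_monoI_Suc) (simp add: N_def)
  moreover have "N k \<ge> M k" for k
    using member_le_sum[of k "{..k}" M] by (simp add: N_def)
  then have "sum f {N k..<N (Suc k)} \<le> e k" for k using M[of k "N k" "N (Suc k)"] by (simp add: abs_less_iff)
  ultimately show ?thesis using that[of N] by (simp add: N_def)
qed

lemma AE_summable_if_summable_expectation:
  fixes f :: "nat \<Rightarrow> 'a \<Rightarrow> real"
  assumes nonneg: "\<And>k x. 0 \<le> f k x" and [measurable]: "\<And>k. (\<lambda>x. ennreal (f k x)) \<in> borel_measurable M"
    and bound: "\<And>k. (\<integral>\<^sup>+x. ennreal (f k x) \<partial>M) \<le> ennreal (b k)" and b: "summable b" "\<And>k. 0 \<le> b k"
  shows "AE x in M. summable (\<lambda>k. f k x)"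
proof -
  have "(\<integral>\<^sup>+x. (\<Sum>k. ennreal (f k x)) \<partial>M) = (\<Sum>k. \<integral>\<^sup>+x. ennreal (f k x) \<partial>M)"
    by (rule nn_integral_suminf) measurable
  also have "\<dots> \<le> (\<Sum>k. ennreal (b k))"
    by (intro suminf_le bound) auto
  also have "\<dots> = ennreal (\<Sum>k. b k)" using b by (intro suminf_ennreal2) auto
  also have "\<dots> < \<infinity>" by simp
  finally have "AE x in M. (\<Sum>k. ennreal (f k x)) \<noteq> \<infinity>"
    by (intro nn_integral_PInf_AE) auto
  then show ?thesis
    by eventually_elim (auto intro!: summable_suminf_not_top nonneg)
qed

context subgaussian_sequence
begin

lemma first_moment_le_1:
  assumes "n \<ge> 1"
  shows "(\<integral>\<^sup>+\<omega>. ennreal (norm (X n \<omega>)) \<partial>M) \<le> 1"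
proof -
  have "(\<integral>\<^sup>+\<omega>. ennreal (norm (X n \<omega>)) \<partial>M) = ennreal (expectation (\<lambda>\<omega>. norm (X n \<omega>)))"
    using integrable_X[OF assms] by (intro nn_integral_eq_integral) auto
  also have "expectation (\<lambda>\<omega>. norm (X n \<omega>)) \<le> expectation (\<lambda>\<omega>. (1 + (norm (X n \<omega>))\<^sup>2) / 2)"
  proof (rule integral_mono)
    fix \<omega>
    have "0 \<le> (norm (X n \<omega>) - 1)\<^sup>2" by simp
    then show "norm (X n \<omega>) \<le> (1 + (norm (X n \<omega>))\<^sup>2) / 2" by (simp add: power2_diff)
  qed (use integrable_X[OF assms] integrable_square[OF assms] in auto)
  also have "\<dots> = 1" using integrable_square[OF assms] variance[OF assms] prob_space by simp
  finally show ?thesis by (simp add: ennreal_leI)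
qed

lemma AE_randomization_abs_summable:
  assumes a: "summable (\<lambda>n. (norm (a n))\<^sup>2)"
  shows "AE \<omega> in M. \<forall>\<sigma>>1/2. summable (\<lambda>n. norm (randomization X a \<omega> n) * real n powr (- \<sigma>))"
proof -
  \<comment> \<open>Countably many exponents decreasing to \<open>1/2\<close> suffice, since
    summability at \<open>s i\<close> implies it at every larger \<sigma>; this keeps the
    exceptional set null.\<close>
  define s where "s i = 1/2 + 1 / real (Suc i)" for i
  have s: "s i > 1/2" for i by (simp add: s_def)
  have "AE \<omega> in M. summable (\<lambda>n. norm (randomization X a \<omega> n) * real n powr (- s i))" for i
  proof (rule AE_summable_if_summable_expectation[where b = "\<lambda>n. norm (a n) * real n powr (- s i)"])
    show "(\<lambda>\<omega>. ennreal (norm (randomization X a \<omega> n) * real n powr (- s i))) \<in> borel_measurable M" for n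
      by (cases "n = 0") (auto simp: randomization_def)
    show "(\<integral>\<^sup>+\<omega>. ennreal (norm (randomization X a \<omega> n) * real n powr (- s i)) \<partial>M) \<le> ennreal (norm (a n) * real n powr (- s i))" for n
    proof (cases "n = 0")
      case False
      then have n: "n \<ge> 1" by simp
      have "(\<integral>\<^sup>+\<omega>. ennreal (norm (randomization X a \<omega> n) * real n powr (- s i)) \<partial>M) = (\<integral>\<^sup>+\<omega>. ennreal (norm (a n) * real n powr (- s i)) * ennreal (norm (X n \<omega>)) \<partial>M)"
        by (intro nn_integral_cong) (simp add: randomization_def norm_mult ennreal_mult[symmetric] mult_ac)
      also have "\<dots> = ennreal (norm (a n) * real n powr (- s i)) * (\<integral>\<^sup>+\<omega>. ennreal (norm (X n \<omega>)) \<partial>M)"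
        using n by (intro nn_integral_cmult) auto
      also have "\<dots> \<le> ennreal (norm (a n) * real n powr (- s i)) * 1"
        by (intro mult_left_mono first_moment_le_1 n) auto
      finally show ?thesis by simp
    qed (simp add: randomization_def)
    show "summable (\<lambda>n. norm (a n) * real n powr (- s i))"
    \<comment> \<open>A product is at most the sum of the squares; \<open>n powr (- 2 * s i)\<close>
      is summable exactly because \<open>s i > 1/2\<close>.\<close>
    proof (rule summable_comparison_test'[where g = "\<lambda>n. (norm (a n))\<^sup>2 + real n powr (- 2 * s i)" and N = 0])
      show "summable (\<lambda>n. (norm (a n))\<^sup>2 + real n powr (- 2 * s i))"
        using a s[of i] by (intro summable_add) (auto simp: summable_real_powr_iff)
      fix n
      define x where "x = norm (a n)"
      define y where "y = real n powr (- s i)"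
      have xy: "0 \<le> x" "0 \<le> y" by (auto simp: x_def y_def)
      have "y\<^sup>2 = real n powr (- 2 * s i)" by (simp add: y_def power2_eq_square flip: powr_add)
      moreover have "x * y \<le> x\<^sup>2 + y\<^sup>2"
        using sum_squares_bound[of x y] xy mult_nonneg_nonneg[OF xy] by linarith
      ultimately show "norm (norm (a n) * real n powr (- s i)) \<le> (norm (a n))\<^sup>2 + real n powr (- 2 * s i)"
        by (simp add: x_def y_def)
    qed
  qed auto
  then have "AE \<omega> in M. \<forall>i. summable (\<lambda>n. norm (randomization X a \<omega> n) * real n powr (- s i))"
    by (simp add: AE_all_countable)
  then show ?thesis
  proof (eventually_elim, intro allI impI)
    fix \<omega> and \<sigma> :: real
    assume sm: "\<forall>i. summable (\<lambda>n. norm (randomization X a \<omega> n) * real n powr (- s i))" and \<sigma>: "\<sigma> > 1/2"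
    obtain i where "inverse (real (Suc i)) < \<sigma> - 1/2" using reals_Archimedean[of "\<sigma> - 1/2"] \<sigma> by auto
    then have i: "s i \<le> \<sigma>" by (simp add: s_def inverse_eq_divide)
    show "summable (\<lambda>n. norm (randomization X a \<omega> n) * real n powr (- \<sigma>))"
    proof (rule summable_comparison_test'[OF sm[rule_format, of i], where N = 1])
      fix n :: nat assume "1 \<le> n"
      then show "norm (norm (randomization X a \<omega> n) * real n powr (- \<sigma>)) \<le> norm (randomization X a \<omega> n) * real n powr (- s i)"
        using i by (auto intro!: mult_left_mono powr_mono)
    qed
  qed
qed

text \<open>After exchanging the integrals, the torus point is fixed: its unimodular monomials do
  not affect the variance, so the moment bound is the same at almost every point.\<close>

lemma expected_lift_int_block:
  assumes q: "0 < q" and N: "N k \<ge> 1"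
  shows "(\<lambda>\<omega>. ennreal (lift_int q (block N (randomization X a \<omega>) k))) \<in> borel_measurable M"
    and "(\<integral>\<^sup>+\<omega>. ennreal (lift_int q (block N (randomization X a \<omega>) k)) \<partial>M)
      \<le> ennreal (moment_const q * (\<Sum>n\<in>{N k..<N (Suc k)}. (norm (a n))\<^sup>2) powr (q / 2))"
proof -
  interpret T: prob_space torus_measure by (rule prob_space_torus_measure)
  interpret P: pair_sigma_finite M torus_measure ..
  define A where "A = {N k..<N (Suc k)}"
  have A: "finite A" "0 \<notin> A" "\<And>n. n \<in> A \<Longrightarrow> n \<ge> 1" using N by (auto simp: A_def)
  define F where "F \<omega> z = ennreal (norm (\<Sum>n\<in>A. (a n * bohr_monomial n z) * X n \<omega>) powr q)" for \<omega> z
  have [measurable]: "(\<lambda>(\<omega>, z). F \<omega> z) \<in> borel_measurable (M \<Otimes>\<^sub>M torus_measure)"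
  proof -
    have [measurable]: "(\<lambda>x. \<Sum>n\<in>A. (a n * bohr_monomial n (snd x)) * X n (fst x)) \<in> borel_measurable (M \<Otimes>\<^sub>M torus_measure)"
      using A(3) by (intro borel_measurable_sum) auto
    show ?thesis unfolding F_def case_prod_unfold by measurable
  qed
  have lift: "ennreal (lift_int q (block N (randomization X a \<omega>) k)) = (\<integral>\<^sup>+z. F \<omega> z \<partial>torus_measure)" for \<omega>
  proof -
    have eq: "bohr_lift (block N (randomization X a \<omega>) k) z = (\<Sum>n\<in>A. (a n * bohr_monomial n z) * X n \<omega>)" for z
      unfolding block_def[abs_def] A_def[symmetric]
      by (subst bohr_lift_finite[OF A(1,2)]) (simp add: randomization_def mult_ac)
    show ?thesis
      unfolding lift_int_def F_def eq[symmetric]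
      using q by (intro nn_integral_eq_integral[symmetric] integrable_lift_powr) auto
  qed
  show "(\<lambda>\<omega>. ennreal (lift_int q (block N (randomization X a \<omega>) k))) \<in> borel_measurable M"
    unfolding lift by measurable
  have "(\<integral>\<^sup>+\<omega>. ennreal (lift_int q (block N (randomization X a \<omega>) k)) \<partial>M) = (\<integral>\<^sup>+z. \<integral>\<^sup>+\<omega>. F \<omega> z \<partial>M \<partial>torus_measure)"
    unfolding lift by (rule P.Fubini'[symmetric]) measurable
  also have "\<dots> \<le> (\<integral>\<^sup>+z. ennreal (moment_const q * (\<Sum>n\<in>A. (norm (a n))\<^sup>2) powr (q / 2)) \<partial>torus_measure)"
  proof (rule nn_integral_mono_AE)
    show "AE z in torus_measure. (\<integral>\<^sup>+\<omega>. F \<omega> z \<partial>M) \<le> ennreal (moment_const q * (\<Sum>n\<in>A. (norm (a n))\<^sup>2) powr (q / 2))"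
      using AE_torus_norm
    proof eventually_elim
      case (elim z)
      then show ?case
        using moment_bound[OF q A(1,2), of "\<lambda>n. a n * bohr_monomial n z"]
        by (simp add: F_def norm_mult norm_bohr_monomial)
    qed
  qed
  also have "\<dots> = ennreal (moment_const q * (\<Sum>n\<in>A. (norm (a n))\<^sup>2) powr (q / 2))"
    by (simp add: T.emeasure_space_1[simplified])
  finally show "(\<integral>\<^sup>+\<omega>. ennreal (lift_int q (block N (randomization X a \<omega>) k)) \<partial>M)
      \<le> ennreal (moment_const q * (\<Sum>n\<in>{N k..<N (Suc k)}. (norm (a n))\<^sup>2) powr (q / 2))"
    by (simp add: A_def)
qed

lemma AE_randomization_in_Hp_space:
  assumes q: "0 < q" and a: "summable (\<lambda>n. (norm (a n))\<^sup>2)"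
  shows "AE \<omega> in M. randomization X a \<omega> \<in> Hp_space q"
proof -
  \<comment> \<open>Variance \<open>(1/16) ^ k\<close> gives a \<open>q\<close>-th moment of order
    \<open>((1/4) ^ k) powr q\<close>; against the weight \<open>(2 ^ k) powr q\<close> this leaves
    the summable \<open>((1/2) powr q) ^ k\<close>.\<close>
  obtain N :: "nat \<Rightarrow> nat" where N: "strict_mono N" "N 0 \<ge> 1" and sm: "\<And>k. (\<Sum>n\<in>{N k..<N (Suc k)}. (norm (a n))\<^sup>2) \<le> (1/16) ^ k"
    using ex_block_sequence[OF a, of "\<lambda>k. (1/16) ^ k"] by auto
  have N1: "N k \<ge> 1" for k using N strict_mono_less_eq[OF N(1), of 0 k] by linarith
  have K: "moment_const q \<ge> 0" by (simp add: moment_const_def)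
  have "AE \<omega> in M. summable (\<lambda>k. (2 ^ k) powr q * lift_int q (block N (randomization X a \<omega>) k))"
  proof (rule AE_summable_if_summable_expectation[where b = "\<lambda>k. moment_const q * ((1/2) powr q) ^ k"])
    fix k
    note [measurable] = expected_lift_int_block(1)[where N=N and k=k and a=a, OF q N1]
    have mult: "ennreal ((2 ^ k) powr q * lift_int q (block N (randomization X a \<omega>) k)) = ennreal ((2 ^ k) powr q) * ennreal (lift_int q (block N (randomization X a \<omega>) k))" for \<omega>
      by (simp add: ennreal_mult lift_int_nonneg)
    show "(\<lambda>\<omega>. ennreal ((2 ^ k) powr q * lift_int q (block N (randomization X a \<omega>) k))) \<in> borel_measurable M"
      unfolding mult by measurable
    have "(\<integral>\<^sup>+\<omega>. ennreal ((2 ^ k) powr q * lift_int q (block N (randomization X a \<omega>) k)) \<partial>M) =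
        ennreal ((2 ^ k) powr q) * (\<integral>\<^sup>+\<omega>. ennreal (lift_int q (block N (randomization X a \<omega>) k)) \<partial>M)"
      unfolding mult by (rule nn_integral_cmult) measurable
    also have "\<dots> \<le> ennreal ((2 ^ k) powr q) * ennreal (moment_const q * (\<Sum>n\<in>{N k..<N (Suc k)}. (norm (a n))\<^sup>2) powr (q / 2))"
      by (intro mult_left_mono expected_lift_int_block(2) q N1) auto
    also have "\<dots> = ennreal ((2 ^ k) powr q * (moment_const q * (\<Sum>n\<in>{N k..<N (Suc k)}. (norm (a n))\<^sup>2) powr (q / 2)))"
      using K by (simp add: ennreal_mult)
    also have "\<dots> \<le> ennreal (moment_const q * ((1/2) powr q) ^ k)"
    proof (rule ennreal_leI)
      have "(\<Sum>n\<in>{N k..<N (Suc k)}. (norm (a n))\<^sup>2) powr (q / 2) \<le> ((1/16) ^ k) powr (q / 2)"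
        using q sm[of k] by (intro powr_mono2) (auto intro: sum_nonneg)
      also have "(1/16::real) ^ k = ((1/4) ^ k) powr 2"
        by (simp add: power2_eq_square flip: power_mult_distrib)
      also have "\<dots> powr (q / 2) = ((1/4) ^ k) powr q" by (simp only: powr_powr) simp
      finally have "(2 ^ k) powr q * (moment_const q * (\<Sum>n\<in>{N k..<N (Suc k)}. (norm (a n))\<^sup>2) powr (q / 2)) \<le> (2 ^ k) powr q * (moment_const q * ((1/4) ^ k) powr q)"
        using K by (intro mult_left_mono) auto
      also have "\<dots> = moment_const q * (2 ^ k * (1/4) ^ k) powr q" by (simp add: powr_mult)
      also have "(2::real) ^ k * (1/4) ^ k = (1/2) ^ k" by (simp flip: power_mult_distrib)
      also have "((1/2::real) ^ k) powr q = ((1/2) powr q) ^ k"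
        by (simp add: powr_powr mult.commute flip: powr_realpow)
      finally show "(2 ^ k) powr q * (moment_const q * (\<Sum>n\<in>{N k..<N (Suc k)}. (norm (a n))\<^sup>2) powr (q / 2)) \<le> moment_const q * ((1/2) powr q) ^ k" .
    qed
    finally show "(\<integral>\<^sup>+\<omega>. ennreal ((2 ^ k) powr q * lift_int q (block N (randomization X a \<omega>) k)) \<partial>M) \<le> ennreal (moment_const q * ((1/2) powr q) ^ k)" .
  next
    have "(1/2::real) powr q < 1 powr q" using q by (intro powr_less_mono2) auto
    then show "summable (\<lambda>k. moment_const q * ((1/2) powr q) ^ k)"
      by (intro summable_mult summable_geometric) auto
  qed (use K in \<open>auto simp: lift_int_nonneg\<close>)
  with AE_randomization_abs_summable[OF a] show ?thesis
    by eventually_elim (intro Hp_spaceI[OF q N], auto)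
qed

end

section \<open>Lower moment bounds and unboundedness of random polynomials\<close>

text \<open>One term for each range of \<open>u^2\<close>: up to \<open>1/8\<close>, up to
  \<open>L\<close>, and beyond \<open>L\<close>. In the middle range \<open>u powr q\<close> is at
  least \<open>(1/8) powr (q / 2)\<close> while \<open>u^2\<close> is at most
  \<open>L\<close>.\<close>

lemma square_le_truncation:
  fixes u :: real
  assumes u: "0 \<le> u" and L: "L \<ge> 1" and q: "0 < q"
  shows "u\<^sup>2 \<le> 1/8 + L * (1/8) powr (- (q/2)) * u powr q + u ^ 4 / L"
proof -
  consider "u\<^sup>2 \<le> 1/8" | "1/8 < u\<^sup>2" "u\<^sup>2 \<le> L" | "u\<^sup>2 > L" by linarith
  then show ?thesis
  proof cases
    case 1
    have "0 \<le> L * (1/8) powr (- (q/2)) * u powr q + u ^ 4 / L" using L u by simp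
    then show ?thesis using 1 by linarith
  next
    case 2
    then have "u > 0" using u by (cases "u = 0") auto
    then have "u powr q = (u\<^sup>2) powr (q / 2)" by (simp add: powr_powr flip: powr_numeral)
    also have "\<dots> \<ge> (1/8) powr (q / 2)" using 2 q by (intro powr_mono2) auto
    finally have "(1/8) powr (- (q/2)) * u powr q \<ge> (1/8) powr (- (q/2)) * (1/8) powr (q / 2)"
      by (intro mult_left_mono) auto
    also have "(1/8::real) powr (- (q/2)) * (1/8) powr (q / 2) = 1" by (simp flip: powr_add)
    finally have "L * 1 \<le> L * ((1/8) powr (- (q/2)) * u powr q)" using L by (intro mult_left_mono) auto
    then have "u\<^sup>2 \<le> L * (1/8) powr (- (q/2)) * u powr q" using 2 by (simp only: mult.assoc mult_1_right)
    moreover have "0 \<le> u ^ 4 / L" using L by simp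
    ultimately show ?thesis by linarith
  next
    case 3
    have "u\<^sup>2 * L \<le> u\<^sup>2 * u\<^sup>2" using 3 by (intro mult_left_mono) auto
    then have "u\<^sup>2 \<le> u ^ 4 / L" using L by (simp add: field_simps power4_eq_xxxx power2_eq_square)
    moreover have "0 \<le> L * (1/8) powr (- (q/2)) * u powr q" using L u by simp
    ultimately show ?thesis by linarith
  qed
qed

text \<open>For outcomes outside the chosen event: their contribution to the second moment is
  controlled by \<open>L\<close> times their probability and by the fourth moment.\<close>

lemma square_le_large:
  fixes u :: real
  assumes L: "L \<ge> 1"
  shows "u\<^sup>2 \<le> L + u ^ 4 / L"
proof (cases "u\<^sup>2 \<le> L")
  case False
  then have "u\<^sup>2 * L \<le> u\<^sup>2 * u\<^sup>2" by (intro mult_left_mono) auto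
  then have "u\<^sup>2 \<le> u ^ 4 / L" using L by (simp add: field_simps power4_eq_xxxx power2_eq_square)
  then show ?thesis using L by simp
next
  case True
  moreover have "0 \<le> u ^ 4 / L" using L by simp
  ultimately show ?thesis by linarith
qed

context subgaussian_sequence
begin

lemma integrable_powr_sum:
  assumes q: "0 < q" and A: "finite A" "0 \<notin> A"
  shows "integrable M (\<lambda>\<omega>. norm (\<Sum>n\<in>A. c n * X n \<omega>) powr q)"
proof (rule integrableI_nonneg)
  have "\<And>n. n \<in> A \<Longrightarrow> n \<ge> 1" using A(2) by (metis less_one not_le)
  then have "(\<lambda>\<omega>. \<Sum>n\<in>A. c n * X n \<omega>) \<in> borel_measurable M"
    by (intro borel_measurable_sum borel_measurable_times X_measurable) auto
  then show "(\<lambda>\<omega>. norm (\<Sum>n\<in>A. c n * X n \<omega>) powr q) \<in> borel_measurable M" by simp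
  show "(\<integral>\<^sup>+\<omega>. ennreal (norm (\<Sum>n\<in>A. c n * X n \<omega>) powr q) \<partial>M) < \<infinity>"
    using moment_bound[OF q A, of c] by (rule order.strict_trans1) simp
qed auto

text \<open>A Paley-Zygmund argument localized to \<open>E\<close>. Small values, large values and
  the complement of \<open>E\<close> each take at most \<open>1/8\<close> of the second moment, so
  the \<open>q\<close>-th moment on \<open>E\<close> must account for the rest. The constants are
  uniform in the sum and in the event.\<close>

lemma moment_lower_bound:
  assumes q: "0 < q"
  obtains \<delta> B where "0 < \<delta>" "0 < B"
    "\<forall>E A c. E \<in> events \<longrightarrow> prob E \<ge> 1 - \<delta> \<longrightarrow> finite A \<longrightarrow> 0 \<notin> A \<longrightarrow> (\<Sum>n\<in>A. (norm (c n))\<^sup>2) = 1 \<longrightarrow>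
       1 \<le> ennreal B * (\<integral>\<^sup>+\<omega>. indicator E \<omega> * ennreal (norm (\<Sum>n\<in>A. c n * X n \<omega>) powr q) \<partial>M)"
proof -
  \<comment> \<open>\<open>K\<close> bounds the fourth moment at variance 1.
    \<open>L = 8 * K\<close> makes fourth moment over \<open>L\<close> at most \<open>1/8\<close>,
    and \<delta> makes \<open>L\<close> times the probability of the complement at most
    \<open>1/8\<close>.\<close>
  define K where "K = max 1 (moment_const 4)"
  define L where "L = 8 * K"
  have L: "L \<ge> 1" "K \<ge> 1" by (auto simp: L_def K_def)
  define B0 where "B0 = L * (1/8) powr (- (q/2))"
  have B0: "B0 > 0" using L by (simp add: B0_def)
  define \<delta> where "\<delta> = 1 / (8 * L)"
  show ?thesis
  proof (rule that[of \<delta> "2 * B0"], goal_cases)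
    case 3
    show ?case
    proof (intro allI impI)
      fix E A and c :: "nat \<Rightarrow> complex"
      assume E: "E \<in> events" "prob E \<ge> 1 - \<delta>" and A: "finite A" "0 \<notin> A" and c: "(\<Sum>n\<in>A. (norm (c n))\<^sup>2) = 1"
      define u where "u \<omega> = norm (\<Sum>n\<in>A. c n * X n \<omega>)" for \<omega>
      have i2: "integrable M (\<lambda>\<omega>. (u \<omega>)\<^sup>2)" and e2: "expectation (\<lambda>\<omega>. (u \<omega>)\<^sup>2) = 1"
        using second_moment[OF A, of c] c by (auto simp: u_def)
      have iq: "integrable M (\<lambda>\<omega>. u \<omega> powr q)" unfolding u_def by (rule integrable_powr_sum[OF q A])
      have i4: "integrable M (\<lambda>\<omega>. u \<omega> ^ 4)"
        using integrable_powr_sum[OF _ A, of 4 c] by (simp add: u_def)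
      have e4: "expectation (\<lambda>\<omega>. u \<omega> ^ 4) \<le> K"
      proof -
        have "ennreal (expectation (\<lambda>\<omega>. u \<omega> ^ 4)) = (\<integral>\<^sup>+\<omega>. ennreal (u \<omega> ^ 4) \<partial>M)"
          using i4 by (intro nn_integral_eq_integral[symmetric]) (auto simp: u_def)
        also have "\<dots> \<le> ennreal (moment_const 4)"
          using moment_bound_normalized[of 4, OF _ A, of c] c by (simp add: u_def)
        also have "\<dots> \<le> ennreal K" by (intro ennreal_leI) (simp add: K_def)
        finally show ?thesis using L by simp
      qed
      have iE: "integrable M (\<lambda>\<omega>. indicator E \<omega> * u \<omega> powr q)"
        using integrable_mult_indicator[OF E(1) iq] by simp
      have iEc: "integrable M (\<lambda>\<omega>. indicat_real (space M - E) \<omega>)"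
        using E(1) by (intro integrable_const_bound[of _ 1]) (auto simp: indicator_def)
      have "expectation (\<lambda>\<omega>. (u \<omega>)\<^sup>2) \<le> expectation (\<lambda>\<omega>. 1/8 + B0 * (indicator E \<omega> * u \<omega> powr q) + u \<omega> ^ 4 / L + L * indicator (space M - E) \<omega>)"
      proof (rule integral_mono[OF i2])
        fix \<omega> assume w: "\<omega> \<in> space M"
        have u: "u \<omega> \<ge> 0" by (simp add: u_def)
        show "(u \<omega>)\<^sup>2 \<le> 1/8 + B0 * (indicator E \<omega> * u \<omega> powr q) + u \<omega> ^ 4 / L + L * indicator (space M - E) \<omega>"
          using square_le_truncation[OF u L(1) q] square_le_large[OF L(1), of "u \<omega>"] w
          by (cases "\<omega> \<in> E") (auto simp: B0_def)
      qed (intro Bochner_Integration.integrable_add integrable_mult_right iE iEc integrable_divide i4, simp)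
      also have "\<dots> = 1/8 + B0 * expectation (\<lambda>\<omega>. indicator E \<omega> * u \<omega> powr q) + expectation (\<lambda>\<omega>. u \<omega> ^ 4) / L + L * prob (space M - E)"
        using iE iEc i4 E(1) prob_space by simp
      also have "expectation (\<lambda>\<omega>. u \<omega> ^ 4) / L \<le> 1/8"
        using e4 L by (simp add: L_def field_simps)
      also have "L * prob (space M - E) \<le> 1/8"
      proof -
        have "prob (space M - E) \<le> \<delta>" using prob_compl[OF E(1)] E(2) by simp
        then have "L * prob (space M - E) \<le> L * \<delta>" using L by (intro mult_left_mono) auto
        then show ?thesis using L by (simp add: \<delta>_def)
      qed
      finally have "1 \<le> 2 * B0 * expectation (\<lambda>\<omega>. indicator E \<omega> * u \<omega> powr q)" by (simp add: e2)
      then have "ennreal 1 \<le> ennreal (2 * B0 * expectation (\<lambda>\<omega>. indicator E \<omega> * u \<omega> powr q))" by (rule ennreal_leI)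
      also have "\<dots> = ennreal (2 * B0) * ennreal (expectation (\<lambda>\<omega>. indicator E \<omega> * u \<omega> powr q))"
        using B0 by (intro ennreal_mult) (auto intro!: integral_nonneg_AE)
      also have "ennreal (expectation (\<lambda>\<omega>. indicator E \<omega> * u \<omega> powr q)) = (\<integral>\<^sup>+\<omega>. ennreal (indicator E \<omega> * u \<omega> powr q) \<partial>M)"
        using iE by (intro nn_integral_eq_integral[symmetric]) auto
      also have "\<dots> = (\<integral>\<^sup>+\<omega>. indicator E \<omega> * ennreal (u \<omega> powr q) \<partial>M)"
        by (intro nn_integral_cong) (auto simp: indicator_def)
      finally show "1 \<le> ennreal (2 * B0) * (\<integral>\<^sup>+\<omega>. indicator E \<omega> * ennreal (norm (\<Sum>n\<in>A. c n * X n \<omega>) powr q) \<partial>M)"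
        by (simp add: u_def)
    qed
  qed (use L B0 in \<open>auto simp: \<delta>_def\<close>)
qed

text \<open>The events on which \<open>C\<close> works increase with \<open>C\<close> to almost the
  whole space, so one of them already has probability above \<open>1 - \<delta>\<close>.\<close>

lemma ex_event_uniform_bound:
  fixes F :: "nat \<Rightarrow> 'w \<Rightarrow> ennreal"
  assumes [measurable]: "\<And>i. F i \<in> borel_measurable M" and bd: "AE \<omega> in M. \<exists>C::nat. \<forall>i. F i \<omega> \<le> of_nat C" and \<delta>: "0 < \<delta>"
  obtains E and C :: nat where "E \<in> events" "prob E \<ge> 1 - \<delta>" "\<forall>\<omega>\<in>E. \<forall>i. F i \<omega> \<le> of_nat C"
proof -
  define E where "E C = {\<omega> \<in> space M. \<forall>i. F i \<omega> \<le> of_nat C}" for C :: nat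
  have E[measurable]: "E C \<in> events" for C unfolding E_def by measurable
  have "incseq E"
    unfolding incseq_def
  proof (intro allI impI subsetI)
    fix m n \<omega> assume mn: "m \<le> n" and w: "\<omega> \<in> E m"
    have "(of_nat m :: ennreal) \<le> of_nat n" using mn by (rule of_nat_mono)
    then have "F i \<omega> \<le> of_nat n" for i using w order.trans[of "F i \<omega>" "of_nat m" "of_nat n"] by (simp add: E_def)
    then show "\<omega> \<in> E n" using w by (simp add: E_def)
  qed
  then have "(\<lambda>C. prob (E C)) \<longlonglongrightarrow> prob (\<Union>C. E C)"
    using E by (intro finite_Lim_measure_incseq) auto
  also have "prob (\<Union>C. E C) = 1"
  proof (rule prob_eq_1[THEN iffD2])
    show "AE \<omega> in M. \<omega> \<in> (\<Union>C. E C)" using bd AE_space by eventually_elim (simp add: E_def)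
  qed (use E in blast)
  finally have "\<forall>\<^sub>F C in sequentially. prob (E C) > 1 - \<delta>" using \<delta> by (intro order_tendstoD(1)) auto
  then obtain C where "prob (E C) > 1 - \<delta>" by (auto simp: eventually_sequentially)
  then show ?thesis using E[of C] by (intro that[of "E C" C]) (auto simp: E_def)
qed

text \<open>Fubini turns the bound on the circle into a bound for a fixed point of the circle, where
  the moments of the random sum are comparable to its variance.\<close>

lemma not_uniformly_bounded_random_polynomials:
  fixes c :: "nat \<Rightarrow> nat \<Rightarrow> complex" and e :: "nat \<Rightarrow> nat"
  assumes q: "0 < q" and A: "\<And>i. finite (A i)" "\<And>i. 0 \<notin> A i"
    and unb: "\<And>R. \<exists>i. (\<Sum>n\<in>A i. (norm (c i n))\<^sup>2) > R"
  shows "\<not> (AE \<omega> in M. \<exists>C::real. \<forall>i. (\<integral>z. norm (\<Sum>n\<in>A i. c i n * X n \<omega> * z ^ e n) powr q \<partial>circle_measure) \<le> C)"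
proof
  assume bd: "AE \<omega> in M. \<exists>C::real. \<forall>i. (\<integral>z. norm (\<Sum>n\<in>A i. c i n * X n \<omega> * z ^ e n) powr q \<partial>circle_measure) \<le> C"
  interpret T: prob_space circle_measure by (rule prob_space_circle_measure)
  interpret P: pair_sigma_finite M circle_measure ..
  define G where "G i \<omega> z = ennreal (norm (\<Sum>n\<in>A i. c i n * X n \<omega> * z ^ e n) powr q)" for i \<omega> z
  have A1: "\<And>n i. n \<in> A i \<Longrightarrow> n \<ge> 1" using A(2) by (metis less_one not_le)
  have G[measurable]: "(\<lambda>(\<omega>, z). G i \<omega> z) \<in> borel_measurable (M \<Otimes>\<^sub>M circle_measure)" for i
  proof -
    have [measurable]: "(\<lambda>x. \<Sum>n\<in>A i. c i n * X n (fst x) * snd x ^ e n) \<in> borel_measurable (M \<Otimes>\<^sub>M circle_measure)"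
      using A1 by (intro borel_measurable_sum) auto
    show ?thesis unfolding G_def case_prod_unfold by measurable
  qed
  have G'[measurable]: "(\<lambda>x. G i (snd x) (fst x)) \<in> borel_measurable (circle_measure \<Otimes>\<^sub>M M)" for i
    using measurable_compose[OF measurable_Pair[OF measurable_snd measurable_fst] G[of i]] by simp
  define F where "F i \<omega> = (\<integral>\<^sup>+z. G i \<omega> z \<partial>circle_measure)" for i \<omega>
  have F[measurable]: "F i \<in> borel_measurable M" for i unfolding F_def by measurable
  have F_eq: "F i \<omega> = ennreal (\<integral>z. norm (\<Sum>n\<in>A i. c i n * X n \<omega> * z ^ e n) powr q \<partial>circle_measure)" for i \<omega>
    unfolding F_def G_def using q
    by (intro nn_integral_eq_integral circle_integrable continuous_intros) auto
  have bd': "AE \<omega> in M. \<exists>C::nat. \<forall>i. F i \<omega> \<le> of_nat C"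
    using bd
  proof (eventually_elim, elim exE)
    fix \<omega> and C :: real
    assume C: "\<forall>i. (\<integral>z. norm (\<Sum>n\<in>A i. c i n * X n \<omega> * z ^ e n) powr q \<partial>circle_measure) \<le> C"
    obtain m :: nat where "C \<le> real m" using real_arch_simple by blast
    then have "F i \<omega> \<le> ennreal (real m)" for i
      unfolding F_eq by (rule ennreal_leI[OF order.trans[OF C[rule_format]]])
    then show "\<exists>C::nat. \<forall>i. F i \<omega> \<le> of_nat C" by (auto simp: ennreal_of_nat_eq_real_of_nat intro!: exI[of _ m])
  qed
  obtain \<delta> B where \<delta>: "0 < \<delta>" and B: "0 < B" and low: "\<forall>E A c. E \<in> events \<longrightarrow> prob E \<ge> 1 - \<delta> \<longrightarrow> finite A \<longrightarrow> 0 \<notin> A \<longrightarrow> (\<Sum>n\<in>A. (norm (c n))\<^sup>2) = 1 \<longrightarrow>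
       1 \<le> ennreal B * (\<integral>\<^sup>+\<omega>. indicator E \<omega> * ennreal (norm (\<Sum>n\<in>A. c n * X n \<omega>) powr q) \<partial>M)"
    by (rule moment_lower_bound[OF q])
  obtain E and C :: nat where E: "E \<in> events" "prob E \<ge> 1 - \<delta>" and C: "\<forall>\<omega>\<in>E. \<forall>i. F i \<omega> \<le> of_nat C"
    by (rule ex_event_uniform_bound[of F, OF F bd' \<delta>])
  note [measurable] = E(1)
  have "(\<Sum>n\<in>A i. (norm (c i n))\<^sup>2) \<le> (B * real C + 1) powr (2 / q)" for i
  proof -
    define v where "v = (\<Sum>n\<in>A i. (norm (c i n))\<^sup>2)"
    have "v \<ge> 0" by (simp add: v_def sum_nonneg)
    show ?thesis
    proof (cases "v = 0")
      case False
      then have v: "v > 0" using \<open>v \<ge> 0\<close> by simp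
      define s where "s = sqrt v"
      have s: "s > 0" "s\<^sup>2 = v" using v by (auto simp: s_def)
      \<comment> \<open>\<open>z ^ e n\<close> is unimodular, so after division by \<open>s\<close>
        the coefficients have square sum 1 and the lower bound applies at \<open>z\<close> with
        constants free of \<open>z\<close> and \<open>i\<close>.\<close>
      have low': "ennreal (s powr q) \<le> ennreal B * (\<integral>\<^sup>+\<omega>. indicator E \<omega> * G i \<omega> z \<partial>M)" if z: "norm z = 1" for z
      proof -
        have [measurable]: "(\<lambda>\<omega>. \<Sum>n\<in>A i. c i n * z ^ e n / of_real s * X n \<omega>) \<in> borel_measurable M"
          using A1 by (intro borel_measurable_sum) auto
        have mI: "(\<lambda>\<omega>. indicator E \<omega> * ennreal (norm (\<Sum>n\<in>A i. c i n * z ^ e n / of_real s * X n \<omega>) powr q)) \<in> borel_measurable M"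
          using E(1) by measurable
        have "(\<Sum>n\<in>A i. (norm (c i n * z ^ e n / of_real s))\<^sup>2) = v / s\<^sup>2"
          using z by (simp add: norm_mult norm_power norm_divide power_divide v_def sum_divide_distrib)
        then have "(\<Sum>n\<in>A i. (norm (c i n * z ^ e n / of_real s))\<^sup>2) = 1" using s v by simp
        from low[rule_format, OF E A this]
        have "ennreal (s powr q) * 1 \<le> ennreal (s powr q) * (ennreal B * (\<integral>\<^sup>+\<omega>. indicator E \<omega> * ennreal (norm (\<Sum>n\<in>A i. c i n * z ^ e n / of_real s * X n \<omega>) powr q) \<partial>M))"
          by (rule mult_left_mono) simp
        also have "\<dots> = ennreal B * (\<integral>\<^sup>+\<omega>. ennreal (s powr q) * (indicator E \<omega> * ennreal (norm (\<Sum>n\<in>A i. c i n * z ^ e n / of_real s * X n \<omega>) powr q)) \<partial>M)"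
          by (subst nn_integral_cmult[OF mI]) (simp only: mult.left_commute)
        also have "(\<integral>\<^sup>+\<omega>. ennreal (s powr q) * (indicator E \<omega> * ennreal (norm (\<Sum>n\<in>A i. c i n * z ^ e n / of_real s * X n \<omega>) powr q)) \<partial>M) = (\<integral>\<^sup>+\<omega>. indicator E \<omega> * G i \<omega> z \<partial>M)"
        proof (rule nn_integral_cong)
          fix \<omega>
          have "(\<Sum>n\<in>A i. c i n * X n \<omega> * z ^ e n) = of_real s * (\<Sum>n\<in>A i. c i n * z ^ e n / of_real s * X n \<omega>)"
            using s by (simp add: sum_distrib_left mult_ac)
          then have "norm (\<Sum>n\<in>A i. c i n * X n \<omega> * z ^ e n) = s * norm (\<Sum>n\<in>A i. c i n * z ^ e n / of_real s * X n \<omega>)"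
            using s(1) by (simp only: norm_mult norm_of_real abs_of_pos)
          then have "G i \<omega> z = ennreal (s powr q) * ennreal (norm (\<Sum>n\<in>A i. c i n * z ^ e n / of_real s * X n \<omega>) powr q)"
            unfolding G_def by (simp only: powr_mult ennreal_mult[symmetric] powr_ge_zero)
          then show "ennreal (s powr q) * (indicator E \<omega> * ennreal (norm (\<Sum>n\<in>A i. c i n * z ^ e n / of_real s * X n \<omega>) powr q)) = indicator E \<omega> * G i \<omega> z"
            by (simp only: mult_ac)
        qed
        finally show ?thesis by simp
      qed
      \<comment> \<open>Averaging the lower bound over the circle and exchanging the integrals
        produces \<open>F i\<close>, which is at most \<open>C\<close> on \<open>E\<close>; the
        resulting bound on \<open>s\<close> does not involve \<open>i\<close>.\<close>
      have "ennreal (s powr q) = (\<integral>\<^sup>+z. ennreal (s powr q) \<partial>circle_measure)"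
        using T.emeasure_space_1 by simp
      also have "\<dots> \<le> (\<integral>\<^sup>+z. ennreal B * (\<integral>\<^sup>+\<omega>. indicator E \<omega> * G i \<omega> z \<partial>M) \<partial>circle_measure)"
        using AE_circle_norm low' by (intro nn_integral_mono_AE) auto
      also have "\<dots> = ennreal B * (\<integral>\<^sup>+z. (\<integral>\<^sup>+\<omega>. indicator E \<omega> * G i \<omega> z \<partial>M) \<partial>circle_measure)"
        using E(1) by (intro nn_integral_cmult) measurable
      also have "(\<integral>\<^sup>+z. (\<integral>\<^sup>+\<omega>. indicator E \<omega> * G i \<omega> z \<partial>M) \<partial>circle_measure) = (\<integral>\<^sup>+\<omega>. (\<integral>\<^sup>+z. indicator E \<omega> * G i \<omega> z \<partial>circle_measure) \<partial>M)"
        using E(1) by (intro P.Fubini') measurable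
      also have "\<dots> = (\<integral>\<^sup>+\<omega>. indicator E \<omega> * F i \<omega> \<partial>M)"
        unfolding F_def by (intro nn_integral_cong nn_integral_cmult) measurable
      also have "\<dots> \<le> (\<integral>\<^sup>+\<omega>. of_nat C \<partial>M)"
        using C by (intro nn_integral_mono) (auto simp: indicator_def)
      also have "\<dots> = of_nat C" using emeasure_space_1 by simp
      finally have "ennreal (s powr q) \<le> ennreal B * of_nat C" by (simp add: mult_left_mono)
      also have "\<dots> = ennreal (B * real C)" using B by (simp add: ennreal_mult ennreal_of_nat_eq_real_of_nat)
      finally have "s powr q \<le> B * real C + 1" using B by simp
      then have "(s powr q) powr (2 / q) \<le> (B * real C + 1) powr (2 / q)" using q by (intro powr_mono2) auto
      moreover have "(s powr q) powr (2 / q) = v" using s q by (simp add: powr_powr)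
      ultimately show ?thesis by (simp add: v_def)
    qed (simp add: v_def)
  qed
  moreover obtain i where "(\<Sum>n\<in>A i. (norm (c i n))\<^sup>2) > (B * real C + 1) powr (2 / q)" using unb by blast
  ultimately show False using not_less by blast
qed

end

section \<open>An element without square summable coefficients\<close>

text \<open>For each \<open>i\<close> an approximant \<open>P k\<close> is taken whose finitely many
  relevant coefficients are within 1 of those of \<open>b\<close> in total, so the error is at most
  1 on the circle. How late \<open>k\<close> must be depends on \<open>i\<close>, but the bound
  \<open>B\<close> on \<open>P k\<close> does not.\<close>

lemma Hp_space_dilation_bounded:
  assumes q: "0 < q" and b: "b \<in> Hp_space q"
    and J: "\<And>i Q. (\<integral>z. norm (\<Sum>j\<le>J i. coeff Q j * of_real (r i ^ j) * z ^ j) powr q \<partial>circle_measure)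
      \<le> 2 powr q * 2 * (\<integral>z. norm (poly Q z) powr q \<partial>circle_measure)"
    and r: "\<And>i. 0 \<le> r i" "\<And>i. r i \<le> 1"
  shows "\<exists>C. \<forall>i. (\<integral>z. norm (\<Sum>j\<le>J i. b (nth_prime 0 ^ j) * of_real (r i ^ j) * z ^ j) powr q \<partial>circle_measure) \<le> C"
proof -
  obtain P where P: "\<And>k. P k \<in> dirichlet_polynomials" "Hp_Cauchy q P" and lim: "\<And>m. m \<ge> 1 \<Longrightarrow> (\<lambda>k. P k m) \<longlonglongrightarrow> b m"
    using Hp_spaceE[OF b] by blast
  obtain K B where B: "\<And>k. k \<ge> K \<Longrightarrow> lift_int q (P k) \<le> B"
    using lift_int_Cauchy_bounded[OF q P] by blast
  let ?p = "nth_prime 0"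
  have p1: "?p ^ j \<ge> 1" for j using nth_prime_gt_1[of 0] by (intro one_le_power) simp
  show ?thesis
  proof (intro exI allI)
    fix i
    have "(\<lambda>k. \<Sum>j\<le>J i. norm (b (?p ^ j) - P k (?p ^ j))) \<longlonglongrightarrow> (\<Sum>j\<le>J i. norm (b (?p ^ j) - b (?p ^ j)))"
      by (intro tendsto_intros lim p1)
    then have "\<forall>\<^sub>F k in sequentially. (\<Sum>j\<le>J i. norm (b (?p ^ j) - P k (?p ^ j))) < 1"
      by (intro order_tendstoD(2)) auto
    then have "\<forall>\<^sub>F k in sequentially. k \<ge> K \<and> (\<Sum>j\<le>J i. norm (b (?p ^ j) - P k (?p ^ j))) < 1"
      by (intro eventually_conj eventually_ge_at_top)
    then obtain k where k: "k \<ge> K" "(\<Sum>j\<le>J i. norm (b (?p ^ j) - P k (?p ^ j))) < 1"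
      by (metis (mono_tags, lifting) eventually_happens trivial_limit_sequentially)
    obtain Q :: "complex poly" where Q: "\<And>j. coeff Q j = P k (?p ^ j)" "(\<integral>x. norm (poly Q x) powr q \<partial>circle_measure) \<le> lift_int q (P k)"
      using lift_int_restrict_powers[OF dirichlet_polynomials_finite[OF P(1)] q] by blast
    define T where "T z = (\<Sum>j\<le>J i. coeff Q j * of_real (r i ^ j) * z ^ j)" for z
    have "(\<integral>z. norm (\<Sum>j\<le>J i. b (?p ^ j) * of_real (r i ^ j) * z ^ j) powr q \<partial>circle_measure)
      \<le> (\<integral>z. 2 powr q * (norm (T z) powr q + 1) \<partial>circle_measure)"
    proof (rule integral_circle_mono)
      fix z :: complex assume z: "norm z = 1"
      define D where "D = (\<Sum>j\<le>J i. (b (?p ^ j) - P k (?p ^ j)) * of_real (r i ^ j) * z ^ j)"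
      have "norm D \<le> (\<Sum>j\<le>J i. norm (b (?p ^ j) - P k (?p ^ j)))"
        unfolding D_def using z r[of i] by (intro sum_norm_le) (auto simp: norm_mult norm_power mult_left_le power_le_one)
      then have "norm D powr q \<le> 1 powr q" using k q by (intro powr_mono2) auto
      moreover have "(\<Sum>j\<le>J i. b (?p ^ j) * of_real (r i ^ j) * z ^ j) = T z + D"
        by (simp add: T_def D_def Q(1) left_diff_distrib sum_subtractf)
      moreover have "norm (T z + D) powr q \<le> 2 powr q * (norm (T z) powr q + norm D powr q)"
        by (rule powr_norm_add_le[OF q])
      ultimately show "norm (\<Sum>j\<le>J i. b (?p ^ j) * of_real (r i ^ j) * z ^ j) powr q \<le> 2 powr q * (norm (T z) powr q + 1)"
        by (simp, elim order.trans) simp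
    qed (unfold T_def, (intro continuous_intros q)+)
    also have "\<dots> = 2 powr q * ((\<integral>z. norm (T z) powr q \<partial>circle_measure) + 1)"
      by (simp add: circle_integral_add_const continuous_intros q T_def)
    also have "(\<integral>z. norm (T z) powr q \<partial>circle_measure) \<le> 2 powr q * 2 * (\<integral>z. norm (poly Q z) powr q \<partial>circle_measure)"
      unfolding T_def by (rule J)
    also have "(\<integral>z. norm (poly Q z) powr q \<partial>circle_measure) \<le> B"
      using Q(2) B[OF k(1)] by linarith
    finally show "(\<integral>z. norm (\<Sum>j\<le>J i. b (?p ^ j) * of_real (r i ^ j) * z ^ j) powr q \<partial>circle_measure) \<le> 2 powr q * (2 powr q * 2 * B + 1)"
      by (simp add: mult_left_mono)
  qed
qed

lemma AE_circle_dirichlet_kernel_tendsto_0: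
  "AE z in circle_measure. (\<lambda>L. norm (\<Sum>j<L. z ^ j) / sqrt (real L)) \<longlonglongrightarrow> 0"
  using AE_circle_norm AE_circle_ne_1
proof eventually_elim
  fix z :: complex assume z: "norm z = 1" "z \<noteq> 1"
  show "(\<lambda>L. norm (\<Sum>j<L. z ^ j) / sqrt (real L)) \<longlonglongrightarrow> 0"
  proof (rule Lim_null_comparison)
    show "\<forall>\<^sub>F L in sequentially. norm (norm (\<Sum>j<L. z ^ j) / sqrt (real L)) \<le> 2 / norm (1 - z) * inverse (sqrt (real L))"
    proof (intro always_eventually allI)
      fix L
      have "norm (\<Sum>j<L. z ^ j) = norm (1 - z ^ L) / norm (1 - z)"
        using z(2) by (simp only: sum_gp_strict if_False norm_divide)
      also have "\<dots> \<le> 2 / norm (1 - z)"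
      proof (rule divide_right_mono)
        have "norm (z ^ L) = 1" using z(1) by (simp add: norm_power)
        then show "norm (1 - z ^ L) \<le> 2" using norm_triangle_ineq4[of 1 "z ^ L"] by simp
      qed simp
      finally have "norm (\<Sum>j<L. z ^ j) * inverse (sqrt (real L)) \<le> 2 / norm (1 - z) * inverse (sqrt (real L))"
        by (rule mult_right_mono) simp
      then show "norm (norm (\<Sum>j<L. z ^ j) / sqrt (real L)) \<le> 2 / norm (1 - z) * inverse (sqrt (real L))"
        by (simp add: divide_inverse)
    qed
    have "(\<lambda>L. inverse (sqrt (real L))) \<longlonglongrightarrow> 0"
      by (intro tendsto_inverse_0_at_top filterlim_compose[OF sqrt_at_top] filterlim_real_sequentially)
    then show "(\<lambda>L. 2 / norm (1 - z) * inverse (sqrt (real L))) \<longlonglongrightarrow> 0" by (rule tendsto_mult_right_zero)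
  qed
qed

text \<open>The normalized kernels tend to 0 almost everywhere while their second moments stay
  bounded. Below height \<open>R\<close> dominated convergence applies; above it,
  \<open>p < 2\<close> gives at most \<open>R powr (p - 2)\<close> times the second moment.\<close>

lemma dirichlet_kernel_Lp_tendsto_0:
  assumes p: "0 < p" "p < 2"
  shows "(\<lambda>L. \<integral>z. (norm (\<Sum>j<L. z ^ j) / sqrt (real L)) powr p \<partial>circle_measure) \<longlonglongrightarrow> 0"
proof (rule LIMSEQ_I)
  interpret T: prob_space circle_measure by (rule prob_space_circle_measure)
  fix e :: real assume e: "0 < e"
  define u where "u L z = norm (\<Sum>j<L. z ^ j) / sqrt (real L)" for L and z :: complex
  have u0: "0 \<le> u L z" for L z by (simp add: u_def)
  have cu: "continuous_on UNIV (u L)" for L unfolding u_def divide_inverse by (intro continuous_intros)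
  have u2: "(\<integral>z. (u L z)\<^sup>2 \<partial>circle_measure) \<le> 1" for L
  proof -
    have "(\<integral>z. (u L z)\<^sup>2 \<partial>circle_measure) = (\<integral>z. (norm (\<Sum>j<L. 1 * z ^ j))\<^sup>2 / real L \<partial>circle_measure)"
      by (simp add: u_def power_divide)
    also have "\<dots> = (\<integral>z. (norm (\<Sum>j<L. 1 * z ^ j))\<^sup>2 \<partial>circle_measure) / real L" by (rule integral_divide_zero)
    also have "\<dots> = real L / real L" by (subst circle_parseval) auto
    finally show ?thesis by simp
  qed
  \<comment> \<open>Solves \<open>R powr (p - 2) = e / 2\<close>; the exponent \<open>p - 2\<close>
    is negative, so a small \<open>e\<close> means a large \<open>R\<close>.\<close>
  define R where "R = (e / 2) powr (1 / (p - 2))"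
  have R: "R > 0" "R powr (p - 2) = e / 2" using e p by (auto simp: R_def powr_powr)
  have "(\<lambda>L. \<integral>z. (min (u L z) R) powr p \<partial>circle_measure) \<longlonglongrightarrow> (\<integral>z. 0 \<partial>circle_measure)"
  proof (rule integral_dominated_convergence)
    show "AE z in circle_measure. (\<lambda>L. (min (u L z) R) powr p) \<longlonglongrightarrow> 0"
      using AE_circle_dirichlet_kernel_tendsto_0
    proof eventually_elim
      fix z :: complex assume "(\<lambda>L. norm (\<Sum>j<L. z ^ j) / sqrt (real L)) \<longlonglongrightarrow> 0"
      then have "(\<lambda>L. min (u L z) R) \<longlonglongrightarrow> min 0 R" unfolding u_def by (intro tendsto_min tendsto_const)
      then have "(\<lambda>L. min (u L z) R) \<longlonglongrightarrow> 0" using R by simp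
      then have "(\<lambda>L. (min (u L z) R) powr p) \<longlonglongrightarrow> 0 powr p"
        using p u0 R by (intro tendsto_powr') (auto simp: less_imp_le)
      then show "(\<lambda>L. (min (u L z) R) powr p) \<longlonglongrightarrow> 0" by simp
    qed
    show "AE z in circle_measure. norm ((min (u L z) R) powr p) \<le> R powr p" for L
      using u0 R p by (auto intro!: powr_mono2)
    have [measurable]: "u L \<in> borel_measurable borel" for L using cu by (rule borel_measurable_continuous_onI)
    show "(\<lambda>z. (min (u L z) R) powr p) \<in> borel_measurable circle_measure" for L by measurable
  qed auto
  then have "\<forall>\<^sub>F L in sequentially. (\<integral>z. (min (u L z) R) powr p \<partial>circle_measure) < e / 2"
    using e by (intro order_tendstoD(2)) auto
  then obtain L0 where L0: "\<And>L. L \<ge> L0 \<Longrightarrow> (\<integral>z. (min (u L z) R) powr p \<partial>circle_measure) < e / 2"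
    by (auto simp: eventually_sequentially)
  have "norm ((\<integral>z. (u L z) powr p \<partial>circle_measure) - 0) < e" if L: "L \<ge> L0" for L
  proof -
    have c1: "continuous_on UNIV (\<lambda>z. (min (u L z) R) powr p)"
      using p u0 R by (intro continuous_on_powr' continuous_intros cu) (auto simp: less_imp_le)
    have "(\<integral>z. (u L z) powr p \<partial>circle_measure) \<le> (\<integral>z. (min (u L z) R) powr p + e / 2 * (u L z)\<^sup>2 \<partial>circle_measure)"
    proof (rule integral_circle_mono)
      fix z
      show "u L z powr p \<le> (min (u L z) R) powr p + e / 2 * (u L z)\<^sup>2"
      proof (cases "u L z \<le> R")
        case True
        then show ?thesis using e by (simp add: min_def)
      next
        case False
        then have "u L z powr p = u L z powr (p - 2) * u L z powr 2" by (subst powr_add[symmetric]) simp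
        also have "\<dots> = u L z powr (p - 2) * (u L z)\<^sup>2" using u0 by simp
        also have "u L z powr (p - 2) \<le> R powr (p - 2)"
          using False R p by (intro powr_mono2') auto
        finally have "u L z powr p \<le> e / 2 * (u L z)\<^sup>2" using R by (simp add: mult_right_mono)
        then show ?thesis by (simp add: add_increasing)
      qed
    qed (use p u0 in \<open>auto intro!: continuous_intros c1 cu continuous_on_powr'\<close>)
    also have "\<dots> = (\<integral>z. (min (u L z) R) powr p \<partial>circle_measure) + e / 2 * (\<integral>z. (u L z)\<^sup>2 \<partial>circle_measure)"
      by (simp add: circle_integrable c1 continuous_intros cu)
    also have "\<dots> < e / 2 + e / 2 * 1"
      using L0[OF L] u2[of L] e by (intro add_less_le_mono mult_left_mono) auto
    finally show ?thesis by (simp add: integral_nonneg_AE)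
  qed
  then show "\<exists>L0. \<forall>L\<ge>L0. norm ((\<integral>z. (norm (\<Sum>j<L. z ^ j) / sqrt (real L)) powr p \<partial>circle_measure) - 0) < e"
    unfolding u_def by blast
qed

text \<open>The coefficients on the powers of the first prime are grouped into normalized Dirichlet
  kernels: each contributes \<open>1\<close> to the square sum but arbitrarily little to the \<open>p\<close>-th mean.\<close>

lemma ex_Hp_space_not_square_summable:
  assumes p: "0 < p" "p < 2"
  obtains a where "a \<in> Hp_space p" "\<forall>R. \<exists>m. (\<Sum>j\<le>m. (norm (a (nth_prime 0 ^ j)))\<^sup>2) > R"
proof -
  let ?P = "nth_prime 0"
  have P1: "?P > 1" by (rule nth_prime_gt_1)
  define I where "I L = (\<integral>z. (norm (\<Sum>j<L. z ^ j) / sqrt (real L)) powr p \<partial>circle_measure)" for L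
  \<comment> \<open>The kernel length is chosen so that the weight \<open>(2 ^ k) powr p\<close> of
    \<open>Hp_spaceI\<close> still leaves \<open>(1/2) ^ k\<close>.\<close>
  have "\<exists>L\<ge>1. I L < (1/2) ^ k / (2 ^ k) powr p" for k :: nat
  proof -
    have "\<forall>\<^sub>F L in sequentially. I L < (1/2) ^ k / (2 ^ k) powr p"
      using dirichlet_kernel_Lp_tendsto_0[OF p] unfolding I_def by (rule order_tendstoD(2)) simp
    then have "\<forall>\<^sub>F L in sequentially. L \<ge> 1 \<and> I L < (1/2) ^ k / (2 ^ k) powr p"
      by (intro eventually_conj eventually_ge_at_top)
    then show ?thesis by (auto simp: eventually_sequentially)
  qed
  then obtain L where L: "\<And>k. L k \<ge> 1" "\<And>k. I (L k) < (1/2) ^ k / (2 ^ k) powr p" by metis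
  define K where "K k = (\<Sum>i<k. L i)" for k
  have K_Suc: "K (Suc k) = K k + L k" for k by (simp add: K_def)
  have K: "strict_mono K" using L(1) by (intro strict_monoI_Suc) (simp add: K_Suc Suc_le_eq)
  \<comment> \<open>The least such \<open>k\<close> is the index of the block
    \<open>{K k..<K (Suc k)}\<close> containing \<open>j\<close>.\<close>
  define \<alpha> where "\<alpha> j = 1 / sqrt (real (L (LEAST k. j < K (Suc k))))" for j
  have \<alpha>: "\<alpha> j = 1 / sqrt (real (L k))" if "j \<in> {K k..<K (Suc k)}" for j k
  proof -
    have "(LEAST k. j < K (Suc k)) = k"
    proof (rule Least_equality)
      fix l assume "j < K (Suc l)"
      then have "K k < K (Suc l)" using that by simp
      then show "k \<le> l" using strict_mono_less[OF K] by simp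
    qed (use that in simp)
    then show ?thesis by (simp add: \<alpha>_def)
  qed
  have \<alpha>1: "0 \<le> \<alpha> j" "\<alpha> j \<le> 1" for j
  proof -
    have "sqrt (real (L (LEAST k. j < K (Suc k)))) \<ge> 1" using L(1) by simp
    then show "0 \<le> \<alpha> j" "\<alpha> j \<le> 1" by (auto simp: \<alpha>_def)
  qed
  define a where "a n = (if n \<in> range (\<lambda>j. ?P ^ j) then complex_of_real (\<alpha> (nu 0 n)) else 0)" for n
  have a: "a (?P ^ j) = of_real (\<alpha> j)" for j by (simp add: a_def nu_power)
  define N where "N k = ?P ^ K k" for k
  have Pmono: "strict_mono (\<lambda>j. ?P ^ j)" using P1 by (intro strict_monoI power_strict_increasing)
  have N: "strict_mono N" "N 0 \<ge> 1"
    using K Pmono by (auto simp: N_def strict_mono_def K_def)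
  have "a \<in> Hp_space p"
  proof (rule Hp_spaceI[OF p(1) N])
    fix \<sigma> :: real assume "\<sigma> > 1/2"
    then have \<sigma>: "\<sigma> > 0" by simp
    define f where "f n = norm (a n) * real n powr (- \<sigma>)" for n
    \<comment> \<open>The support is so sparse that bounded coefficients suffice: along powers of
      the prime the terms decay geometrically for every positive \<sigma>.\<close>
    have "summable (\<lambda>j. f (?P ^ j))"
    proof (rule summable_comparison_test'[where g = "\<lambda>j. (real ?P powr (- \<sigma>)) ^ j" and N = 0])
      have "real ?P powr (- \<sigma>) < 1 powr (- \<sigma>)" using P1 \<sigma> by (intro powr_less_mono2_neg) auto
      then show "summable (\<lambda>j. (real ?P powr (- \<sigma>)) ^ j)" by (intro summable_geometric) simp
      fix j
      have "real (?P ^ j) powr (- \<sigma>) = (real ?P powr (- \<sigma>)) ^ j"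
        using P1 by (simp add: powr_powr mult.commute flip: powr_realpow)
      then show "norm (f (?P ^ j)) \<le> (real ?P powr (- \<sigma>)) ^ j"
        using \<alpha>1[of j] by (simp add: f_def a mult_left_le_one_le)
    qed
    moreover have "f n = 0" if "n \<notin> range (\<lambda>j. ?P ^ j)" for n using that by (simp add: f_def a_def)
    ultimately have "summable f" using summable_mono_reindex[OF Pmono, of f] by blast
    then show "summable (\<lambda>n. norm (a n) * real n powr (- \<sigma>))" by (simp only: f_def[abs_def])
  next
    have lift: "lift_int p (block N a k) = I (L k)" for k
    proof -
      have mem: "?P ^ j \<in> {N k..<N (Suc k)} \<longleftrightarrow> j \<in> {K k..<K (Suc k)}" for j
        using strict_mono_less[OF Pmono] strict_mono_less_eq[OF Pmono] by (simp add: N_def)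
      have "block N a k = (\<lambda>n. if n \<in> (\<lambda>j. ?P ^ j) ` {K k..<K (Suc k)} then a n else 0)"
      proof
        fix n
        show "block N a k n = (if n \<in> (\<lambda>j. ?P ^ j) ` {K k..<K (Suc k)} then a n else 0)"
        proof (cases "n \<in> range (\<lambda>j. ?P ^ j)")
          case True
          then obtain j where j: "n = ?P ^ j" by blast
          then have "n \<in> (\<lambda>j. ?P ^ j) ` {K k..<K (Suc k)} \<longleftrightarrow> j \<in> {K k..<K (Suc k)}"
            using inj_image_mem_iff[OF inj_nth_prime_power[of 0]] by simp
          then show ?thesis using mem[of j] unfolding block_def j by presburger
        next
          case False
          then have "a n = 0" by (simp add: a_def)
          then show ?thesis by (simp add: block_def)
        qed
      qed
      then have "lift_int p (block N a k) = (\<integral>x. norm (\<Sum>j\<in>{K k..<K (Suc k)}. a (?P ^ j) * x ^ j) powr p \<partial>circle_measure)"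
        using lift_int_powers[of "{K k..<K (Suc k)}" p 0 a] by simp
      also have "\<dots> = I (L k)"
        unfolding I_def
      proof (rule integral_cong_AE)
        show "AE x in circle_measure. norm (\<Sum>j\<in>{K k..<K (Suc k)}. a (?P ^ j) * x ^ j) powr p = (norm (\<Sum>j<L k. x ^ j) / sqrt (real (L k))) powr p"
          using AE_circle_norm
        proof eventually_elim
          fix x :: complex assume x: "norm x = 1"
          have "(\<Sum>j\<in>{K k..<K (Suc k)}. a (?P ^ j) * x ^ j) = (\<Sum>j\<in>{K k..<K (Suc k)}. of_real (1 / sqrt (real (L k))) * x ^ j)"
            by (intro sum.cong refl) (simp add: a \<alpha>)
          also have "\<dots> = (\<Sum>j<L k. of_real (1 / sqrt (real (L k))) * x ^ (K k + j))"
            by (rule sum.reindex_bij_witness[of _ "\<lambda>j. K k + j" "\<lambda>j. j - K k"]) (auto simp: K_Suc)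
          \<comment> \<open>Shifting the block down to degree 0 costs only the factor
            \<open>x ^ K k\<close>, which is unimodular.\<close>
          also have "\<dots> = of_real (1 / sqrt (real (L k))) * x ^ K k * (\<Sum>j<L k. x ^ j)"
            by (simp add: power_add sum_distrib_left sum_divide_distrib mult_ac)
          finally have "norm (\<Sum>j\<in>{K k..<K (Suc k)}. a (?P ^ j) * x ^ j) = norm (\<Sum>j<L k. x ^ j) / sqrt (real (L k))"
            using x by (simp add: norm_mult norm_power norm_divide)
          then show "norm (\<Sum>j\<in>{K k..<K (Suc k)}. a (?P ^ j) * x ^ j) powr p = (norm (\<Sum>j<L k. x ^ j) / sqrt (real (L k))) powr p"
            by simp
        qed
      qed measurable
      finally show ?thesis .
    qed
    show "summable (\<lambda>k. (2 ^ k) powr p * lift_int p (block N a k))"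
    proof (rule summable_comparison_test'[where g = "\<lambda>k. (1/2) ^ k" and N = 0])
      fix k :: nat
      have "(2 ^ k) powr p * I (L k) \<le> (2 ^ k) powr p * ((1/2) ^ k / (2 ^ k) powr p)"
        using L(2)[of k] by (intro mult_left_mono) auto
      then show "norm ((2 ^ k) powr p * lift_int p (block N a k)) \<le> (1/2) ^ k"
        using lift_int_nonneg[of p "block N a k"] by (simp add: lift abs_mult)
    qed (simp add: summable_geometric)
  qed
  moreover have "\<exists>m. (\<Sum>j\<le>m. (norm (a (?P ^ j)))\<^sup>2) > R" for R
  proof -
    \<comment> \<open>Block \<open>k\<close> consists of \<open>L k\<close> coefficients of squared
      modulus \<open>1 / L k\<close>, hence adds exactly 1.\<close>
    have "(\<Sum>j<K k. (norm (a (?P ^ j)))\<^sup>2) = real k" for k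
    proof (induction k)
      case (Suc k)
      have "(\<Sum>j<K (Suc k). (norm (a (?P ^ j)))\<^sup>2) = (\<Sum>j<K k. (norm (a (?P ^ j)))\<^sup>2) + (\<Sum>j\<in>{K k..<K (Suc k)}. (norm (a (?P ^ j)))\<^sup>2)"
        by (subst sum.union_disjoint[symmetric]) (auto intro!: sum.cong simp: K_Suc)
      also have "(\<Sum>j\<in>{K k..<K (Suc k)}. (norm (a (?P ^ j)))\<^sup>2) = (\<Sum>j\<in>{K k..<K (Suc k)}. 1 / real (L k))"
        by (intro sum.cong refl) (simp add: a \<alpha> norm_divide power_divide)
      also have "\<dots> = 1" using L(1)[of k] by (simp add: K_Suc)
      finally show ?case using Suc by simp
    qed (simp add: K_def)
    moreover obtain k where "R < real k" using reals_Archimedean2 by blast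
    ultimately have "R < (\<Sum>j<K k. (norm (a (?P ^ j)))\<^sup>2)" by simp
    also have "\<dots> \<le> (\<Sum>j\<le>K k. (norm (a (?P ^ j)))\<^sup>2)" by (intro sum_mono2) auto
    finally show ?thesis by blast
  qed
  ultimately show ?thesis using that by blast
qed

section \<open>The two directions of the equivalence\<close>

theorem theorem1p2:
  fixes p q :: real
    and M :: "'w measure"
    and X :: "nat \<Rightarrow> 'w \<Rightarrow> complex"
  assumes "0 < p" and "0 < q"
    and "standard_random_sequence M X"
  shows "(\<forall>f \<in> Hp_space p. AE \<omega> in M. randomization X f \<omega> \<in> Hp_space q) \<longleftrightarrow> p \<ge> 2"
proof
  interpret subgaussian_sequence M X
    by (rule subgaussian_sequence_if_standard[OF assms(3)])
  show "\<forall>f \<in> Hp_space p. AE \<omega> in M. randomization X f \<omega> \<in> Hp_space q" if "p \<ge> 2"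
    by (intro ballI AE_randomization_in_Hp_space assms(2) Hp_space_square_summable[OF that])
  assume all: "\<forall>f \<in> Hp_space p. AE \<omega> in M. randomization X f \<omega> \<in> Hp_space q"
  show "p \<ge> 2"
  proof (rule ccontr)
    assume "\<not> p \<ge> 2"
    then have p2: "p < 2" by simp
    let ?P = "nth_prime 0"
    obtain a where a: "a \<in> Hp_space p" and unb: "\<forall>R. \<exists>m. (\<Sum>j\<le>m. (norm (a (?P ^ j)))\<^sup>2) > R"
      by (rule ex_Hp_space_not_square_summable[OF assms(1) p2])
    \<comment> \<open>Strictly below 1, as the truncation lemma requires, and tending to 1, so that
      the dilated square sums still become arbitrarily large.\<close>
    define r where "r i = 1 - 1 / real (i + 2)" for i
    have r: "0 \<le> r i" "r i < 1" for i by (auto simp: r_def)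
    have r1: "r \<longlonglongrightarrow> 1"
    proof -
      have "(\<lambda>i. 1 - 1 / real (i + 2)) \<longlonglongrightarrow> 1 - 0"
        using LIMSEQ_ignore_initial_segment[OF lim_1_over_n, of 2] by (intro tendsto_diff tendsto_const) simp
      then show ?thesis by (simp add: r_def[abs_def])
    qed
    define good where "good i J \<longleftrightarrow> (\<forall>Q::complex poly. (\<integral>z. norm (\<Sum>j\<le>J. coeff Q j * of_real (r i ^ j) * z ^ j) powr q \<partial>circle_measure)
      \<le> 2 powr q * 2 * (\<integral>z. norm (poly Q z) powr q \<partial>circle_measure))" for i J
    \<comment> \<open>Besides admitting the truncation bound, the degree must be at least
      \<open>i\<close>, so that every fixed section is eventually contained in the sum.\<close>
    have "\<exists>J. J \<ge> i \<and> good i J" for i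
    proof -
      obtain J0 where "\<forall>J\<ge>J0. good i J"
        using dilation_truncation[OF assms(2) r(1)[of i] r(2)[of i]] unfolding good_def by blast
      then show ?thesis by (intro exI[of _ "max i J0"]) simp
    qed
    then obtain J where J: "\<And>i. J i \<ge> i" and JQ: "\<And>i. good i (J i)" by metis
    \<comment> \<open>The random sum is indexed by the powers themselves, matching the indices of
      \<open>X\<close>; \<open>nu 0\<close> recovers the exponent of \<open>z\<close>, and the
      dilation factor goes into the deterministic coefficients.\<close>
    define A where "A i = (\<lambda>j. ?P ^ j) ` {..J i}" for i
    define c where "c i n = a n * of_real (r i ^ nu 0 n)" for i n
    have A: "finite (A i)" "0 \<notin> A i" for i using nth_prime_gt_1[of 0] by (auto simp: A_def)
    have sumA: "(\<Sum>n\<in>A i. g n) = (\<Sum>j\<le>J i. g (?P ^ j))" for i and g :: "nat \<Rightarrow> 'b::comm_monoid_add"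
      unfolding A_def by (simp add: sum.reindex inj_on_subset[OF inj_nth_prime_power])
    have "\<exists>i. (\<Sum>n\<in>A i. (norm (c i n))\<^sup>2) > R" for R
    proof -
      obtain m where m: "(\<Sum>j\<le>m. (norm (a (?P ^ j)))\<^sup>2) > R" using unb by blast
      have "(\<lambda>i. \<Sum>j\<le>m. (norm (a (?P ^ j)) * r i ^ j)\<^sup>2) \<longlonglongrightarrow> (\<Sum>j\<le>m. (norm (a (?P ^ j)) * 1 ^ j)\<^sup>2)"
        by (intro tendsto_intros r1)
      then have "\<forall>\<^sub>F i in sequentially. (\<Sum>j\<le>m. (norm (a (?P ^ j)) * r i ^ j)\<^sup>2) > R"
        using m by (intro order_tendstoD(1)) auto
      then have "\<forall>\<^sub>F i in sequentially. i \<ge> m \<and> (\<Sum>j\<le>m. (norm (a (?P ^ j)) * r i ^ j)\<^sup>2) > R"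
        by (intro eventually_conj eventually_ge_at_top)
      then obtain i where i: "i \<ge> m" "(\<Sum>j\<le>m. (norm (a (?P ^ j)) * r i ^ j)\<^sup>2) > R"
        by (auto simp: eventually_sequentially)
      have "(\<Sum>j\<le>m. (norm (a (?P ^ j)) * r i ^ j)\<^sup>2) \<le> (\<Sum>j\<le>J i. (norm (a (?P ^ j)) * r i ^ j)\<^sup>2)"
        using i(1) J[of i] by (intro sum_mono2) auto
      also have "\<dots> = (\<Sum>n\<in>A i. (norm (c i n))\<^sup>2)"
        using r(1)[of i] by (simp add: sumA c_def nu_power norm_mult norm_power)
      finally show ?thesis using i(2) by (intro exI[of _ i]) simp
    qed
    then have "\<not> (AE \<omega> in M. \<exists>C::real. \<forall>i. (\<integral>z. norm (\<Sum>n\<in>A i. c i n * X n \<omega> * z ^ nu 0 n) powr q \<partial>circle_measure) \<le> C)"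
      by (intro not_uniformly_bounded_random_polynomials assms(2) A)
    moreover have "AE \<omega> in M. \<exists>C::real. \<forall>i. (\<integral>z. norm (\<Sum>n\<in>A i. c i n * X n \<omega> * z ^ nu 0 n) powr q \<partial>circle_measure) \<le> C"
      using bspec[OF all a]
    proof eventually_elim
      fix \<omega> assume w: "randomization X a \<omega> \<in> Hp_space q"
      have "(\<Sum>n\<in>A i. c i n * X n \<omega> * z ^ nu 0 n) = (\<Sum>j\<le>J i. randomization X a \<omega> (?P ^ j) * of_real (r i ^ j) * z ^ j)" for i z
        by (simp add: sumA c_def nu_power randomization_def mult_ac)
      then show "\<exists>C::real. \<forall>i. (\<integral>z. norm (\<Sum>n\<in>A i. c i n * X n \<omega> * z ^ nu 0 n) powr q \<partial>circle_measure) \<le> C"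
        using Hp_space_dilation_bounded[OF assms(2) w JQ[unfolded good_def, rule_format] r(1) less_imp_le[OF r(2)]] by simp
    qed
    ultimately show False by blast
  qed
qed

end
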